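(* Let $f:\mathbb{R}^d\to\mathbb{R}^D$ be a $C^k$ function and let $(X,Y)$ be a pair of random variables with values in $\mathbb{R}^d\times\mathbb{R}^D$ such that: (i) the distribution of $X$ is absolutely continuous, and its density is bounded away from zero and from infinity on an open neighborhood $U$ of the origin of $\mathbb{R}^d$; (ii) $f(x)=\mathbb{E}(Y\mid X=x)$; (iii) the noise $Z=f(X)-Y$ satisfies $\|\operatorname{cov}(Z\mid X=x)\|_{op}=\|\operatorname{cov}(Y\mid X=x)\|_{op}\le\sqrt{c/D}$ for some constant $c$. Let $L=\sum_{|\alpha|\le m}c_\alpha\partial^\alpha$ with $0\le m\le k$, let $T(f)=L[f](0)\in\mathbb{R}^D$, and let the bandwidths $\epsilon_n$ satisfy $0<\lim_{n\to\infty}n^{\frac{1}{2k+d}}\epsilon_n<\infty$. Put $r_m=\frac{k-m}{2k+d}$. Then there are constants $C_0,c_0,N_0$ such that, for any failure probability $\varepsilon$, the vector-valued median trick (defined in the context, with $r=r_m$), applied to a sample $\{(x_i,y_i)\}_{i=1}^n$ drawn i.i.d. from $(X,Y)$, results in an estimator $\widehat T_n$ such that for any $n>N_\varepsilon$ $$\Pr\left(\|\widehat T_n-T(f)\|>\frac{C_\varepsilon}{n^{r_m}}\right)\le\varepsilon,$$ where $$N_\varepsilon=N_0\ln\frac1\varepsilon,\qquad C_\varepsilon=C_0\,c_0^{r_m}\left(\ln\frac1\varepsilon\right)^{r_m}.$$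
   Context: $\|\cdot\|$ is the Euclidean norm and $\|\cdot\|_{op}$ the Euclidean operator norm of matrices. For an integer-valued multi-index $\alpha=(\alpha_1,\dots,\alpha_d)$ with non-negative entries, $|\alpha|=\sum_j\alpha_j$ and $\partial^\alpha=\partial_{x_1}^{\alpha_1}\cdots\partial_{x_d}^{\alpha_d}$; the $c_\alpha$ are constant coefficients, and $L$ acts on $\mathbb{R}^D$-valued functions coordinatewise. Basic estimator (local polynomial regression). Let $\Pi_{k-1}^{d\mapsto D}$ be the space of vector-valued polynomials $\mathbb{R}^d\to\mathbb{R}^D$ of degree at most $k-1$. From $n$ data points $\{(x_i,y_i)\}_{i=1}^n$ compute $$\pi^*=\operatorname*{arg\,min}_{\pi\in\Pi_{k-1}^{d\mapsto D}}\frac{1}{|I_n|}\sum_{i\in I_n}\|y_i-\pi(x_i)\|^2,\qquad I_n=\{i : \|x_i\|\le\epsilon_n\},$$ where $|I_n|$ is the number of elements of $I_n$, and return $L[\pi^*](0)\in\mathbb{R}^D$. Vector-valued median trick (for failure probability $\varepsilon$). 1. Split the $n$ data points into $\nu=O(\ln\frac1\varepsilon)$ equal parts. 2. Apply the basic estimator to each part (so with $n/\nu$ data points in place of $n$) to get $\widehat T^1_{n/\nu},\dots,\widehat T^\nu_{n/\nu}\in\mathbb{R}^D$. 3. Find a ball of radius $2\,C_{\varepsilon_0}\nu^r/n^r$ that has more than half of the estimates $\widehat T^i_{n/\nu}$ in it. 4. Return $\widehat T_n$, the center of that ball. Here $\varepsilon_0\in(0,0.5)$ is a fixed auxiliary failure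 probability, and $C_{\varepsilon_0}$ is a constant for which the basic estimator computed from $n$ points is, for all large enough $n$, within $C_{\varepsilon_0}/n^r$ of $T(f)$ with probability at least $1-\varepsilon_0$.
   Formalization: The constants C_0, c_0, N_0 serve all failure probabilities ε in (0,q] for an arbitrary fixed q<1 and may depend on q; uniformity up to ε=1 fails, since there ln(1/ε) tends to 0 and n=1 with one part already violates the bound. *)

theory Defs
  imports "HOL-Probability.Probability"
begin

subsection \<open>Derivatives, differential operators and polynomials\<close>

definition partial_deriv ::
    "'d::finite \<Rightarrow> (real^'d \<Rightarrow> real^'e::finite) \<Rightarrow> real^'d \<Rightarrow> real^'e" where
  "partial_deriv i g x = vector_derivative (\<lambda>t. g (x + t *\<^sub>R axis i 1)) (at 0)"

text \<open>\<open>Ck k f\<close>: all iterated partial derivatives of \<open>f\<close> up to order \<open>k\<close> exist on the whole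
  space and are continuous.  The explicit differentiability requirement is needed because
  \<^const>\<open>vector_derivative\<close> is a total function.\<close>

primrec Ck :: "nat \<Rightarrow> (real^'d::finite \<Rightarrow> real^'e::finite) \<Rightarrow> bool" where
  "Ck 0 f \<longleftrightarrow> continuous_on UNIV f"
| "Ck (Suc k) f \<longleftrightarrow> continuous_on UNIV f \<and>
     (\<forall>i. (\<forall>x. (\<lambda>t. f (x + t *\<^sub>R axis i 1)) differentiable at 0) \<and> Ck k (partial_deriv i f))"

definition mdeg :: "('d::finite \<Rightarrow> nat) \<Rightarrow> nat" where
  "mdeg \<alpha> = (\<Sum>j\<in>UNIV. \<alpha> j)"

text \<open>\<open>coords\<close> is a fixed numbering \<open>x\<^sub>1, \<dots>, x\<^sub>d\<close> of the coordinates.  It only determines the order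
  in which partial derivatives are composed, which is immaterial for the functions considered.\<close>

definition coords :: "'d::finite list" where
  "coords = (SOME xs. distinct xs \<and> set xs = UNIV)"

definition multi_deriv ::
    "('d::finite \<Rightarrow> nat) \<Rightarrow> (real^'d \<Rightarrow> real^'e::finite) \<Rightarrow> real^'d \<Rightarrow> real^'e" where
  "multi_deriv \<alpha> g = foldr (\<lambda>i. partial_deriv i ^^ \<alpha> i) coords g"

definition diff_op ::
    "nat \<Rightarrow> (('d::finite \<Rightarrow> nat) \<Rightarrow> real) \<Rightarrow>
     (real^'d \<Rightarrow> real^'e::finite) \<Rightarrow> real^'d \<Rightarrow> real^'e" where
  "diff_op m a g x = (\<Sum>\<alpha> | mdeg \<alpha> \<le> m. a \<alpha> *\<^sub>R multi_deriv \<alpha> g x)"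

text \<open>Vector-valued polynomials of degree at most \<open>k - 1\<close>, where \<open>k - 1\<close> is an integer
  subtraction: for \<open>k = 0\<close> only the zero polynomial is left.\<close>

definition vpolys :: "nat \<Rightarrow> (real^'d::finite \<Rightarrow> real^'e::finite) set" where
  "vpolys k = {\<pi>. \<exists>b :: ('d \<Rightarrow> nat) \<Rightarrow> real^'e.
     \<pi> = (\<lambda>x. \<Sum>\<alpha> | mdeg \<alpha> < k. (\<Prod>j\<in>UNIV. (x $ j) ^ \<alpha> j) *\<^sub>R b \<alpha>)}"


subsection \<open>Conditional mean and conditional covariance given a random vector\<close>

definition cond_mean ::
    "'a measure \<Rightarrow> ('a \<Rightarrow> 'b::topological_space) \<Rightarrow> ('a \<Rightarrow> real^'e::finite) \<Rightarrow> 'a \<Rightarrow> real^'e" where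
  "cond_mean M X Z \<omega> =
     (\<chi> i. real_cond_exp M (vimage_algebra (space M) X borel) (\<lambda>\<omega>. Z \<omega> $ i) \<omega>)"

definition cond_cov ::
    "'a measure \<Rightarrow> ('a \<Rightarrow> 'b::topological_space) \<Rightarrow> ('a \<Rightarrow> real^'e::finite) \<Rightarrow> 'a \<Rightarrow> real^'e^'e" where
  "cond_cov M X Z \<omega> =
     (\<chi> i j. real_cond_exp M (vimage_algebra (space M) X borel)
        (\<lambda>\<omega>. (Z \<omega> $ i - cond_mean M X Z \<omega> $ i) * (Z \<omega> $ j - cond_mean M X Z \<omega> $ j)) \<omega>)"


subsection \<open>Samples and estimators\<close>

text \<open>A sample of size \<open>n\<close> is a function on \<open>{..<n}\<close> with values \<open>(x\<^sub>i, y\<^sub>i)\<close>; the law of an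
  i.i.d. sample is the product of \<open>n\<close> copies of the joint law.  Estimators are measurable
  functions of the sample.\<close>

type_synonym ('d, 'e) sample = "nat \<Rightarrow> (real^'d) \<times> (real^'e)"

definition iid_law :: "'a measure \<Rightarrow> ('a \<Rightarrow> real^'d::finite) \<Rightarrow> ('a \<Rightarrow> real^'e::finite) \<Rightarrow>
    nat \<Rightarrow> ('d, 'e) sample measure" where
  "iid_law M X Y n = PiM {..<n} (\<lambda>_. distr M borel (\<lambda>\<omega>. (X \<omega>, Y \<omega>)))"

definition sample_space :: "nat \<Rightarrow> ('d::finite, 'e::finite) sample measure" where
  "sample_space n = PiM {..<n} (\<lambda>_. borel)"

definition window :: "real \<Rightarrow> nat \<Rightarrow> ('d::finite, 'e::finite) sample \<Rightarrow> nat set" where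
  "window h n s = {i. i < n \<and> norm (fst (s i)) \<le> h}"

definition empirical_risk ::
    "real \<Rightarrow> nat \<Rightarrow> ('d::finite, 'e::finite) sample \<Rightarrow> (real^'d \<Rightarrow> real^'e) \<Rightarrow> real" where
  "empirical_risk h n s \<pi> =
     1 / real (card (window h n s)) *
     (\<Sum>i\<in>window h n s. (norm (snd (s i) - \<pi> (fst (s i))))\<^sup>2)"

text \<open>The minimiser need not be unique (for instance if the window is empty, in which case the
  risk is identically \<open>0\<close>); any measurable way of selecting one is allowed.\<close>

definition basic_estimator ::
    "nat \<Rightarrow> nat \<Rightarrow> (('d::finite \<Rightarrow> nat) \<Rightarrow> real) \<Rightarrow> real \<Rightarrow> nat \<Rightarrow>
     (('d, 'e::finite) sample \<Rightarrow> real^'e) \<Rightarrow> bool" where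
  "basic_estimator k m a h n E \<longleftrightarrow>
     E \<in> borel_measurable (sample_space n) \<and>
     (\<forall>s\<in>space (sample_space n). \<exists>\<pi>.
        is_arg_min (empirical_risk h n s) (\<lambda>\<pi>. \<pi> \<in> vpolys k) \<pi> \<and> E s = diff_op m a \<pi> 0)"

text \<open>Part number \<open>j\<close> of a sample, the parts being consecutive blocks of \<open>p\<close> points.\<close>

definition part :: "nat \<Rightarrow> ('d, 'e) sample \<Rightarrow> nat \<Rightarrow> ('d, 'e) sample" where
  "part p s j = (\<lambda>i\<in>{..<p}. s (j * p + i))"

definition contains_majority :: "nat \<Rightarrow> (nat \<Rightarrow> 'b::metric_space) \<Rightarrow> 'b set \<Rightarrow> bool" where
  "contains_majority \<nu> t B \<longleftrightarrow> real (card {j \<in> {..<\<nu>}. t j \<in> B}) > real \<nu> / 2"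

text \<open>\<open>T\<close> is a result of the median trick applied to \<open>n\<close> points with \<open>\<nu>\<close> parts, where \<open>E p\<close> is the
  basic estimator for \<open>p\<close> points and \<open>C\<close> is the constant in the radius.  Each part has
  \<open>n div \<nu>\<close> points, so fewer than \<open>\<nu>\<close> points are unused if \<open>\<nu>\<close> does not divide \<open>n\<close>.  Nothing is
  required of \<open>T\<close> at samples for which no suitable ball exists.\<close>

definition median_trick ::
    "(nat \<Rightarrow> ('d::finite, 'e::finite) sample \<Rightarrow> real^'e) \<Rightarrow> real \<Rightarrow> real \<Rightarrow> nat \<Rightarrow> nat \<Rightarrow>
     (('d, 'e) sample \<Rightarrow> real^'e) \<Rightarrow> bool" where
  "median_trick E C r \<nu> n T \<longleftrightarrow>
     T \<in> borel_measurable (sample_space n) \<and>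
     (\<forall>s\<in>space (sample_space n).
        let p = n div \<nu>;
            t = (\<lambda>j. E p (part p s j));
            R = 2 * C * real \<nu> powr r / real n powr r
        in (\<exists>z. contains_majority \<nu> t (cball z R)) \<longrightarrow> contains_majority \<nu> t (cball (T s) R))"

text \<open>For all large \<open>n\<close>, the basic estimator from \<open>n\<close> points is within \<open>C / n\<^sup>r\<close> of \<open>\<theta>\<close> with
  probability at least \<open>1 - \<epsilon>\<^sub>0\<close>.\<close>

definition basic_rate ::
    "(nat \<Rightarrow> ('d::finite, 'e::finite) sample measure) \<Rightarrow>
     (nat \<Rightarrow> ('d, 'e) sample \<Rightarrow> real^'e) \<Rightarrow> real^'e \<Rightarrow> real \<Rightarrow> real \<Rightarrow> real \<Rightarrow> bool" where
  "basic_rate P E \<theta> r \<epsilon>\<^sub>0 C \<longleftrightarrow>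
     (\<forall>\<^sub>F n in sequentially.
        measure (P n) {s \<in> space (P n). norm (E n s - \<theta>) \<le> C / real n powr r} \<ge> 1 - \<epsilon>\<^sub>0)"

end

theory Submission
  imports Defs
begin

text \<open>The proof has two independent halves.

The first half is the rate of the basic estimator with a fixed failure probability
(\<open>basic_estimator_rate\<close>).  Let \<open>h\<close> be the bandwidth, let \<open>b\<close> be the Taylor coefficients of \<open>f\<close> at the
origin and let \<open>b'\<close> be the coefficients of the fitted polynomial.  After rescaling the window to the
unit ball, the difference of the two polynomials has coefficients \<open>\<gamma>\<^sub>\<alpha> = h\<^bsup>|\<alpha>|\<^esup> (b'\<^sub>\<alpha> - b\<^sub>\<alpha>)\<close>.  The fit
is at least as good as the Taylor polynomial, and this alone, without the normal equations, gives
\<open>\<Sum>\<^sub>i \<bar>g(x\<^sub>i)\<bar>\<^sup>2 \<le> 2 \<Sum>\<^sub>i \<langle>y\<^sub>i - P(x\<^sub>i), g(x\<^sub>i)\<rangle>\<close> for the Taylor polynomial \<open>P\<close> and the difference \<open>g\<close>.  The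
left side is of order \<open>n h\<^sup>d |\<gamma>|\<^sup>2\<close>: its mean is bounded below because the density is bounded away from
\<open>0\<close> and the monomials are linearly independent on the unit ball (\<open>monomials_L2_lower_bound\<close>), and
it concentrates by Chebyshev's inequality.  On the right, \<open>y - P(x)\<close> is the sum of a bias of order
\<open>h\<^sup>k\<close> (\<open>Taylor_vpoly\<close>) and a centred noise whose pairing with each monomial has variance of order
\<open>n h\<^sup>d\<close>, by the bound on the conditional covariance (\<open>noise_second_moment\<close>).  So \<open>|\<gamma>|\<close> is of order
\<open>h\<^sup>k + (n h\<^sup>d)\<^bsup>-1/2\<^esup>\<close>, and the bandwidth is chosen to make the two terms comparable.  Undoing the
scaling costs \<open>h\<^bsup>-|\<alpha>|\<^esup>\<close> for the derivative of order \<open>\<alpha>\<close>, which leaves \<open>n\<^bsup>-r\<^esup>\<close> for derivatives of order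
at most \<open>m\<close>.

The second half is the amplification of the success probability
(\<open>median_trick_exponential_concentration\<close>).  The parts of an i.i.d. sample are independent, and each
estimate is close to the target with probability at least \<open>1 - \<epsilon>\<^sub>0 > 1/2\<close>; by Hoeffding's inequality
a majority of them is close except with probability exponentially small in the number \<open>\<nu>\<close> of parts.
In that case the ball around the target contains a majority of the estimates.  So does the ball that
the median trick returns, and two majorities share an estimate, so the two centres are within twice
the radius.  A number of parts proportional to \<open>ln (1 / \<epsilon>)\<close> makes the exceptional probability at most
\<open>\<epsilon>\<close>.

Two points are specific to the definitions.  Partial derivatives are composed in the fixed order
given by \<open>coords\<close>, so the Taylor expansion is carried out one coordinate at a time in that same order;
mixed partial derivatives never have to be interchanged.  For \<open>m = k\<close> the operator contains
derivatives of order \<open>k\<close>, which the fitted polynomial does not see; there \<open>r = 0\<close>, and the missing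
terms are a constant error that the constant \<open>C\<close> absorbs.\<close>

section \<open>Polynomials and their derivatives at the origin\<close>

definition monomial :: "('d::finite \<Rightarrow> nat) \<Rightarrow> real^'d \<Rightarrow> real" where
  "monomial \<alpha> x = (\<Prod>j\<in>UNIV. (x $ j) ^ \<alpha> j)"

definition vpoly :: "nat \<Rightarrow> (('d::finite \<Rightarrow> nat) \<Rightarrow> real^'e::finite) \<Rightarrow> real^'d \<Rightarrow> real^'e" where
  "vpoly k b x = (\<Sum>\<alpha> | mdeg \<alpha> < k. monomial \<alpha> x *\<^sub>R b \<alpha>)"

definition mfact :: "('d::finite \<Rightarrow> nat) \<Rightarrow> real" where
  "mfact \<alpha> = (\<Prod>j\<in>UNIV. fact (\<alpha> j))"

lemma vpolys_eq: "vpolys k = range (vpoly k)"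
  unfolding vpolys_def vpoly_def[abs_def] monomial_def by auto

lemma mfact_pos [simp]: "mfact \<alpha> > 0" "mfact \<alpha> \<noteq> 0"
  unfolding mfact_def by (simp_all add: prod_pos)

lemma finite_mdeg_less [simp]: "finite {\<alpha> :: 'd::finite \<Rightarrow> nat. mdeg \<alpha> < k}"
proof (rule finite_subset)
  show "{\<alpha> :: 'd \<Rightarrow> nat. mdeg \<alpha> < k} \<subseteq> PiE UNIV (\<lambda>_. {..<k})"
  proof
    fix \<alpha> :: "'d \<Rightarrow> nat" assume "\<alpha> \<in> {\<alpha>. mdeg \<alpha> < k}"
    moreover have "\<alpha> j \<le> mdeg \<alpha>" for j
      unfolding mdeg_def by (rule member_le_sum) auto
    ultimately show "\<alpha> \<in> PiE UNIV (\<lambda>_. {..<k})" using le_less_trans by fastforce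
  qed
qed (intro finite_PiE, auto)

lemma finite_mdeg_le [simp]: "finite {\<alpha> :: 'd::finite \<Rightarrow> nat. mdeg \<alpha> \<le> k}"
  using finite_mdeg_less[of "Suc k"] by (simp add: less_Suc_eq_le)

lemma mdeg_upd: "mdeg (\<alpha>(i := n)) + \<alpha> i = mdeg \<alpha> + n"
proof -
  have "mdeg (\<alpha>(i := n)) = n + (\<Sum>j\<in>UNIV - {i}. \<alpha> j)"
    unfolding mdeg_def by (subst sum.remove[of _ i]) auto
  moreover have "mdeg \<alpha> = \<alpha> i + (\<Sum>j\<in>UNIV - {i}. \<alpha> j)"
    unfolding mdeg_def by (subst sum.remove[of _ i]) auto
  ultimately show ?thesis by simp
qed

lemma mdeg_zero [simp]: "mdeg (\<lambda>_. 0) = 0"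
  by (simp add: mdeg_def)

lemma monomial_split: "monomial \<alpha> x = (x $ i) ^ \<alpha> i * (\<Prod>j\<in>UNIV - {i}. (x $ j) ^ \<alpha> j)"
  unfolding monomial_def by (subst prod.remove[of _ i]) auto

lemma monomial_zero [simp]: "monomial (\<lambda>_. 0) x = 1"
  by (simp add: monomial_def)

lemma monomial_at_0: "monomial \<alpha> 0 = (if \<alpha> = (\<lambda>_. 0) then 1 else 0)"
  by (auto simp: monomial_def fun_eq_iff)

lemma monomial_scaleR: "monomial \<alpha> (h *\<^sub>R x) = h ^ mdeg \<alpha> * monomial \<alpha> x"
  unfolding monomial_def mdeg_def by (simp add: power_mult_distrib prod.distrib power_sum)

lemma abs_monomial_le: 
  assumes "norm x \<le> h" shows "\<bar>monomial \<alpha> x\<bar> \<le> h ^ mdeg \<alpha>"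
proof -
  have "\<bar>monomial \<alpha> x\<bar> = (\<Prod>j\<in>UNIV. \<bar>x $ j\<bar> ^ \<alpha> j)" by (simp add: monomial_def abs_prod power_abs)
  also have "\<dots> \<le> (\<Prod>j\<in>UNIV. h ^ \<alpha> j)"
  proof (intro prod_mono conjI power_mono)
    fix j show "\<bar>x $ j\<bar> \<le> h" using component_le_norm_cart[of x j] assms by linarith
  qed auto
  also have "\<dots> = h ^ mdeg \<alpha>" unfolding mdeg_def by (simp add: power_sum)
  finally show ?thesis .
qed

lemma continuous_on_monomial [continuous_intros]: "continuous_on S (monomial \<alpha>)"
  unfolding monomial_def[abs_def] by (intro continuous_intros)

lemma borel_measurable_monomial [measurable (raw)]:
  "g \<in> borel_measurable M \<Longrightarrow> (\<lambda>x. monomial \<alpha> (g x)) \<in> borel_measurable M"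
  by (rule borel_measurable_continuous_on[OF continuous_on_monomial])

lemma borel_measurable_vec_component [measurable (raw)]:
  fixes g :: "'a \<Rightarrow> real^'e::finite"
  shows "g \<in> borel_measurable M \<Longrightarrow> (\<lambda>x. g x $ e) \<in> borel_measurable M"
  by (rule borel_measurable_continuous_on[where f = "\<lambda>x. x $ e"]) (intro continuous_intros)

lemma distinct_coords: "distinct (coords :: 'd::finite list)" and set_coords: "set (coords :: 'd list) = UNIV"
proof -
  have "\<exists>xs :: 'd list. distinct xs \<and> set xs = UNIV" using finite_distinct_list[of "UNIV :: 'd set"] by auto
  then have "distinct (coords :: 'd list) \<and> set (coords :: 'd list) = UNIV"
    unfolding coords_def by (rule someI_ex)
  then show "distinct (coords :: 'd::finite list)" "set (coords :: 'd list) = UNIV" by auto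
qed

text \<open>Coefficients in degrees \<open>\<ge> k\<close> do not influence \<^const>\<open>vpoly\<close>.  Fixing them to be \<open>0\<close> makes the
  coefficient family unique and lets differentiation act on coefficients as a shift without changing
  the degree bound \<open>k\<close>.\<close>

definition supported_below :: "nat \<Rightarrow> (('d::finite \<Rightarrow> nat) \<Rightarrow> 'b::zero) \<Rightarrow> bool" where
  "supported_below k b \<longleftrightarrow> (\<forall>\<alpha>. k \<le> mdeg \<alpha> \<longrightarrow> b \<alpha> = 0)"

text \<open>The action of \<open>\<partial>\<^sub>i\<close> on the coefficients of a polynomial.\<close>

definition coeff_deriv ::
    "'d::finite \<Rightarrow> (('d \<Rightarrow> nat) \<Rightarrow> 'b::real_vector) \<Rightarrow> ('d \<Rightarrow> nat) \<Rightarrow> 'b" where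
  "coeff_deriv i b \<alpha> = real (Suc (\<alpha> i)) *\<^sub>R b (\<alpha>(i := Suc (\<alpha> i)))"

lemma supported_below_coeff_deriv:
  assumes "supported_below k b" shows "supported_below k (coeff_deriv i b)"
  unfolding supported_below_def
proof (intro allI impI)
  fix \<alpha> :: "'a \<Rightarrow> nat" assume "k \<le> mdeg \<alpha>"
  moreover have "mdeg (\<alpha>(i := Suc (\<alpha> i))) = Suc (mdeg \<alpha>)" using mdeg_upd[of \<alpha> i "Suc (\<alpha> i)"] by simp
  ultimately show "coeff_deriv i b \<alpha> = 0" using assms by (simp add: coeff_deriv_def supported_below_def)
qed

lemma monomial_has_partial_derivative:
  "((\<lambda>t. monomial \<alpha> (x + t *\<^sub>R axis i 1)) has_real_derivative
     real (\<alpha> i) * monomial (\<alpha>(i := \<alpha> i - 1)) x) (at 0)"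
proof -
  define c where "c = (\<Prod>j\<in>UNIV - {i}. (x $ j) ^ \<alpha> j)"
  have "monomial \<alpha> (x + t *\<^sub>R axis i 1) = (x $ i + t) ^ \<alpha> i * c" for t
    unfolding monomial_split[of \<alpha> _ i] c_def
    by (intro arg_cong2[where f = "(*)"] prod.cong) (auto simp: axis_def)
  moreover have "((\<lambda>t. (x $ i + t) ^ \<alpha> i * c) has_real_derivative
      real (\<alpha> i) * (x $ i) ^ (\<alpha> i - 1) * c) (at 0)"
    by (auto intro!: derivative_eq_intros)
  moreover have "real (\<alpha> i) * (x $ i) ^ (\<alpha> i - 1) * c = real (\<alpha> i) * monomial (\<alpha>(i := \<alpha> i - 1)) x"
    unfolding monomial_split[of _ x i] c_def by simp
  ultimately show ?thesis by (simp only: mult.assoc)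
qed

text \<open>Differentiating term by term replaces \<open>\<alpha>\<close> by \<open>\<alpha> - e\<^sub>i\<close>.  Terms with \<open>\<alpha>\<^sub>i = 0\<close> disappear, and the
  shifted family has one degree less, so the sums over \<open>{\<alpha>. mdeg \<alpha> < k}\<close> on the two sides are matched
  through the indices that survive.\<close>

lemma partial_deriv_vpoly:
  assumes "supported_below k b"
  shows "partial_deriv i (vpoly k b) = vpoly k (coeff_deriv i b)"
proof
  fix x
  have "((\<lambda>t. vpoly k b (x + t *\<^sub>R axis i 1)) has_vector_derivative
     (\<Sum>\<alpha> | mdeg \<alpha> < k. (real (\<alpha> i) * monomial (\<alpha>(i := \<alpha> i - 1)) x) *\<^sub>R b \<alpha>)) (at 0)"
    unfolding vpoly_def
  proof (rule has_vector_derivative_sum)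
    fix \<alpha> :: "'a \<Rightarrow> nat"
    show "((\<lambda>t. monomial \<alpha> (x + t *\<^sub>R axis i 1) *\<^sub>R b \<alpha>) has_vector_derivative
        (real (\<alpha> i) * monomial (\<alpha>(i := \<alpha> i - 1)) x) *\<^sub>R b \<alpha>) (at 0)"
      using has_vector_derivative_scaleR[OF monomial_has_partial_derivative[of \<alpha> x i]
          has_vector_derivative_const[of "b \<alpha>"]] by simp
  qed
  then have "partial_deriv i (vpoly k b) x =
     (\<Sum>\<alpha> | mdeg \<alpha> < k. (real (\<alpha> i) * monomial (\<alpha>(i := \<alpha> i - 1)) x) *\<^sub>R b \<alpha>)"
    unfolding partial_deriv_def by (rule vector_derivative_at)
  also have "\<dots> = (\<Sum>\<alpha> | mdeg \<alpha> < k. monomial \<alpha> x *\<^sub>R coeff_deriv i b \<alpha>)"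
  proof -
    have "(\<Sum>\<alpha> | mdeg \<alpha> < k. (real (\<alpha> i) * monomial (\<alpha>(i := \<alpha> i - 1)) x) *\<^sub>R b \<alpha>) =
        (\<Sum>\<alpha> | mdeg \<alpha> < k \<and> 0 < \<alpha> i. (real (\<alpha> i) * monomial (\<alpha>(i := \<alpha> i - 1)) x) *\<^sub>R b \<alpha>)"
      by (intro sum.mono_neutral_right) auto
    also have "\<dots> = (\<Sum>\<alpha> | Suc (mdeg \<alpha>) < k. monomial \<alpha> x *\<^sub>R coeff_deriv i b \<alpha>)"
    proof (rule sum.reindex_bij_witness[where
          i = "\<lambda>\<alpha>. \<alpha>(i := Suc (\<alpha> i))" and j = "\<lambda>\<alpha>. \<alpha>(i := \<alpha> i - 1)"])
      fix \<alpha> :: "'a \<Rightarrow> nat" assume "\<alpha> \<in> {\<alpha>. mdeg \<alpha> < k \<and> 0 < \<alpha> i}"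
      then show "(\<alpha>(i := \<alpha> i - 1))(i := Suc ((\<alpha>(i := \<alpha> i - 1)) i)) = \<alpha>"
        and "\<alpha>(i := \<alpha> i - 1) \<in> {\<alpha>. Suc (mdeg \<alpha>) < k}"
        and "monomial (\<alpha>(i := \<alpha> i - 1)) x *\<^sub>R coeff_deriv i b (\<alpha>(i := \<alpha> i - 1)) =
          (real (\<alpha> i) * monomial (\<alpha>(i := \<alpha> i - 1)) x) *\<^sub>R b \<alpha>"
        using mdeg_upd[of \<alpha> i "\<alpha> i - 1"] by (auto simp: coeff_deriv_def mult.commute)
    next
      fix \<alpha> :: "'a \<Rightarrow> nat" assume "\<alpha> \<in> {\<alpha>. Suc (mdeg \<alpha>) < k}"
      then show "(\<alpha>(i := Suc (\<alpha> i)))(i := (\<alpha>(i := Suc (\<alpha> i))) i - 1) = \<alpha>"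
        and "\<alpha>(i := Suc (\<alpha> i)) \<in> {\<alpha>. mdeg \<alpha> < k \<and> 0 < \<alpha> i}"
        using mdeg_upd[of \<alpha> i "Suc (\<alpha> i)"] by auto
    qed
    also have "\<dots> = (\<Sum>\<alpha> | mdeg \<alpha> < k. monomial \<alpha> x *\<^sub>R coeff_deriv i b \<alpha>)"
    proof (rule sum.mono_neutral_left)
      show "\<forall>\<alpha>\<in>{\<alpha>. mdeg \<alpha> < k} - {\<alpha>. Suc (mdeg \<alpha>) < k}. monomial \<alpha> x *\<^sub>R coeff_deriv i b \<alpha> = 0"
      proof
        fix \<alpha> :: "'a \<Rightarrow> nat" assume "\<alpha> \<in> {\<alpha>. mdeg \<alpha> < k} - {\<alpha>. Suc (mdeg \<alpha>) < k}"
        then show "monomial \<alpha> x *\<^sub>R coeff_deriv i b \<alpha> = 0"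
          using assms mdeg_upd[of \<alpha> i "Suc (\<alpha> i)"] by (auto simp: coeff_deriv_def supported_below_def)
      qed
    qed auto
    finally show ?thesis .
  qed
  finally show "partial_deriv i (vpoly k b) x = vpoly k (coeff_deriv i b) x"
    unfolding vpoly_def .
qed

lemma iterated_partial_deriv_vpoly:
  assumes "supported_below k b"
  shows "supported_below k ((coeff_deriv i ^^ n) b) \<and>
    (partial_deriv i ^^ n) (vpoly k b) = vpoly k ((coeff_deriv i ^^ n) b)"
  using assms by (induction n) (auto simp: supported_below_coeff_deriv partial_deriv_vpoly)

lemma multi_deriv_vpoly:
  assumes "supported_below k b"
  shows "multi_deriv \<alpha> (vpoly k b) = vpoly k (foldr (\<lambda>i. coeff_deriv i ^^ \<alpha> i) coords b)"
proof -
  have "supported_below k (foldr (\<lambda>i. coeff_deriv i ^^ \<alpha> i) xs b) \<and>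
    foldr (\<lambda>i. partial_deriv i ^^ \<alpha> i) xs (vpoly k b) = vpoly k (foldr (\<lambda>i. coeff_deriv i ^^ \<alpha> i) xs b)" for xs
    using assms by (induction xs) (auto simp: iterated_partial_deriv_vpoly)
  then show ?thesis unfolding multi_deriv_def by blast
qed

lemma iterated_coeff_deriv:
  "(coeff_deriv i ^^ n) b \<alpha> = (fact (\<alpha> i + n) / fact (\<alpha> i)) *\<^sub>R b (\<alpha>(i := \<alpha> i + n))"
proof (induction n arbitrary: \<alpha>)
  case (Suc n)
  have "(coeff_deriv i ^^ Suc n) b \<alpha> = real (Suc (\<alpha> i)) *\<^sub>R (coeff_deriv i ^^ n) b (\<alpha>(i := Suc (\<alpha> i)))"
    by (simp add: coeff_deriv_def)
  also have "\<dots> = (real (Suc (\<alpha> i)) * (fact (Suc (\<alpha> i) + n) / fact (Suc (\<alpha> i)))) *\<^sub>R b (\<alpha>(i := Suc (\<alpha> i) + n))"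
    by (subst Suc.IH) simp
  also have "real (Suc (\<alpha> i)) * (fact (Suc (\<alpha> i) + n) / fact (Suc (\<alpha> i))) = fact (\<alpha> i + Suc n) / fact (\<alpha> i)"
    by (simp add: field_simps del: of_nat_Suc)
  finally show ?case by simp
qed simp

text \<open>The coordinates in \<open>xs\<close> are distinct, so each of them is differentiated in one block, starting from
  exponent \<open>0\<close>; every block contributes one factorial.\<close>

lemma foldr_coeff_deriv:
  assumes "distinct xs" "\<And>j. j \<in> set xs \<Longrightarrow> \<beta> j = 0"
  shows "foldr (\<lambda>i. coeff_deriv i ^^ \<alpha> i) xs b \<beta> =
    (\<Prod>j\<in>set xs. fact (\<alpha> j)) *\<^sub>R b (\<lambda>j. if j \<in> set xs then \<alpha> j else \<beta> j)"
  using assms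
proof (induction xs arbitrary: \<beta>)
  case (Cons i xs)
  have "foldr (\<lambda>i. coeff_deriv i ^^ \<alpha> i) (i # xs) b \<beta> =
      fact (\<alpha> i) *\<^sub>R foldr (\<lambda>i. coeff_deriv i ^^ \<alpha> i) xs b (\<beta>(i := \<alpha> i))"
    using Cons.prems by (simp add: iterated_coeff_deriv)
  also have "foldr (\<lambda>i. coeff_deriv i ^^ \<alpha> i) xs b (\<beta>(i := \<alpha> i)) =
      (\<Prod>j\<in>set xs. fact (\<alpha> j)) *\<^sub>R b (\<lambda>j. if j \<in> set xs then \<alpha> j else (\<beta>(i := \<alpha> i)) j)"
    using Cons.prems by (intro Cons.IH) auto
  also have "(\<lambda>j. if j \<in> set xs then \<alpha> j else (\<beta>(i := \<alpha> i)) j) =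
      (\<lambda>j. if j \<in> set (i # xs) then \<alpha> j else \<beta> j)" by auto
  finally show ?case using Cons.prems by simp
qed simp

lemma vpoly_at_0:
  assumes "supported_below k b" shows "vpoly k b 0 = b (\<lambda>_. 0)"
proof -
  have "vpoly k b 0 = (\<Sum>\<alpha> | mdeg \<alpha> < k. if \<alpha> = (\<lambda>_. 0) then b \<alpha> else 0)"
    unfolding vpoly_def by (intro sum.cong) (auto simp: monomial_at_0)
  also have "\<dots> = (if k > 0 then b (\<lambda>_. 0) else 0)"
    by (subst sum.delta) auto
  finally show ?thesis using assms by (auto simp: supported_below_def)
qed

text \<open>Only the constant coefficient is visible at the origin, and \<open>\<partial>\<^sup>\<alpha>\<close> moves the coefficient of index \<open>\<alpha>\<close>
  there.  This turns estimates of derivatives into estimates of coefficients.\<close>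

lemma multi_deriv_vpoly_at_0:
  assumes "supported_below k b"
  shows "multi_deriv \<alpha> (vpoly k b) 0 = mfact \<alpha> *\<^sub>R b \<alpha>"
proof -
  have "supported_below k (foldr (\<lambda>i. coeff_deriv i ^^ \<alpha> i) xs b)" for xs
    using assms by (induction xs) (auto simp: iterated_partial_deriv_vpoly)
  then have "multi_deriv \<alpha> (vpoly k b) 0 = foldr (\<lambda>i. coeff_deriv i ^^ \<alpha> i) coords b (\<lambda>_. 0)"
    by (simp add: multi_deriv_vpoly[OF assms] vpoly_at_0)
  then show ?thesis
    by (simp add: foldr_coeff_deriv distinct_coords set_coords mfact_def)
qed

lemma vpolys_obtain_supported:
  assumes "\<pi> \<in> vpolys k"
  obtains b where "supported_below k b" "\<pi> = vpoly k b"
proof -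
  obtain b where b: "\<pi> = vpoly k b" using assms unfolding vpolys_eq by auto
  have "vpoly k b = vpoly k (\<lambda>\<alpha>. if mdeg \<alpha> < k then b \<alpha> else 0)"
    unfolding vpoly_def by (intro ext sum.cong) auto
  then show ?thesis using b by (intro that[of "\<lambda>\<alpha>. if mdeg \<alpha> < k then b \<alpha> else 0"]) (auto simp: supported_below_def)
qed

lemma partial_deriv_eq_0_on_open:
  assumes "open S" "\<And>x. x \<in> S \<Longrightarrow> g x = 0" "x \<in> S"
  shows "partial_deriv i g x = 0"
proof -
  have "((\<lambda>t. g (x + t *\<^sub>R axis i 1)) has_vector_derivative 0) (at 0)"
  proof (rule has_vector_derivative_transform_within_open)
    show "open ((\<lambda>t. x + t *\<^sub>R axis i 1) -` S)"
      using assms(1) by (intro open_vimage continuous_intros)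
  qed (use assms in auto)
  then show ?thesis unfolding partial_deriv_def by (rule vector_derivative_at)
qed

lemma multi_deriv_eq_0_on_open:
  assumes "open S" "\<And>x. x \<in> S \<Longrightarrow> g x = 0" "x \<in> S"
  shows "multi_deriv \<alpha> g x = 0"
proof -
  have it: "\<forall>x\<in>S. (partial_deriv i ^^ n) g' x = 0" if "\<forall>x\<in>S. g' x = 0" for i n and g' :: "real^'a \<Rightarrow> real^'b"
    using that by (induction n) (auto intro!: partial_deriv_eq_0_on_open[OF assms(1)])
  have "\<forall>x\<in>S. foldr (\<lambda>i. partial_deriv i ^^ \<alpha> i) xs g x = 0" for xs
    using assms(2) by (induction xs) (auto simp: it)
  then show ?thesis unfolding multi_deriv_def using assms(3) by blast
qed

text \<open>The uniqueness of coefficients: they are derivatives at the origin, and those depend only on the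
  values nearby.\<close>

lemma vpoly_eq_0_on_open_imp_coeff_0:
  assumes "open S" "0 \<in> S" "\<And>x. x \<in> S \<Longrightarrow> vpoly k b x = 0" "supported_below k b"
  shows "b \<alpha> = 0"
proof -
  have "multi_deriv \<alpha> (vpoly k b) 0 = 0"
    using assms(3) by (intro multi_deriv_eq_0_on_open[OF assms(1) _ assms(2)]) auto
  then show ?thesis by (simp add: multi_deriv_vpoly_at_0[OF assms(4)])
qed

section \<open>Taylor expansion\<close>

definition zero_coords :: "'d::finite set \<Rightarrow> real^'d \<Rightarrow> real^'d" where
  "zero_coords S x = (\<chi> j. if j \<in> S then 0 else x $ j)"

lemma zero_coords_empty [simp]: "zero_coords {} x = x"
  by (simp add: zero_coords_def vec_eq_iff)

lemma zero_coords_UNIV [simp]: "zero_coords UNIV x = 0"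
  by (simp add: zero_coords_def vec_eq_iff)

lemma zero_coords_zero_coords: "zero_coords S (zero_coords T x) = zero_coords (S \<union> T) x"
  by (simp add: zero_coords_def vec_eq_iff)

lemma norm_zero_coords_le: "norm (zero_coords S x) \<le> norm x"
  by (rule norm_le_componentwise_cart) (simp add: zero_coords_def)

lemma Ck_imp_continuous: "Ck k f \<Longrightarrow> continuous_on UNIV f"
  by (cases k) auto

lemma Ck_iterated_partial_deriv:
  assumes "Ck k f" "n \<le> k" shows "Ck (k - n) ((partial_deriv i ^^ n) f)"
  using assms(2)
proof (induction n)
  case (Suc n)
  then have "Ck (Suc (k - Suc n)) ((partial_deriv i ^^ n) f)" by (simp add: Suc_diff_Suc)
  then show ?case by simp
qed (use assms in auto)

lemma Ck_partial_has_real_derivative: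
  assumes "Ck (Suc k) f"
  shows "((\<lambda>t. f (x + t *\<^sub>R axis i 1) $ e) has_real_derivative partial_deriv i f (x + t *\<^sub>R axis i 1) $ e) (at t)"
proof -
  let ?y = "x + t *\<^sub>R axis i 1"
  have "(\<lambda>s. f (?y + s *\<^sub>R axis i 1)) differentiable at 0" using assms by simp
  then have "((\<lambda>s. f (?y + s *\<^sub>R axis i 1)) has_vector_derivative partial_deriv i f ?y) (at 0)"
    unfolding partial_deriv_def by (simp add: vector_derivative_works)
  then have "((\<lambda>s. f (?y + s *\<^sub>R axis i 1) $ e) has_vector_derivative partial_deriv i f ?y $ e) (at 0)"
    by (rule bounded_linear.has_vector_derivative[OF bounded_linear_vec_nth])
  then have "DERIV (\<lambda>s. f (?y + s *\<^sub>R axis i 1) $ e) (t + - t) :> partial_deriv i f ?y $ e"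
    by (simp add: has_real_derivative_iff_has_vector_derivative)
  then have "DERIV (\<lambda>u. f (?y + (u + - t) *\<^sub>R axis i 1) $ e) t :> partial_deriv i f ?y $ e"
    by (rule DERIV_shift[THEN iffD1])
  moreover have "?y + (u + - t) *\<^sub>R axis i 1 = x + u *\<^sub>R axis i 1" for u
    by (simp add: algebra_simps)
  ultimately show ?thesis by (simp only:)
qed

text \<open>This is the one-variable formula along the line in direction \<open>i\<close>, applied to each component of
  \<open>f\<close> because the intermediate point depends on the component.  The derivative of order \<open>k\<close> is
  bounded on the unit ball by compactness.\<close>

lemma Taylor_one_coordinate:
  fixes f :: "real^'d::finite \<Rightarrow> real^'e::finite"
  assumes f: "Ck k f"
  shows "\<exists>K\<ge>0. \<forall>x. norm x \<le> 1 \<longrightarrow>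
    norm (f x - (\<Sum>a<k. ((x $ i) ^ a / fact a) *\<^sub>R (partial_deriv i ^^ a) f (zero_coords {i} x)))
      \<le> K * \<bar>x $ i\<bar> ^ k"
proof -
  define g where "g = (\<lambda>a. (partial_deriv i ^^ a) f)"
  have "continuous_on (cball 0 1) (g k)"
    using Ck_iterated_partial_deriv[OF f, of k i] unfolding g_def
    by (auto intro: continuous_on_subset)
  then have "compact (g k ` cball 0 1)" by (intro compact_continuous_image) auto
  then obtain B where B: "B > 0" "\<And>y. norm y \<le> 1 \<Longrightarrow> norm (g k y) \<le> B"
    using compact_imp_bounded bounded_pos by (metis imageI mem_cball_0)
  show ?thesis
  proof (intro exI[of _ "real CARD('e) * B"] conjI allI impI)
    fix x :: "real^'d" assume x: "norm x \<le> 1"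
    define y where "y = zero_coords {i} x"
    define S where "S = (\<Sum>a<k. ((x $ i) ^ a / fact a) *\<^sub>R g a y)"
    have yx: "y + (x $ i) *\<^sub>R axis i 1 = x"
      by (auto simp: y_def zero_coords_def vec_eq_iff axis_def)
    have comp: "\<bar>(f x - S) $ e\<bar> \<le> B * \<bar>x $ i\<bar> ^ k" for e
    proof -
      \<comment> \<open>The iterated partial derivatives in direction \<open>i\<close>, restricted to the line through \<open>y\<close>.\<close>
      define D where "D = (\<lambda>a t. g a (y + t *\<^sub>R axis i 1) $ e)"
      have "\<forall>a t. a < k \<and> \<bar>t\<bar> \<le> \<bar>x $ i\<bar> \<longrightarrow> DERIV (D a) t :> D (Suc a) t"
      proof (intro allI impI)
        fix a t assume "a < k \<and> \<bar>t\<bar> \<le> \<bar>x $ i\<bar>"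
        then have "Ck (Suc (k - Suc a)) (g a)"
          using Ck_iterated_partial_deriv[OF f, of a i] unfolding g_def by (simp add: Suc_diff_Suc)
        from Ck_partial_has_real_derivative[OF this, of y i e t]
        show "DERIV (D a) t :> D (Suc a) t" unfolding D_def g_def by simp
      qed
      from Maclaurin_bi_le[OF refl this] obtain t where t: "\<bar>t\<bar> \<le> \<bar>x $ i\<bar>"
        "D 0 (x $ i) = (\<Sum>a<k. D a 0 / fact a * (x $ i) ^ a) + D k t / fact k * (x $ i) ^ k"
        by auto
      have "D 0 (x $ i) = f x $ e" by (simp add: D_def g_def yx)
      moreover have "(\<Sum>a<k. D a 0 / fact a * (x $ i) ^ a) = S $ e"
        by (simp add: D_def S_def mult.commute)
      ultimately have "(f x - S) $ e = D k t / fact k * (x $ i) ^ k" using t by simp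
      moreover have "\<bar>D k t / fact k\<bar> \<le> B"
      proof -
        have "norm (y + t *\<^sub>R axis i 1) \<le> norm x"
          using t(1) by (intro norm_le_componentwise_cart) (auto simp: y_def zero_coords_def axis_def)
        then have "norm (g k (y + t *\<^sub>R axis i 1)) \<le> B" using x B(2) by auto
        then have "\<bar>D k t\<bar> \<le> B" unfolding D_def using component_le_norm_cart order_trans by blast
        moreover have "\<bar>D k t / fact k\<bar> \<le> \<bar>D k t\<bar>"
          using fact_ge_1[of k, where 'a = real] by (simp add: divide_le_eq mult_le_cancel_left1 abs_mult)
        ultimately show ?thesis by linarith
      qed
      ultimately show ?thesis by (simp only: abs_mult power_abs mult_right_mono zero_le_power abs_ge_zero)
    qed
    have "norm (f x - S) \<le> (\<Sum>e\<in>UNIV. \<bar>(f x - S) $ e\<bar>)" by (rule norm_le_l1_cart)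
    also have "\<dots> \<le> (\<Sum>e\<in>(UNIV :: 'e set). B * \<bar>x $ i\<bar> ^ k)" by (intro sum_mono comp)
    also have "\<dots> = real CARD('e) * B * \<bar>x $ i\<bar> ^ k" by simp
    finally show "norm (f x - (\<Sum>a<k. ((x $ i) ^ a / fact a) *\<^sub>R (partial_deriv i ^^ a) f (zero_coords {i} x)))
      \<le> real CARD('e) * B * \<bar>x $ i\<bar> ^ k" unfolding S_def y_def g_def .
  qed (use B in auto)
qed

text \<open>Expanding in the coordinates of \<open>xs\<close> one after the other, starting from the last entry, uses the
  derivatives exactly in the order in which \<^const>\<open>foldr\<close> composes them.  The term of order \<open>a\<close> in
  coordinate \<open>i\<close> already carries a factor \<open>x\<^sub>i\<^sup>a\<close>, so it has to be expanded only to order \<open>k - a\<close> in the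
  others, which is the smoothness that \<open>\<partial>\<^sub>i\<^sup>a f\<close> still has.\<close>

lemma Taylor_coordinate_list:
  fixes f :: "real^'d::finite \<Rightarrow> real^'e::finite"
  assumes "distinct xs" "Ck k f"
  shows "\<exists>K\<ge>0. \<forall>x. norm x \<le> 1 \<longrightarrow>
    norm (f x - (\<Sum>\<alpha> | mdeg \<alpha> < k \<and> (\<forall>j. j \<notin> set xs \<longrightarrow> \<alpha> j = 0).
        (monomial \<alpha> x / mfact \<alpha>) *\<^sub>R foldr (\<lambda>i. partial_deriv i ^^ \<alpha> i) xs f (zero_coords (set xs) x)))
      \<le> K * norm x ^ k"
  using assms
proof (induction xs arbitrary: f k rule: rev_induct)
  case Nil
  show ?case
  proof (cases "k = 0")
    case True
    have "continuous_on (cball 0 1) f"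
      using Ck_imp_continuous[OF Nil(2)] by (auto intro: continuous_on_subset)
    then have "compact (f ` cball 0 1)" by (intro compact_continuous_image) auto
    then obtain B where "B > 0" "\<And>y. norm y \<le> 1 \<Longrightarrow> norm (f y) \<le> B"
      using compact_imp_bounded bounded_pos by (metis imageI mem_cball_0)
    then show ?thesis using True by (intro exI[of _ B]) auto
  next
    case False
    then have "{\<alpha> :: 'd \<Rightarrow> nat. mdeg \<alpha> < k \<and> (\<forall>j. j \<notin> set [] \<longrightarrow> \<alpha> j = 0)} = {\<lambda>_. 0}"
      by (auto simp: fun_eq_iff)
    then show ?thesis by (intro exI[of _ 0]) (simp add: mfact_def)
  qed
next
  case (snoc i xs)
  define g where "g = (\<lambda>a. (partial_deriv i ^^ a) f)"
  define A where "A = (\<lambda>k. {\<alpha> :: 'd \<Rightarrow> nat. mdeg \<alpha> < k \<and> (\<forall>j. j \<notin> set xs \<longrightarrow> \<alpha> j = 0)})"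
  define A' where "A' = {\<alpha> :: 'd \<Rightarrow> nat. mdeg \<alpha> < k \<and> (\<forall>j. j \<notin> set (xs @ [i]) \<longrightarrow> \<alpha> j = 0)}"
  have i: "i \<notin> set xs" "distinct xs" using snoc.prems by auto
  have finA: "finite (A k)" for k by (rule finite_subset[OF _ finite_mdeg_less[of k]]) (auto simp: A_def)
  define P where "P = (\<lambda>a y. \<Sum>\<beta>\<in>A (k - a). (monomial \<beta> y / mfact \<beta>) *\<^sub>R
      foldr (\<lambda>i. partial_deriv i ^^ \<beta> i) xs (g a) (zero_coords (set xs) y))"
  have "\<exists>K. 0 \<le> K \<and> (\<forall>y. norm y \<le> 1 \<longrightarrow> norm (g a y - P a y) \<le> K * norm y ^ (k - a))" if "a \<in> {..<k}" for a
    using snoc.IH[OF i(2) Ck_iterated_partial_deriv[OF snoc.prems(2), of a i]] that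
    unfolding P_def g_def A_def by auto
  then obtain K where K: "\<And>a. a < k \<Longrightarrow> 0 \<le> K a"
    "\<And>a y. a < k \<Longrightarrow> norm y \<le> 1 \<Longrightarrow> norm (g a y - P a y) \<le> K a * norm y ^ (k - a)"
    by (metis lessThan_iff)
  obtain K0 where K0: "K0 \<ge> 0" "\<And>x. norm x \<le> 1 \<Longrightarrow>
      norm (f x - (\<Sum>a<k. ((x $ i) ^ a / fact a) *\<^sub>R g a (zero_coords {i} x))) \<le> K0 * \<bar>x $ i\<bar> ^ k"
    using Taylor_one_coordinate[OF snoc.prems(2), of i] unfolding g_def by blast
  show ?case
  proof (intro exI[of _ "K0 + (\<Sum>a<k. K a)"] conjI allI impI)
    show "0 \<le> K0 + (\<Sum>a<k. K a)" using K0 K by (intro add_nonneg_nonneg sum_nonneg) auto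
    fix x :: "real^'d" assume x: "norm x \<le> 1"
    define y where "y = zero_coords {i} x"
    have y: "norm y \<le> norm x" "norm y \<le> 1" using norm_zero_coords_le[of "{i}" x] x by (auto simp: y_def)
    let ?T = "\<Sum>\<alpha>\<in>A'. (monomial \<alpha> x / mfact \<alpha>) *\<^sub>R
        foldr (\<lambda>i. partial_deriv i ^^ \<alpha> i) (xs @ [i]) f (zero_coords (set (xs @ [i])) x)"
    have "?T = (\<Sum>a<k. ((x $ i) ^ a / fact a) *\<^sub>R P a y)"
    proof -
      have "(\<Sum>a<k. ((x $ i) ^ a / fact a) *\<^sub>R P a y) =
        (\<Sum>a<k. \<Sum>\<beta>\<in>A (k - a). ((x $ i) ^ a / fact a * (monomial \<beta> y / mfact \<beta>)) *\<^sub>R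
           foldr (\<lambda>i. partial_deriv i ^^ \<beta> i) xs (g a) (zero_coords (set xs) y))"
        by (simp add: P_def scaleR_sum_right)
      also have "\<dots> = (\<Sum>(a, \<beta>)\<in>(SIGMA a:{..<k}. A (k - a)). ((x $ i) ^ a / fact a * (monomial \<beta> y / mfact \<beta>)) *\<^sub>R
           foldr (\<lambda>i. partial_deriv i ^^ \<beta> i) xs (g a) (zero_coords (set xs) y))"
        by (rule sum.Sigma) (auto simp: finA)
      also have "\<dots> = ?T"
      \<comment> \<open>A multi-index supported in \<open>xs @ [i]\<close> is a pair of its \<open>i\<close>-th entry and the rest.\<close>
      proof (rule sum.reindex_bij_witness[where j = "\<lambda>(a, \<beta>). \<beta>(i := a)" and i = "\<lambda>\<alpha>. (\<alpha> i, \<alpha>(i := 0))"])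
        fix c assume "c \<in> (SIGMA a:{..<k}. A (k - a))"
        then obtain a \<beta> where c: "c = (a, \<beta>)" "a < k" "\<beta> \<in> A (k - a)" by auto
        have \<beta>i: "\<beta> i = 0" using c(3) i by (simp add: A_def)
        show "(case c of (a, \<beta>) \<Rightarrow> \<beta>(i := a)) \<in> A'"
          using c mdeg_upd[of \<beta> i a] \<beta>i by (auto simp: A_def A'_def)
        show "((case c of (a, \<beta>) \<Rightarrow> \<beta>(i := a)) i, (case c of (a, \<beta>) \<Rightarrow> \<beta>(i := a))(i := 0)) = c"
          using c \<beta>i by auto
        let ?\<alpha> = "\<beta>(i := a)"
        have "monomial ?\<alpha> x = (x $ i) ^ a * monomial \<beta> y"
          unfolding monomial_split[of _ _ i] using \<beta>i
          by (auto simp: y_def zero_coords_def intro!: prod.cong)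
        moreover have "mfact ?\<alpha> = fact a * mfact \<beta>"
          unfolding mfact_def using \<beta>i by (simp add: prod.remove[of UNIV i])
        moreover have "foldr (\<lambda>i. partial_deriv i ^^ ?\<alpha> i) (xs @ [i]) f =
            foldr (\<lambda>i. partial_deriv i ^^ \<beta> i) xs (g a)"
          using i by (auto simp: g_def intro!: foldr_cong)
        moreover have "zero_coords (set (xs @ [i])) x = zero_coords (set xs) y"
          by (simp add: y_def zero_coords_zero_coords)
        ultimately show "(monomial (case c of (a, \<beta>) \<Rightarrow> \<beta>(i := a)) x / mfact (case c of (a, \<beta>) \<Rightarrow> \<beta>(i := a))) *\<^sub>R
            foldr (\<lambda>j. partial_deriv j ^^ (case c of (a, \<beta>) \<Rightarrow> \<beta>(i := a)) j) (xs @ [i]) f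
              (zero_coords (set (xs @ [i])) x) =
          (case c of (a, \<beta>) \<Rightarrow> ((x $ i) ^ a / fact a * (monomial \<beta> y / mfact \<beta>)) *\<^sub>R
             foldr (\<lambda>i. partial_deriv i ^^ \<beta> i) xs (g a) (zero_coords (set xs) y))"
          using c by simp
      next
        fix \<alpha> assume \<alpha>: "\<alpha> \<in> A'"
        show "(case (\<alpha> i, \<alpha>(i := 0)) of (a, \<beta>) \<Rightarrow> \<beta>(i := a)) = \<alpha>" by simp
        show "(\<alpha> i, \<alpha>(i := 0)) \<in> (SIGMA a:{..<k}. A (k - a))"
          using \<alpha> mdeg_upd[of \<alpha> i 0] by (auto simp: A_def A'_def)
      qed
      finally show ?thesis by simp
    qed
    then have "f x - ?T = (f x - (\<Sum>a<k. ((x $ i) ^ a / fact a) *\<^sub>R g a y)) +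
        (\<Sum>a<k. ((x $ i) ^ a / fact a) *\<^sub>R (g a y - P a y))"
      by (simp add: scaleR_diff_right sum_subtractf)
    then have "norm (f x - ?T) \<le> norm (f x - (\<Sum>a<k. ((x $ i) ^ a / fact a) *\<^sub>R g a y)) +
        norm (\<Sum>a<k. ((x $ i) ^ a / fact a) *\<^sub>R (g a y - P a y))"
      by (simp only: norm_triangle_ineq)
    also have "\<dots> \<le> K0 * norm x ^ k + (\<Sum>a<k. K a * norm x ^ k)"
    proof (intro add_mono sum_norm_le)
      have "K0 * \<bar>x $ i\<bar> ^ k \<le> K0 * norm x ^ k"
        using K0(1) component_le_norm_cart[of x i] by (intro mult_left_mono power_mono) auto
      then show "norm (f x - (\<Sum>a<k. ((x $ i) ^ a / fact a) *\<^sub>R g a y)) \<le> K0 * norm x ^ k"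
        using K0(2)[OF x] unfolding y_def by linarith
      fix a assume "a \<in> {..<k}"
      then have a: "a < k" by simp
      have "\<bar>(x $ i) ^ a / fact a\<bar> \<le> \<bar>x $ i\<bar> ^ a"
        using fact_ge_1[of a, where 'a = real] by (simp add: power_abs divide_le_eq mult_le_cancel_left1)
      also have "\<dots> \<le> norm x ^ a" using component_le_norm_cart[of x i] by (intro power_mono) auto
      finally have 1: "\<bar>(x $ i) ^ a / fact a\<bar> \<le> norm x ^ a" .
      have "K a * norm y ^ (k - a) \<le> K a * norm x ^ (k - a)"
        using K(1)[OF a] y by (intro mult_left_mono power_mono) auto
      then have 2: "norm (g a y - P a y) \<le> K a * norm x ^ (k - a)" using K(2)[OF a y(2)] by linarith
      have "norm (((x $ i) ^ a / fact a) *\<^sub>R (g a y - P a y)) \<le> norm x ^ a * (K a * norm x ^ (k - a))"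
        unfolding norm_scaleR using 1 2 by (intro mult_mono) auto
      also have "\<dots> = K a * norm x ^ k" using a by (simp add: power_add[symmetric])
      finally show "norm (((x $ i) ^ a / fact a) *\<^sub>R (g a y - P a y)) \<le> K a * norm x ^ k" .
    qed
    also have "\<dots> = (K0 + (\<Sum>a<k. K a)) * norm x ^ k" by (simp add: distrib_right sum_distrib_right)
    finally show "norm (f x - (\<Sum>\<alpha> | mdeg \<alpha> < k \<and> (\<forall>j. j \<notin> set (xs @ [i]) \<longrightarrow> \<alpha> j = 0).
        (monomial \<alpha> x / mfact \<alpha>) *\<^sub>R foldr (\<lambda>i. partial_deriv i ^^ \<alpha> i) (xs @ [i]) f
          (zero_coords (set (xs @ [i])) x))) \<le> (K0 + (\<Sum>a<k. K a)) * norm x ^ k"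
      unfolding A'_def .
  qed
qed

theorem Taylor_vpoly:
  fixes f :: "real^'d::finite \<Rightarrow> real^'e::finite"
  assumes "Ck k f"
  obtains b K where "supported_below k b" "0 \<le> K"
    "\<And>\<alpha>. mdeg \<alpha> < k \<Longrightarrow> multi_deriv \<alpha> f 0 = multi_deriv \<alpha> (vpoly k b) 0"
    "\<And>x. norm x \<le> 1 \<Longrightarrow> norm (f x - vpoly k b x) \<le> K * norm x ^ k"
proof -
  define b where "b = (\<lambda>\<alpha>. if mdeg \<alpha> < k then (1 / mfact \<alpha>) *\<^sub>R multi_deriv \<alpha> f 0 else 0)"
  have b: "supported_below k b" by (simp add: b_def supported_below_def)
  have "vpoly k b x = (\<Sum>\<alpha> | mdeg \<alpha> < k \<and> (\<forall>j. j \<notin> set (coords :: 'd list) \<longrightarrow> \<alpha> j = 0).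
        (monomial \<alpha> x / mfact \<alpha>) *\<^sub>R foldr (\<lambda>i. partial_deriv i ^^ \<alpha> i) coords f (zero_coords (set coords) x))" for x
    unfolding vpoly_def b_def by (auto simp: set_coords multi_deriv_def intro!: sum.cong)
  then obtain K where "K \<ge> 0" "\<And>x. norm x \<le> 1 \<Longrightarrow> norm (f x - vpoly k b x) \<le> K * norm x ^ k"
    using Taylor_coordinate_list[OF distinct_coords assms] by auto
  moreover have "multi_deriv \<alpha> f 0 = multi_deriv \<alpha> (vpoly k b) 0" if "mdeg \<alpha> < k" for \<alpha>
    using that by (simp add: multi_deriv_vpoly_at_0[OF b]) (simp add: b_def)
  ultimately show ?thesis using b that by blast
qed

section \<open>Coercivity of the Gram form of the monomials\<close>

text \<open>A nonzero value of \<open>p\<close> would persist on a nonempty open set, and such a set is not negligible.\<close>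

lemma zero_on_ball_if_square_integral_0:
  fixes p :: "'a::euclidean_space \<Rightarrow> real"
  assumes cont: "continuous_on UNIV p" and "0 < r"
    and int: "(\<integral>x. indicator (cball 0 r) x * (p x)\<^sup>2 \<partial>lborel) = 0" and x: "x \<in> ball 0 r"
  shows "p x = 0"
proof (rule ccontr)
  assume nz: "p x \<noteq> 0"
  let ?q = "\<lambda>x. indicator (cball 0 r) x * (p x)\<^sup>2"
  have "continuous_on (cball 0 r) (\<lambda>x. (p x)\<^sup>2)"
    by (intro continuous_intros continuous_on_subset[OF cont]) auto
  then have "integrable lborel ?q"
    using borel_integrable_compact[OF compact_cball, of 0 r "\<lambda>x. (p x)\<^sup>2"]
    unfolding real_scaleR_def by blast
  then have "AE x in lborel. ?q x = 0"
    using int by (subst (asm) integral_nonneg_eq_0_iff_AE) auto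
  then obtain N where N: "N \<in> null_sets lborel" "\<And>x. x \<notin> N \<Longrightarrow> ?q x = 0"
    by (rule AE_E3) auto
  define O' where "O' = ball 0 r \<inter> {x. p x \<noteq> 0}"
  have "open O'" unfolding O'_def
    using open_Collect_neq[OF cont continuous_on_const, of 0] by auto
  moreover have "x \<in> O'" using x nz by (simp add: O'_def)
  ultimately have "\<not> negligible O'" using open_not_negligible by blast
  moreover have "O' \<subseteq> N"
  proof
    fix z assume z: "z \<in> O'"
    then have "?q z \<noteq> 0" by (auto simp: O'_def)
    then show "z \<in> N" using N(2) by blast
  qed
  moreover have "negligible N" using N(1) by (simp add: negligible_iff_null_sets null_sets_completionI)
  ultimately show False using negligible_subset by blast
qed

text \<open>The right side is a quadratic form in the finitely many coefficients.  It is continuous, hence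
  attains its minimum on the unit sphere, and the minimum is positive since a polynomial that vanishes
  on a ball has zero coefficients.  The sphere is realised inside a product of intervals, so
  that Tychonoff's theorem gives its compactness.\<close>

lemma monomials_L2_lower_bound:
  "\<exists>c>0. \<forall>\<gamma> :: ('d::finite \<Rightarrow> nat) \<Rightarrow> real.
     c * (\<Sum>\<alpha> | mdeg \<alpha> < k. (\<gamma> \<alpha>)\<^sup>2) \<le>
     (\<integral>x. indicator (cball 0 1) x * (\<Sum>\<alpha> | mdeg \<alpha> < k. \<gamma> \<alpha> * monomial \<alpha> x)\<^sup>2 \<partial>lborel)"
proof (cases "k = 0")
  case True
  then show ?thesis by (intro exI[of _ 1]) auto
next
  case False
  define A where "A = {\<alpha> :: 'd \<Rightarrow> nat. mdeg \<alpha> < k}"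
  have finA: "finite A" by (simp add: A_def)
  define p where "p = (\<lambda>\<gamma> (x::real^'d). \<Sum>\<alpha>\<in>A. \<gamma> \<alpha> * monomial \<alpha> x)"
  define Q where "Q = (\<lambda>\<gamma>. \<integral>x. indicator (cball 0 1) x * (p \<gamma> x)\<^sup>2 \<partial>lborel)"
  define G where "G = (\<lambda>\<alpha> \<beta>. \<integral>x. indicator (cball (0::real^'d) 1) x * (monomial \<alpha> x * monomial \<beta> x) \<partial>lborel)"
  have int: "integrable lborel (\<lambda>x. indicator (cball (0::real^'d) 1) x * (monomial \<alpha> x * monomial \<beta> x))" for \<alpha> \<beta>
  proof -
    have "continuous_on (cball 0 1) (\<lambda>x::real^'d. monomial \<alpha> x * monomial \<beta> x)" by (intro continuous_intros)
    from borel_integrable_compact[OF compact_cball this] show ?thesis unfolding real_scaleR_def .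
  qed
  have QG: "Q \<gamma> = (\<Sum>\<alpha>\<in>A. \<Sum>\<beta>\<in>A. \<gamma> \<alpha> * \<gamma> \<beta> * G \<alpha> \<beta>)" for \<gamma>
  proof -
    have "indicator (cball 0 1) x * (p \<gamma> x)\<^sup>2 =
        (\<Sum>\<alpha>\<in>A. \<Sum>\<beta>\<in>A. (\<gamma> \<alpha> * \<gamma> \<beta>) * (indicator (cball 0 1) x * (monomial \<alpha> x * monomial \<beta> x)))" for x
    proof -
      have "(p \<gamma> x)\<^sup>2 = (\<Sum>\<alpha>\<in>A. \<Sum>\<beta>\<in>A. (\<gamma> \<alpha> * monomial \<alpha> x) * (\<gamma> \<beta> * monomial \<beta> x))"
        unfolding p_def power2_eq_square by (rule sum_product)
      then show ?thesis by (simp only: sum_distrib_left) (intro sum.cong refl, simp)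
    qed
    then have "Q \<gamma> = (\<integral>x. (\<Sum>\<alpha>\<in>A. \<Sum>\<beta>\<in>A. (\<gamma> \<alpha> * \<gamma> \<beta>) * (indicator (cball 0 1) x * (monomial \<alpha> x * monomial \<beta> x))) \<partial>lborel)"
      unfolding Q_def by presburger
    also have "\<dots> = (\<Sum>\<alpha>\<in>A. \<Sum>\<beta>\<in>A. \<gamma> \<alpha> * \<gamma> \<beta> * G \<alpha> \<beta>)"
      unfolding G_def using int by (simp add: Bochner_Integration.integral_sum)
    finally show ?thesis .
  qed
  \<comment> \<open>The unit sphere of the coefficient space, as a subset of all real functions on multi-indices: entries
    outside \<open>A\<close> are pinned to \<open>0\<close>, which makes the set compact.\<close>
  define S where "S = (PiE UNIV (\<lambda>\<alpha>. if \<alpha> \<in> A then {-1..1} else {0::real})) \<inter> {\<gamma>. (\<Sum>\<alpha>\<in>A. (\<gamma> \<alpha>)\<^sup>2) = 1}"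
  have "compact (PiE UNIV (\<lambda>\<alpha>. if \<alpha> \<in> A then {-1..1} else {0::real}))"
    using compactin_PiE[of "\<lambda>_. euclidean" "UNIV :: ('d \<Rightarrow> nat) set" "\<lambda>\<alpha>. if \<alpha> \<in> A then {-1..1} else {0::real}"]
    by (simp add: euclidean_product_topology)
  moreover have "closed {\<gamma> :: ('d \<Rightarrow> nat) \<Rightarrow> real. (\<Sum>\<alpha>\<in>A. (\<gamma> \<alpha>)\<^sup>2) = 1}"
    by (intro closed_Collect_eq continuous_intros continuous_on_product_coordinates)
  ultimately have "compact S" unfolding S_def by (rule compact_Int_closed)
  moreover have "(\<lambda>\<alpha>. if \<alpha> = (\<lambda>_. 0) then 1 else 0) \<in> S"
  proof -
    have "(\<lambda>_. 0) \<in> A" using False by (simp add: A_def)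
    then show ?thesis unfolding S_def using finA by (auto simp: if_distrib[of "\<lambda>x. x\<^sup>2"] cong: if_cong)
  qed
  moreover have "continuous_on S Q"
    unfolding QG by (intro continuous_intros continuous_on_subset[OF continuous_on_product_coordinates]) auto
  ultimately obtain \<gamma>0 where \<gamma>0: "\<gamma>0 \<in> S" "\<And>\<gamma>. \<gamma> \<in> S \<Longrightarrow> Q \<gamma>0 \<le> Q \<gamma>"
    using continuous_attains_inf[of S Q] by (metis empty_iff)
  have Q0: "Q \<gamma> \<ge> 0" for \<gamma> unfolding Q_def by (intro integral_nonneg_AE) auto
  have "Q \<gamma>0 \<noteq> 0"
  proof
    assume "Q \<gamma>0 = 0"
    have cont: "continuous_on UNIV (p \<gamma>0)" unfolding p_def by (intro continuous_intros)
    have p0: "p \<gamma>0 x = 0" if "x \<in> ball 0 1" for x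
      using zero_on_ball_if_square_integral_0[OF cont _ _ that] \<open>Q \<gamma>0 = 0\<close> by (simp add: Q_def)
    \<comment> \<open>The uniqueness of coefficients is stated for vector-valued polynomials; scalars are vectors of
      dimension one.\<close>
    define b where "b = (\<lambda>\<alpha>. if \<alpha> \<in> A then vec (\<gamma>0 \<alpha>) else (0 :: real^1))"
    have b: "supported_below k b" by (auto simp: b_def supported_below_def A_def)
    have "vpoly k b x = vec (p \<gamma>0 x)" for x
      unfolding vpoly_def p_def b_def A_def by (auto simp: vec_eq_iff mult.commute intro!: sum.cong)
    then have "vpoly k b x = 0" if "x \<in> ball 0 1" for x
      using p0[OF that] by (simp add: vec_eq_iff)
    then have "b \<alpha> = 0" for \<alpha>
      using b by (intro vpoly_eq_0_on_open_imp_coeff_0[of "ball 0 1" k b]) auto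
    then have "\<gamma>0 \<alpha> = 0" if "\<alpha> \<in> A" for \<alpha>
      using that unfolding b_def by (metis vec_component zero_index)
    then show False using \<gamma>0(1) by (simp add: S_def)
  qed
  then have pos: "Q \<gamma>0 > 0" using Q0[of \<gamma>0] by linarith
  have "Q \<gamma>0 * (\<Sum>\<alpha>\<in>A. (\<gamma> \<alpha>)\<^sup>2) \<le> Q \<gamma>" for \<gamma>
  proof (cases "(\<Sum>\<alpha>\<in>A. (\<gamma> \<alpha>)\<^sup>2) = 0")
    case True
    then show ?thesis using Q0 by simp
  next
    case False
    define N where "N = (\<Sum>\<alpha>\<in>A. (\<gamma> \<alpha>)\<^sup>2)"
    have N: "N > 0" using False unfolding N_def by (simp add: order_less_le sum_nonneg)
    define \<gamma>' where "\<gamma>' = (\<lambda>\<alpha>. if \<alpha> \<in> A then \<gamma> \<alpha> / sqrt N else 0)"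
    have sum1: "(\<Sum>\<alpha>\<in>A. (\<gamma>' \<alpha>)\<^sup>2) = 1"
    proof -
      have "(\<Sum>\<alpha>\<in>A. (\<gamma>' \<alpha>)\<^sup>2) = N / N"
        unfolding \<gamma>'_def N_def sum_divide_distrib
        using N by (intro sum.cong) (auto simp: power_divide N_def)
      then show ?thesis using N by simp
    qed
    have "(\<gamma>' \<alpha>)\<^sup>2 \<le> 1" if "\<alpha> \<in> A" for \<alpha>
      using member_le_sum[of \<alpha> A "\<lambda>\<alpha>. (\<gamma>' \<alpha>)\<^sup>2"] that finA sum1 by simp
    then have "\<gamma>' \<alpha> \<in> {-1..1}" if "\<alpha> \<in> A" for \<alpha>
      using that by (metis abs_le_iff abs_square_le_1 atLeastAtMost_iff minus_le_iff)
    then have "\<gamma>' \<in> S" using sum1 by (auto simp: S_def \<gamma>'_def)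
    then have "Q \<gamma>0 \<le> Q \<gamma>'" by (rule \<gamma>0)
    also have "Q \<gamma>' = Q \<gamma> / N"
    proof -
      have "\<gamma>' \<alpha> * \<gamma>' \<beta> * G \<alpha> \<beta> = (\<gamma> \<alpha> * \<gamma> \<beta> * G \<alpha> \<beta>) / N" if "\<alpha> \<in> A" "\<beta> \<in> A" for \<alpha> \<beta>
        using that N by (simp add: \<gamma>'_def)
      then show ?thesis unfolding QG sum_divide_distrib by (intro sum.cong) auto
    qed
    finally show ?thesis using N unfolding N_def[symmetric] by (simp add: pos_le_divide_eq)
  qed
  then show ?thesis using pos unfolding Q_def p_def A_def by blast
qed

section \<open>Least squares on a window\<close>

text \<open>Here \<open>r\<close> are the residuals of a reference fit, split into bias \<open>u\<close> and noise \<open>v\<close>, and \<open>\<gamma>\<close> is the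
  coefficient vector of the correction that least squares makes to it.  Expanding the square in the
  minimality assumption bounds the squared norm of the correction by twice its pairing with the
  residuals.  The pairing is linear in \<open>\<gamma>\<close> and the curvature is quadratic, so one power of the
  largest coefficient cancels.\<close>

lemma least_squares_coefficient_bound:
  fixes r u v :: "'i \<Rightarrow> 'v::real_inner" and \<gamma> :: "'a \<Rightarrow> 'v" and \<phi> :: "'a \<Rightarrow> 'i \<Rightarrow> real"
  assumes finA: "finite A" and finW: "finite W"
    and min: "(\<Sum>i\<in>W. (norm (r i - (\<Sum>\<alpha>\<in>A. \<phi> \<alpha> i *\<^sub>R \<gamma> \<alpha>)))\<^sup>2) \<le> (\<Sum>i\<in>W. (norm (r i))\<^sup>2)"
    and curv: "\<kappa> * (\<Sum>\<alpha>\<in>A. (norm (\<gamma> \<alpha>))\<^sup>2) \<le> (\<Sum>i\<in>W. (norm (\<Sum>\<alpha>\<in>A. \<phi> \<alpha> i *\<^sub>R \<gamma> \<alpha>))\<^sup>2)" and "0 < \<kappa>"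
    and split: "\<And>i. i \<in> W \<Longrightarrow> r i = u i + v i"
    and bias: "\<And>i. i \<in> W \<Longrightarrow> norm (u i) \<le> \<eta>" and "0 \<le> \<eta>"
    and phi: "\<And>\<alpha> i. \<alpha> \<in> A \<Longrightarrow> i \<in> W \<Longrightarrow> \<bar>\<phi> \<alpha> i\<bar> \<le> 1"
    and noise: "\<And>\<alpha>. \<alpha> \<in> A \<Longrightarrow> norm (\<Sum>i\<in>W. \<phi> \<alpha> i *\<^sub>R v i) \<le> \<tau>"
    and "\<alpha> \<in> A"
  shows "\<kappa> * norm (\<gamma> \<alpha>) \<le> 2 * real (card A) * (real (card W) * \<eta> + \<tau>)"
proof -
  define g where "g = (\<lambda>i. \<Sum>\<alpha>\<in>A. \<phi> \<alpha> i *\<^sub>R \<gamma> \<alpha>)"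
  define B where "B = Max ((\<lambda>\<alpha>. norm (\<gamma> \<alpha>)) ` A)"
  have B: "norm (\<gamma> \<alpha>) \<le> B" if "\<alpha> \<in> A" for \<alpha> unfolding B_def using finA that by auto
  have "B \<in> (\<lambda>\<alpha>. norm (\<gamma> \<alpha>)) ` A" unfolding B_def using finA \<open>\<alpha> \<in> A\<close> by (intro Max_in) auto
  then obtain \<beta> where \<beta>: "\<beta> \<in> A" "B = norm (\<gamma> \<beta>)" by auto
  have test: "norm (\<Sum>i\<in>W. \<phi> \<alpha> i *\<^sub>R r i) \<le> real (card W) * \<eta> + \<tau>" if "\<alpha> \<in> A" for \<alpha>
  proof -
    have "(\<Sum>i\<in>W. \<phi> \<alpha> i *\<^sub>R r i) = (\<Sum>i\<in>W. \<phi> \<alpha> i *\<^sub>R u i) + (\<Sum>i\<in>W. \<phi> \<alpha> i *\<^sub>R v i)"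
      by (simp add: split scaleR_add_right sum.distrib)
    then have "norm (\<Sum>i\<in>W. \<phi> \<alpha> i *\<^sub>R r i) \<le> norm (\<Sum>i\<in>W. \<phi> \<alpha> i *\<^sub>R u i) + norm (\<Sum>i\<in>W. \<phi> \<alpha> i *\<^sub>R v i)"
      by (simp only: norm_triangle_ineq)
    moreover have "norm (\<Sum>i\<in>W. \<phi> \<alpha> i *\<^sub>R u i) \<le> (\<Sum>i\<in>W. \<eta>)"
    proof (rule sum_norm_le)
      fix i assume "i \<in> W"
      then have "\<bar>\<phi> \<alpha> i\<bar> * norm (u i) \<le> 1 * \<eta>"
        using phi[OF that] bias by (intro mult_mono) auto
      then show "norm (\<phi> \<alpha> i *\<^sub>R u i) \<le> \<eta>" by simp
    qed
    ultimately show ?thesis using noise[OF that] by simp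
  qed
  have "(\<Sum>i\<in>W. (norm (r i - g i))\<^sup>2) = (\<Sum>i\<in>W. (norm (r i))\<^sup>2) - 2 * (\<Sum>i\<in>W. r i \<bullet> g i) + (\<Sum>i\<in>W. (norm (g i))\<^sup>2)"
    unfolding power2_norm_eq_inner sum_distrib_left sum_subtractf[symmetric] sum.distrib[symmetric]
    by (intro sum.cong refl) (simp add: inner_diff_left inner_diff_right inner_commute)
  then have "(\<Sum>i\<in>W. (norm (g i))\<^sup>2) \<le> 2 * (\<Sum>i\<in>W. r i \<bullet> g i)"
    using min unfolding g_def by linarith
  also have "(\<Sum>i\<in>W. r i \<bullet> g i) = (\<Sum>\<alpha>\<in>A. (\<Sum>i\<in>W. \<phi> \<alpha> i *\<^sub>R r i) \<bullet> \<gamma> \<alpha>)"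
    unfolding g_def inner_sum_right inner_sum_left by (subst sum.swap) simp
  also have "\<dots> \<le> (\<Sum>\<alpha>\<in>A. (real (card W) * \<eta> + \<tau>) * B)"
  proof (rule sum_mono)
    fix \<alpha> assume "\<alpha> \<in> A"
    have "(\<Sum>i\<in>W. \<phi> \<alpha> i *\<^sub>R r i) \<bullet> \<gamma> \<alpha> \<le> norm (\<Sum>i\<in>W. \<phi> \<alpha> i *\<^sub>R r i) * norm (\<gamma> \<alpha>)"
      by (rule norm_cauchy_schwarz)
    also have "\<dots> \<le> (real (card W) * \<eta> + \<tau>) * B"
      using test[OF \<open>\<alpha> \<in> A\<close>] B[OF \<open>\<alpha> \<in> A\<close>] by (intro mult_mono) (auto intro: order_trans[OF norm_ge_zero])
    finally show "(\<Sum>i\<in>W. \<phi> \<alpha> i *\<^sub>R r i) \<bullet> \<gamma> \<alpha> \<le> (real (card W) * \<eta> + \<tau>) * B" .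
  qed
  finally have "\<kappa> * (\<Sum>\<alpha>\<in>A. (norm (\<gamma> \<alpha>))\<^sup>2) \<le> (2 * real (card A) * (real (card W) * \<eta> + \<tau>)) * B"
    using curv unfolding g_def by (simp add: mult_ac)
  moreover have "\<kappa> * B\<^sup>2 \<le> \<kappa> * (\<Sum>\<alpha>\<in>A. (norm (\<gamma> \<alpha>))\<^sup>2)"
    using member_le_sum[of \<beta> A "\<lambda>\<alpha>. (norm (\<gamma> \<alpha>))\<^sup>2"] \<beta> finA \<open>0 < \<kappa>\<close> by (intro mult_left_mono) auto
  ultimately have quad: "(\<kappa> * B) * B \<le> (2 * real (card A) * (real (card W) * \<eta> + \<tau>)) * B"
    by (simp add: power2_eq_square mult_ac)
  have rhs: "0 \<le> 2 * real (card A) * (real (card W) * \<eta> + \<tau>)"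
    using test[OF \<beta>(1)] by (intro mult_nonneg_nonneg) (auto intro: order_trans[OF norm_ge_zero])
  have "\<kappa> * B \<le> 2 * real (card A) * (real (card W) * \<eta> + \<tau>)"
  proof (cases "B = 0")
    case False
    then have "B > 0" using \<beta>(2) by simp
    with quad show ?thesis by simp
  qed (use rhs in simp)
  moreover have "\<kappa> * norm (\<gamma> \<alpha>) \<le> \<kappa> * B" using B[OF \<open>\<alpha> \<in> A\<close>] \<open>0 < \<kappa>\<close> by simp
  ultimately show ?thesis by linarith
qed

text \<open>Monomials of the rescaled variable \<open>x / h\<close>, cut off outside the window: these are bounded by \<open>1\<close> for
  every bandwidth.\<close>

definition window_monomial :: "real \<Rightarrow> ('d::finite \<Rightarrow> nat) \<Rightarrow> real^'d \<Rightarrow> real" where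
  "window_monomial h \<alpha> x = indicator (cball 0 h) x * monomial \<alpha> ((1 / h) *\<^sub>R x)"

lemma borel_measurable_window_monomial [measurable]:
  "window_monomial h \<alpha> \<in> borel_measurable (borel :: (real^'d::finite) measure)"
proof -
  have [measurable]: "cball 0 h \<in> sets (borel :: (real^'d) measure)" by simp
  show ?thesis unfolding window_monomial_def[abs_def]
    by (intro borel_measurable_times borel_measurable_indicator borel_measurable_monomial) measurable
qed

lemma abs_window_monomial_le:
  assumes "0 < h" shows "\<bar>window_monomial h \<alpha> x\<bar> \<le> indicator (cball 0 h) x"
  using assms abs_monomial_le[of "(1 / h) *\<^sub>R x" 1 \<alpha>]
  by (auto simp: window_monomial_def indicator_def)

lemma sum_window:
  fixes F :: "nat \<Rightarrow> 'v::real_vector"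
  shows "(\<Sum>i<n. indicator (cball 0 h) (fst (s i)) *\<^sub>R F i) = (\<Sum>i\<in>window h n s. F i)"
proof -
  have "(\<Sum>i<n. indicator (cball 0 h) (fst (s i)) *\<^sub>R F i) = (\<Sum>i<n. if norm (fst (s i)) \<le> h then F i else 0)"
    by (intro sum.cong) (auto simp: indicator_def)
  also have "\<dots> = (\<Sum>i\<in>window h n s. F i)"
    by (subst sum.inter_filter[symmetric]) (auto simp: window_def intro!: sum.cong)
  finally show ?thesis .
qed

lemma finite_window [simp]: "finite (window h n s)"
  unfolding window_def by auto

text \<open>The reference fit is the polynomial with coefficients \<open>b\<close>.  Scaling the coefficient of index \<open>\<alpha>\<close> by
  \<open>h\<^bsup>|\<alpha>|\<^esup>\<close> expresses the correction through monomials bounded by \<open>1\<close> on the window.  Curvature and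
  noise are assumed for scalar coefficients and for components, which is the form in which they are
  obtained probabilistically, and are summed over the components.\<close>

lemma local_polynomial_coefficient_error:
  fixes s :: "('d::finite, 'e::finite) sample"
  assumes h: "0 < h" and "0 < \<kappa>"
    and argmin: "is_arg_min (empirical_risk h n s) (\<lambda>\<pi>. \<pi> \<in> vpolys k) (vpoly k b')"
    and bias: "\<And>x. norm x \<le> h \<Longrightarrow> norm (f x - vpoly k b x) \<le> \<eta>" and "0 \<le> \<eta>"
    and curv: "\<And>\<gamma> :: ('d \<Rightarrow> nat) \<Rightarrow> real. \<kappa> * (\<Sum>\<alpha> | mdeg \<alpha> < k. (\<gamma> \<alpha>)\<^sup>2) \<le>
       (\<Sum>i<n. (\<Sum>\<alpha> | mdeg \<alpha> < k. \<gamma> \<alpha> * window_monomial h \<alpha> (fst (s i)))\<^sup>2)"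
    and noise: "\<And>\<alpha> e. mdeg \<alpha> < k \<Longrightarrow>
       \<bar>\<Sum>i<n. (f (fst (s i)) - snd (s i)) $ e * window_monomial h \<alpha> (fst (s i))\<bar> \<le> \<tau>"
    and \<alpha>: "mdeg \<alpha> < k"
  shows "\<kappa> * (h ^ mdeg \<alpha> * norm (b' \<alpha> - b \<alpha>)) \<le>
    2 * real (card {\<alpha> :: 'd \<Rightarrow> nat. mdeg \<alpha> < k}) * (real (card (window h n s)) * \<eta> + real CARD('e) * \<tau>)"
proof -
  define A where "A = {\<alpha> :: 'd \<Rightarrow> nat. mdeg \<alpha> < k}"
  define W where "W = window h n s"
  define \<phi> where "\<phi> = (\<lambda>\<alpha> i. monomial \<alpha> ((1 / h) *\<^sub>R fst (s i)))"
  define \<gamma> where "\<gamma> = (\<lambda>\<alpha>. h ^ mdeg \<alpha> *\<^sub>R (b' \<alpha> - b \<alpha>))"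
  have g: "(\<Sum>\<alpha>\<in>A. \<phi> \<alpha> i *\<^sub>R \<gamma> \<alpha>) = vpoly k b' (fst (s i)) - vpoly k b (fst (s i))" for i
  proof -
    have "\<phi> \<alpha> i *\<^sub>R \<gamma> \<alpha> = monomial \<alpha> (fst (s i)) *\<^sub>R b' \<alpha> - monomial \<alpha> (fst (s i)) *\<^sub>R b \<alpha>" for \<alpha>
      using h by (simp add: \<phi>_def \<gamma>_def monomial_scaleR power_one_over scaleR_diff_right)
    then show ?thesis unfolding vpoly_def A_def by (simp add: sum_subtractf)
  qed
  have risk_sum: "(\<Sum>i\<in>W. (norm (snd (s i) - \<pi> (fst (s i))))\<^sup>2) = real (card W) * empirical_risk h n s \<pi>" for \<pi>
    unfolding empirical_risk_def W_def[symmetric]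
    by (cases "card W = 0") (auto simp: W_def)
  have "empirical_risk h n s (vpoly k b') \<le> empirical_risk h n s (vpoly k b)"
    using argmin is_arg_min_linorder unfolding vpolys_eq by (metis rangeI)
  then have "(\<Sum>i\<in>W. (norm (snd (s i) - vpoly k b' (fst (s i))))\<^sup>2) \<le> (\<Sum>i\<in>W. (norm (snd (s i) - vpoly k b (fst (s i))))\<^sup>2)"
    unfolding risk_sum by (intro mult_left_mono) auto
  then have min: "(\<Sum>i\<in>W. (norm ((snd (s i) - vpoly k b (fst (s i))) - (\<Sum>\<alpha>\<in>A. \<phi> \<alpha> i *\<^sub>R \<gamma> \<alpha>)))\<^sup>2)
      \<le> (\<Sum>i\<in>W. (norm (snd (s i) - vpoly k b (fst (s i))))\<^sup>2)"
    by (simp add: g)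
  have curvW: "\<kappa> * (\<Sum>\<alpha>\<in>A. (c \<alpha>)\<^sup>2) \<le> (\<Sum>i\<in>W. (\<Sum>\<alpha>\<in>A. \<phi> \<alpha> i * c \<alpha>)\<^sup>2)" for c :: "('d \<Rightarrow> nat) \<Rightarrow> real"
  proof -
    have "(\<Sum>i<n. (\<Sum>\<alpha>\<in>A. c \<alpha> * window_monomial h \<alpha> (fst (s i)))\<^sup>2) =
        (\<Sum>i<n. indicator (cball 0 h) (fst (s i)) *\<^sub>R (\<Sum>\<alpha>\<in>A. \<phi> \<alpha> i * c \<alpha>)\<^sup>2)"
      by (intro sum.cong refl) (auto simp: window_monomial_def \<phi>_def indicator_def mult.commute)
    also have "\<dots> = (\<Sum>i\<in>W. (\<Sum>\<alpha>\<in>A. \<phi> \<alpha> i * c \<alpha>)\<^sup>2)" unfolding W_def by (rule sum_window)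
    finally show ?thesis using curv[of c] unfolding A_def by simp
  qed
  have norm_sq: "(norm x)\<^sup>2 = (\<Sum>e\<in>UNIV. (x $ e)\<^sup>2)" for x :: "real^'e"
    unfolding power2_norm_eq_inner inner_vec_def by (simp add: power2_eq_square)
  have curv': "\<kappa> * (\<Sum>\<alpha>\<in>A. (norm (\<gamma> \<alpha>))\<^sup>2) \<le> (\<Sum>i\<in>W. (norm (\<Sum>\<alpha>\<in>A. \<phi> \<alpha> i *\<^sub>R \<gamma> \<alpha>))\<^sup>2)"
  proof -
    have "\<kappa> * (\<Sum>\<alpha>\<in>A. (norm (\<gamma> \<alpha>))\<^sup>2) = (\<Sum>e\<in>UNIV. \<kappa> * (\<Sum>\<alpha>\<in>A. (\<gamma> \<alpha> $ e)\<^sup>2))"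
      unfolding norm_sq by (subst sum.swap) (simp add: sum_distrib_left)
    also have "\<dots> \<le> (\<Sum>e\<in>UNIV. \<Sum>i\<in>W. (\<Sum>\<alpha>\<in>A. \<phi> \<alpha> i * \<gamma> \<alpha> $ e)\<^sup>2)"
      by (intro sum_mono curvW)
    also have "\<dots> = (\<Sum>i\<in>W. (norm (\<Sum>\<alpha>\<in>A. \<phi> \<alpha> i *\<^sub>R \<gamma> \<alpha>))\<^sup>2)"
      unfolding norm_sq by (subst sum.swap) simp
    finally show ?thesis .
  qed
  have noise': "norm (\<Sum>i\<in>W. \<phi> \<alpha> i *\<^sub>R (snd (s i) - f (fst (s i)))) \<le> real CARD('e) * \<tau>" if "\<alpha> \<in> A" for \<alpha>
  proof -
    have "(\<Sum>i\<in>W. \<phi> \<alpha> i *\<^sub>R (snd (s i) - f (fst (s i)))) $ e =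
        - (\<Sum>i<n. (f (fst (s i)) - snd (s i)) $ e * window_monomial h \<alpha> (fst (s i)))" for e
    proof -
      have "(\<Sum>i\<in>W. \<phi> \<alpha> i *\<^sub>R (snd (s i) - f (fst (s i)))) =
          (\<Sum>i<n. indicator (cball 0 h) (fst (s i)) *\<^sub>R (\<phi> \<alpha> i *\<^sub>R (snd (s i) - f (fst (s i)))))"
        unfolding W_def by (rule sum_window[symmetric])
      then show ?thesis
        by (auto simp: window_monomial_def \<phi>_def sum_negf[symmetric] algebra_simps intro!: sum.cong)
    qed
    then have "\<bar>(\<Sum>i\<in>W. \<phi> \<alpha> i *\<^sub>R (snd (s i) - f (fst (s i)))) $ e\<bar> \<le> \<tau>" for e
      using noise[of \<alpha> e] that by (simp add: A_def)
    then have "(\<Sum>e\<in>UNIV. \<bar>(\<Sum>i\<in>W. \<phi> \<alpha> i *\<^sub>R (snd (s i) - f (fst (s i)))) $ e\<bar>) \<le> (\<Sum>e\<in>(UNIV::'e set). \<tau>)"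
      by (intro sum_mono)
    then show ?thesis using norm_le_l1_cart[of "\<Sum>i\<in>W. \<phi> \<alpha> i *\<^sub>R (snd (s i) - f (fst (s i)))"] by simp
  qed
  have "\<kappa> * norm (\<gamma> \<alpha>) \<le> 2 * real (card A) * (real (card W) * \<eta> + real CARD('e) * \<tau>)"
  proof (rule least_squares_coefficient_bound[OF _ _ min curv' \<open>0 < \<kappa>\<close>])
    show "snd (s i) - vpoly k b (fst (s i)) = (f (fst (s i)) - vpoly k b (fst (s i))) + (snd (s i) - f (fst (s i)))" for i
      by simp
    show "norm (f (fst (s i)) - vpoly k b (fst (s i))) \<le> \<eta>" if "i \<in> W" for i
      using bias that by (simp add: W_def window_def)
    show "\<bar>\<phi> \<alpha> i\<bar> \<le> 1" if "i \<in> W" for \<alpha> i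
      using abs_monomial_le[of "(1 / h) *\<^sub>R fst (s i)" 1 \<alpha>] that h by (simp add: \<phi>_def W_def window_def)
  qed (use noise' \<alpha> \<open>0 \<le> \<eta>\<close> in \<open>auto simp: A_def W_def\<close>)
  then show ?thesis using h by (simp add: \<gamma>_def A_def W_def)
qed

section \<open>Sums over i.i.d. samples\<close>

lemma prob_space_iid_law:
  assumes "prob_space M" "X \<in> borel_measurable M" "Y \<in> borel_measurable M"
  shows "prob_space (distr M borel (\<lambda>\<omega>. (X \<omega> :: real^'d::finite, Y \<omega> :: real^'e::finite)))" "prob_space (iid_law M X Y n)"
proof -
  show *: "prob_space (distr M borel (\<lambda>\<omega>. (X \<omega>, Y \<omega>)))"
    using assms by (intro prob_space.prob_space_distr) auto
  then show "prob_space (iid_law M X Y n)" unfolding iid_law_def by (intro prob_space_PiM)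
qed

lemma sets_iid_law: "sets (iid_law M X Y n) = sets (sample_space n)"
  and space_iid_law: "space (iid_law M X Y n) = space (sample_space n)"
  unfolding iid_law_def sample_space_def by (auto intro!: sets_PiM_cong simp: space_PiM)

text \<open>Centred copies are orthogonal, so the variance of the sum is the sum of the variances.  Orthogonality
  comes from the integral of a product of functions of different coordinates.\<close>

lemma Chebyshev_iid_sum:
  fixes g :: "'a \<Rightarrow> real"
  assumes N: "prob_space N" and g [measurable]: "g \<in> borel_measurable N"
    and sq: "integrable N (\<lambda>x. (g x)\<^sup>2)" "(\<integral>x. (g x)\<^sup>2 \<partial>N) \<le> v" and t: "t > 0"
  shows "measure (PiM {..<n} (\<lambda>_. N))
     {s \<in> space (PiM {..<n} (\<lambda>_. N)). t \<le> \<bar>(\<Sum>i<n. g (s i)) - real n * (\<integral>x. g x \<partial>N)\<bar>} \<le> real n * v / t\<^sup>2"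
proof -
  interpret N: prob_space N by fact
  interpret PS: product_prob_space "\<lambda>_::nat. N" "{..<n}" by unfold_locales
  let ?P = "PiM {..<n} (\<lambda>_. N)"
  define m where "m = (\<integral>x. g x \<partial>N)"
  define g0 where "g0 = (\<lambda>x. g x - m)"
  have [measurable]: "g0 \<in> borel_measurable N" unfolding g0_def by measurable
  have int: "integrable N g" by (rule N.square_integrable_imp_integrable[OF g sq(1)])
  have int0: "integrable N g0" "(\<integral>x. g0 x \<partial>N) = 0"
    using int by (auto simp: g0_def m_def N.prob_space)
  have eq: "(g0 x)\<^sup>2 = (g x)\<^sup>2 - 2 * m * g x + m\<^sup>2" for x
    by (simp add: g0_def power2_eq_square algebra_simps)
  have intsq: "integrable N (\<lambda>x. (g0 x)\<^sup>2)" unfolding eq using int sq by auto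
  have "(\<integral>x. (g0 x)\<^sup>2 \<partial>N) = (\<integral>x. (g x)\<^sup>2 \<partial>N) - m\<^sup>2"
    unfolding eq using int sq by (simp add: N.prob_space m_def power2_eq_square)
  then have vle: "(\<integral>x. (g0 x)\<^sup>2 \<partial>N) \<le> v" using sq(2) by (smt (verit) zero_le_power2)
  have pair: "integrable ?P (\<lambda>s. g0 (s i) * g0 (s j)) \<and>
      (\<integral>s. g0 (s i) * g0 (s j) \<partial>?P) = (if i = j then (\<integral>x. (g0 x)\<^sup>2 \<partial>N) else 0)" if "i < n" "j < n" for i j
  proof (cases "i = j")
    case True
    have d: "distr ?P N (\<lambda>s. s i) = N" using that N by (intro distr_PiM_component) auto
    have "integrable (distr ?P N (\<lambda>s. s i)) (\<lambda>x. (g0 x)\<^sup>2)" using intsq by (simp add: d)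
    then have "integrable ?P (\<lambda>s. (g0 (s i))\<^sup>2)" using that by (subst (asm) integrable_distr_eq) auto
    moreover have "(\<integral>x. (g0 x)\<^sup>2 \<partial>distr ?P N (\<lambda>s. s i)) = (\<integral>s. (g0 (s i))\<^sup>2 \<partial>?P)"
      using that by (intro integral_distr) auto
    ultimately show ?thesis using True unfolding d power2_eq_square by simp
  next
    case False
    \<comment> \<open>Writes \<open>g0 (s i) * g0 (s j)\<close> as a product over all coordinates, so that the integral factorises.\<close>
    define F where "F = (\<lambda>k x. if k = i \<or> k = j then g0 x else 1)"
    have F: "integrable N (F k)" for k using int0 by (cases "k = i \<or> k = j") (auto simp: F_def)
    have prod: "(\<Prod>k<n. F k (s k)) = g0 (s i) * g0 (s j)" for s
    proof -
      have "(\<Prod>k<n. F k (s k)) = (\<Prod>k\<in>{i, j}. F k (s k))"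
        using that by (intro prod.mono_neutral_right) (auto simp: F_def)
      then show ?thesis using False by (simp add: F_def)
    qed
    have "(\<integral>s. (\<Prod>k<n. F k (s k)) \<partial>?P) = (\<Prod>k<n. \<integral>x. F k x \<partial>N)"
      using F by (intro PS.product_integral_prod) auto
    also have "\<dots> = 0" using that int0 by (intro prod_zero) (auto simp: F_def intro!: bexI[of _ i])
    finally have "(\<integral>s. g0 (s i) * g0 (s j) \<partial>?P) = 0" by (simp add: prod)
    moreover have "integrable ?P (\<lambda>s. \<Prod>k<n. F k (s k))"
      using F by (intro PS.product_integrable_prod) auto
    ultimately show ?thesis using False by (simp add: prod)
  qed
  have single: "integrable ?P (\<lambda>s. g (s i)) \<and> (\<integral>s. g (s i) \<partial>?P) = m" if "i < n" for i
  proof -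
    have d: "distr ?P N (\<lambda>s. s i) = N" using that N by (intro distr_PiM_component) auto
    have "integrable (distr ?P N (\<lambda>s. s i)) g" using int by (simp add: d)
    then have "integrable ?P (\<lambda>s. g (s i))" using that by (subst (asm) integrable_distr_eq) auto
    moreover have "(\<integral>x. g x \<partial>distr ?P N (\<lambda>s. s i)) = (\<integral>s. g (s i) \<partial>?P)"
      using that by (intro integral_distr) auto
    ultimately show ?thesis by (simp add: d m_def)
  qed
  define S where "S = (\<lambda>s. \<Sum>i<n. g (s i))"
  have [measurable]: "S \<in> borel_measurable ?P" unfolding S_def by measurable
  have ES: "PS.expectation S = real n * m"
    unfolding S_def using single by (subst Bochner_Integration.integral_sum) auto
  have sq_eq: "(S s - real n * m)\<^sup>2 = (\<Sum>i<n. \<Sum>j<n. g0 (s i) * g0 (s j))" for s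
  proof -
    have "S s - real n * m = (\<Sum>i<n. g0 (s i))" by (simp add: S_def g0_def sum_subtractf)
    then show ?thesis by (simp add: power2_eq_square sum_product)
  qed
  have int_sq: "integrable ?P (\<lambda>s. (S s - real n * m)\<^sup>2)"
    unfolding sq_eq using pair by (intro Bochner_Integration.integrable_sum) auto
  have intS: "integrable ?P S" unfolding S_def using single by (intro Bochner_Integration.integrable_sum) auto
  have "(S s)\<^sup>2 = (S s - real n * m)\<^sup>2 + 2 * (real n * m) * S s - (real n * m)\<^sup>2" for s
    by (simp add: power2_eq_square algebra_simps)
  then have "integrable ?P (\<lambda>s. (S s)\<^sup>2)"
    using int_sq intS by simp
  then have "PS.prob {s \<in> space ?P. t \<le> \<bar>S s - PS.expectation S\<bar>} \<le> PS.variance S / t\<^sup>2"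
    using t by (intro PS.Chebyshev_inequality) auto
  also have "PS.variance S = (\<Sum>i<n. \<Sum>j<n. if i = j then (\<integral>x. (g0 x)\<^sup>2 \<partial>N) else 0)"
    unfolding ES sq_eq using pair
    by (subst Bochner_Integration.integral_sum) (auto intro!: sum.cong simp: Bochner_Integration.integral_sum)
  also have "\<dots> = real n * (\<integral>x. (g0 x)\<^sup>2 \<partial>N)" by simp
  also have "real n * (\<integral>x. (g0 x)\<^sup>2 \<partial>N) / t\<^sup>2 \<le> real n * v / t\<^sup>2"
    using vle by (intro divide_right_mono mult_left_mono) auto
  finally show ?thesis unfolding ES unfolding S_def m_def .
qed

section \<open>Moments of the regression model\<close>

text \<open>The hypotheses that concern one observation \<open>(X, Y)\<close>, with \<open>B\<close> for the bound on the conditional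
  covariance.\<close>

locale local_regression = prob_space M for M :: "'a measure" +
  fixes X :: "'a \<Rightarrow> real^'d::finite" and Y :: "'a \<Rightarrow> real^'e::finite" and f :: "real^'d \<Rightarrow> real^'e"
    and \<rho> :: "real^'d \<Rightarrow> real" and U :: "(real^'d) set" and lo hi B :: real
  assumes f_continuous: "continuous_on UNIV f"
    and density: "distributed M lborel X (\<lambda>x. ennreal (\<rho> x))"
    and density_bounds: "0 < lo" "0 \<in> U" "\<And>x. x \<in> U \<Longrightarrow> lo \<le> \<rho> x \<and> \<rho> x \<le> hi"
    and Y_integrable: "integrable M Y"
    and cond_mean_Y: "AE \<omega> in M. cond_mean M X Y \<omega> = f (X \<omega>)"
    and noise_square_integrable: "integrable M (\<lambda>\<omega>. (norm (f (X \<omega>) - Y \<omega>))\<^sup>2)"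
    and cond_cov_noise:
      "AE \<omega> in M. onorm ((*v) (cond_cov M X (\<lambda>\<omega>. f (X \<omega>) - Y \<omega>) \<omega>)) \<le> B"
begin

abbreviation Xalg :: "'a measure" where "Xalg \<equiv> vimage_algebra (space M) X borel"

abbreviation noise :: "'a \<Rightarrow> real^'e" where "noise \<equiv> \<lambda>\<omega>. f (X \<omega>) - Y \<omega>"

lemma X_measurable [measurable]: "X \<in> borel_measurable M"
  using distributed_measurable[OF density] by simp

lemma Y_measurable [measurable]: "Y \<in> borel_measurable M"
  using Y_integrable by (rule borel_measurable_integrable)

lemma f_measurable [measurable]: "f \<in> borel_measurable borel"
  using f_continuous by (rule borel_measurable_continuous_onI)

lemma lo_le_hi: "lo \<le> hi"
  using density_bounds(2,3) by fastforce

sublocale X: finite_measure_subalgebra M Xalg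
proof
  show "subalgebra M Xalg"
    unfolding subalgebra_def by (auto simp: sets_vimage_algebra2 intro!: measurable_sets)
qed

text \<open>Functions of \<open>X\<close> are the test functions that can be moved through the conditional expectation.\<close>

lemma Xalg_measurable: 
  assumes [measurable]: "g \<in> borel_measurable borel"
  shows "(\<lambda>\<omega>. g (X \<omega>)) \<in> borel_measurable Xalg"
proof -
  have "X \<in> measurable Xalg borel" by (rule measurable_vimage_algebra1) auto
  then show ?thesis by measurable
qed

lemma integrable_noise_square: "integrable M (\<lambda>\<omega>. (noise \<omega> $ e)\<^sup>2)"
proof (rule Bochner_Integration.integrable_bound[OF noise_square_integrable])
  show "AE \<omega> in M. norm ((noise \<omega> $ e)\<^sup>2) \<le> norm ((norm (noise \<omega>))\<^sup>2)"
    using component_le_norm_cart[of "noise _" e] by (auto intro!: power_mono simp: abs_le_square_iff[symmetric])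
qed measurable

lemma integrable_noise: "integrable M (\<lambda>\<omega>. noise \<omega> $ e)"
  by (rule square_integrable_imp_integrable[OF _ integrable_noise_square]) measurable

lemma integrable_Y_component: "integrable M (\<lambda>\<omega>. Y \<omega> $ e)"
  by (rule integrable_bounded_linear[OF bounded_linear_vec_nth Y_integrable])

lemma integrable_f_component: "integrable M (\<lambda>\<omega>. f (X \<omega>) $ e)"
  using Bochner_Integration.integrable_add[OF integrable_noise integrable_Y_component, of e e] by simp

lemma cond_exp_noise: "AE \<omega> in M. real_cond_exp M Xalg (\<lambda>\<omega>. noise \<omega> $ e) \<omega> = 0"
proof -
  have "AE \<omega> in M. real_cond_exp M Xalg (\<lambda>\<omega>. f (X \<omega>) $ e - Y \<omega> $ e) \<omega> =
      real_cond_exp M Xalg (\<lambda>\<omega>. f (X \<omega>) $ e) \<omega> - real_cond_exp M Xalg (\<lambda>\<omega>. Y \<omega> $ e) \<omega>"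
    by (rule X.real_cond_exp_diff[OF integrable_f_component integrable_Y_component])
  moreover have "AE \<omega> in M. real_cond_exp M Xalg (\<lambda>\<omega>. f (X \<omega>) $ e) \<omega> = f (X \<omega>) $ e"
    using Xalg_measurable[of "\<lambda>x. f x $ e"] integrable_f_component by (intro X.real_cond_exp_F_meas) auto
  moreover have "AE \<omega> in M. real_cond_exp M Xalg (\<lambda>\<omega>. Y \<omega> $ e) \<omega> = f (X \<omega>) $ e"
    using cond_mean_Y by eventually_elim (auto simp: cond_mean_def vec_eq_iff)
  ultimately show ?thesis by eventually_elim simp
qed

text \<open>The conditional mean of the noise vanishes, so the diagonal of its conditional covariance consists of
  conditional second moments, and a diagonal entry of a matrix is at most its operator norm.\<close>

lemma cond_exp_noise_square: "AE \<omega> in M. real_cond_exp M Xalg (\<lambda>\<omega>. (noise \<omega> $ e)\<^sup>2) \<omega> \<le> B"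
proof -
  have mean0: "AE \<omega> in M. cond_mean M X noise \<omega> $ e = 0"
    using cond_exp_noise[of e] by eventually_elim (simp add: cond_mean_def)
  have [measurable]: "(\<lambda>\<omega>. cond_mean M X noise \<omega> $ e) \<in> borel_measurable M"
    unfolding cond_mean_def by simp
  have "AE \<omega> in M. real_cond_exp M Xalg (\<lambda>\<omega>. (noise \<omega> $ e - cond_mean M X noise \<omega> $ e) *
        (noise \<omega> $ e - cond_mean M X noise \<omega> $ e)) \<omega> = real_cond_exp M Xalg (\<lambda>\<omega>. (noise \<omega> $ e)\<^sup>2) \<omega>"
  proof (rule X.real_cond_exp_cong)
    show "AE \<omega> in M. (noise \<omega> $ e - cond_mean M X noise \<omega> $ e) *
        (noise \<omega> $ e - cond_mean M X noise \<omega> $ e) = (noise \<omega> $ e)\<^sup>2"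
      using mean0 by eventually_elim (simp add: power2_eq_square)
  qed measurable
  with cond_cov_noise show ?thesis
  proof eventually_elim
    case (elim \<omega>)
    have "\<bar>cond_cov M X noise \<omega> $ e $ e\<bar> \<le> onorm ((*v) (cond_cov M X noise \<omega>))"
      by (rule matrix_component_le_onorm)
    then show ?case using elim by (simp add: cond_cov_def)
  qed
qed

lemma integrable_bounded_times:
  fixes \<phi> :: "real^'d \<Rightarrow> real" and g :: "'a \<Rightarrow> real"
  assumes [measurable]: "\<phi> \<in> borel_measurable borel" and bd: "\<And>x. \<bar>\<phi> x\<bar> \<le> 1"
    and g: "integrable M g"
  shows "integrable M (\<lambda>\<omega>. \<phi> (X \<omega>) * g \<omega>)"
proof (rule Bochner_Integration.integrable_bound[OF g])
  show "AE \<omega> in M. norm (\<phi> (X \<omega>) * g \<omega>) \<le> norm (g \<omega>)"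
    using bd by (auto simp: abs_mult intro!: mult_left_le_one_le)
qed (use g in measurable)

lemma noise_orthogonal:
  fixes \<phi> :: "real^'d \<Rightarrow> real"
  assumes [measurable]: "\<phi> \<in> borel_measurable borel" and bd: "\<And>x. \<bar>\<phi> x\<bar> \<le> 1"
  shows "(\<integral>\<omega>. \<phi> (X \<omega>) * noise \<omega> $ e \<partial>M) = 0"
proof -
  have "(\<integral>\<omega>. \<phi> (X \<omega>) * noise \<omega> $ e \<partial>M) = (\<integral>\<omega>. \<phi> (X \<omega>) * real_cond_exp M Xalg (\<lambda>\<omega>. noise \<omega> $ e) \<omega> \<partial>M)"
    by (rule X.real_cond_exp_intg(2)[symmetric])
       (use integrable_bounded_times[OF assms integrable_noise] Xalg_measurable[OF assms(1)] in auto)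
  also have "\<dots> = (\<integral>\<omega>. 0 \<partial>M)"
    using cond_exp_noise[of e] Xalg_measurable[OF assms(1)]
    by (intro integral_cong_AE) (auto elim!: eventually_mono)
  finally show ?thesis by simp
qed

lemma noise_second_moment:
  fixes \<phi> :: "real^'d \<Rightarrow> real"
  assumes [measurable]: "\<phi> \<in> borel_measurable borel" and bd: "\<And>x. \<bar>\<phi> x\<bar> \<le> 1"
  shows "integrable M (\<lambda>\<omega>. (\<phi> (X \<omega>) * noise \<omega> $ e)\<^sup>2)"
    "(\<integral>\<omega>. (\<phi> (X \<omega>) * noise \<omega> $ e)\<^sup>2 \<partial>M) \<le> B * (\<integral>\<omega>. (\<phi> (X \<omega>))\<^sup>2 \<partial>M)"
proof -
  have sq: "\<bar>(\<phi> x)\<^sup>2\<bar> \<le> 1" for x using bd[of x] by (simp add: abs_square_le_1)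
  have int: "integrable M (\<lambda>\<omega>. (\<phi> (X \<omega>))\<^sup>2 * (noise \<omega> $ e)\<^sup>2)"
    by (rule integrable_bounded_times[OF _ sq integrable_noise_square]) measurable
  then show "integrable M (\<lambda>\<omega>. (\<phi> (X \<omega>) * noise \<omega> $ e)\<^sup>2)" by (simp add: power_mult_distrib)
  have Xm: "(\<lambda>\<omega>. (\<phi> (X \<omega>))\<^sup>2) \<in> borel_measurable Xalg"
    by (rule Xalg_measurable[of "\<lambda>x. (\<phi> x)\<^sup>2"]) measurable
  have int2: "integrable M (\<lambda>\<omega>. (\<phi> (X \<omega>))\<^sup>2)"
    using integrable_bounded_times[of "\<lambda>x. (\<phi> x)\<^sup>2" "\<lambda>_. 1"] sq by simp
  have "(\<integral>\<omega>. (\<phi> (X \<omega>) * noise \<omega> $ e)\<^sup>2 \<partial>M) =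
      (\<integral>\<omega>. (\<phi> (X \<omega>))\<^sup>2 * real_cond_exp M Xalg (\<lambda>\<omega>. (noise \<omega> $ e)\<^sup>2) \<omega> \<partial>M)"
    using int Xm by (subst X.real_cond_exp_intg(2)) (auto simp: power_mult_distrib)
  also have "\<dots> \<le> (\<integral>\<omega>. (\<phi> (X \<omega>))\<^sup>2 * B \<partial>M)"
  proof (rule integral_mono_AE)
    show "integrable M (\<lambda>\<omega>. (\<phi> (X \<omega>))\<^sup>2 * real_cond_exp M Xalg (\<lambda>\<omega>. (noise \<omega> $ e)\<^sup>2) \<omega>)"
      using int Xm by (intro X.real_cond_exp_intg(1)) auto
    show "AE \<omega> in M. (\<phi> (X \<omega>))\<^sup>2 * real_cond_exp M Xalg (\<lambda>\<omega>. (noise \<omega> $ e)\<^sup>2) \<omega> \<le> (\<phi> (X \<omega>))\<^sup>2 * B"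
      using cond_exp_noise_square[of e] by eventually_elim (simp add: mult_left_mono)
  qed (use int2 in auto)
  finally show "(\<integral>\<omega>. (\<phi> (X \<omega>) * noise \<omega> $ e)\<^sup>2 \<partial>M) \<le> B * (\<integral>\<omega>. (\<phi> (X \<omega>))\<^sup>2 \<partial>M)"
    by (simp add: mult.commute)
qed

text \<open>The density may take arbitrary, even negative, values outside \<open>U\<close> as a real function; integrals of
  functions that live in \<open>U\<close> only see its values there.\<close>

lemma expectation_density_bounds:
  fixes g :: "real^'d \<Rightarrow> real"
  assumes g: "integrable lborel g" "\<And>x. 0 \<le> g x" "\<And>x. x \<notin> U \<Longrightarrow> g x = 0"
  shows "lo * (\<integral>x. g x \<partial>lborel) \<le> (\<integral>\<omega>. g (X \<omega>) \<partial>M)" "(\<integral>\<omega>. g (X \<omega>) \<partial>M) \<le> hi * (\<integral>x. g x \<partial>lborel)"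
proof -
  \<comment> \<open>The positive part of \<open>\<rho>\<close>: it represents the same density and is nonnegative and measurable.\<close>
  define \<rho>' where "\<rho>' = (\<lambda>x. enn2real (ennreal (\<rho> x)))"
  have [measurable]: "g \<in> borel_measurable borel" using g(1) by auto
  have d: "distributed M lborel X (\<lambda>x. ennreal (\<rho>' x))" using density by (simp add: \<rho>'_def)
  have [measurable]: "\<rho>' \<in> borel_measurable borel"
    using distributed_real_measurable[OF _ d] by (simp add: \<rho>'_def)
  have eq: "(\<integral>x. \<rho>' x * g x \<partial>lborel) = (\<integral>\<omega>. g (X \<omega>) \<partial>M)"
    by (rule distributed_integral[OF d]) (auto simp: \<rho>'_def)
  have bd: "lo * g x \<le> \<rho>' x * g x \<and> \<rho>' x * g x \<le> hi * g x" for x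
  proof (cases "x \<in> U")
    case True
    then have "\<rho>' x = \<rho> x" using density_bounds(1) density_bounds(3)[of x] by (simp add: \<rho>'_def)
    then show ?thesis using density_bounds(3)[OF True] g(2)[of x] by (auto intro!: mult_right_mono)
  qed (use g(3) in auto)
  have int: "integrable lborel (\<lambda>x. \<rho>' x * g x)"
  proof (rule Bochner_Integration.integrable_bound)
    show "integrable lborel (\<lambda>x. hi * g x)" using g(1) by simp
    show "AE x in lborel. norm (\<rho>' x * g x) \<le> norm (hi * g x)"
    proof (intro AE_I2)
      fix x
      have "0 \<le> \<rho>' x * g x" using g(2)[of x] by (simp add: \<rho>'_def)
      then show "norm (\<rho>' x * g x) \<le> norm (hi * g x)" using bd[of x] by simp
    qed
  qed measurable
  show "lo * (\<integral>x. g x \<partial>lborel) \<le> (\<integral>\<omega>. g (X \<omega>) \<partial>M)"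
    unfolding eq[symmetric] integral_mult_right_zero[symmetric]
    using bd g(1) int by (intro integral_mono) auto
  show "(\<integral>\<omega>. g (X \<omega>) \<partial>M) \<le> hi * (\<integral>x. g x \<partial>lborel)"
    unfolding eq[symmetric] integral_mult_right_zero[symmetric]
    using bd g(1) int by (intro integral_mono) auto
qed

text \<open>The probability of the window is at most the supremum of the density times its volume.\<close>

lemma window_second_moment:
  fixes \<phi> :: "real^'d \<Rightarrow> real"
  assumes [measurable]: "\<phi> \<in> borel_measurable borel"
    and bd: "\<And>x. \<bar>\<phi> x\<bar> \<le> indicator (cball 0 h) x" and h: "0 \<le> h" "cball 0 h \<subseteq> U"
  shows "(\<integral>\<omega>. (\<phi> (X \<omega>))\<^sup>2 \<partial>M) \<le> hi * unit_ball_vol (real CARD('d)) * h ^ CARD('d)"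
proof -
  have int: "integrable lborel (indicator (cball (0::real^'d) h) :: _ \<Rightarrow> real)"
    by (rule integrable_real_indicator) (auto simp: emeasure_cball h)
  have le: "(\<phi> x)\<^sup>2 \<le> indicator (cball 0 h) x" for x
    using bd[of x] by (cases "x \<in> cball 0 h") (auto simp: abs_square_le_1)
  have int2: "integrable lborel (\<lambda>x. (\<phi> x)\<^sup>2)"
    by (rule Bochner_Integration.integrable_bound[OF int]) (use le in auto)
  have "(\<integral>\<omega>. (\<phi> (X \<omega>))\<^sup>2 \<partial>M) \<le> hi * (\<integral>x. (\<phi> x)\<^sup>2 \<partial>lborel)"
  proof (rule expectation_density_bounds(2)[OF int2])
    fix x assume "x \<notin> U"
    then have "x \<notin> cball 0 h" using h by blast
    then show "(\<phi> x)\<^sup>2 = 0" using bd[of x] by simp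
  qed auto
  also have "\<dots> \<le> hi * (\<integral>x. indicator (cball (0::real^'d) h) x \<partial>lborel)"
    using le int int2 lo_le_hi density_bounds(1) by (intro mult_left_mono integral_mono) auto
  also have "\<dots> = hi * unit_ball_vol (real CARD('d)) * h ^ CARD('d)"
    using content_cball[of h "0 :: real^'d"] h by simp
  finally show ?thesis .
qed

text \<open>The substitution \<open>x = h u\<close> reduces the window to the unit ball, where \<open>c\<close> is the coercivity constant
  of the monomials.\<close>

lemma window_Gram_lower_bound:
  assumes h: "0 < h" "cball 0 h \<subseteq> U"
    and c: "\<And>\<gamma> :: ('d \<Rightarrow> nat) \<Rightarrow> real. c * (\<Sum>\<alpha> | mdeg \<alpha> < k. (\<gamma> \<alpha>)\<^sup>2) \<le>
     (\<integral>x. indicator (cball 0 1) x * (\<Sum>\<alpha> | mdeg \<alpha> < k. \<gamma> \<alpha> * monomial \<alpha> x)\<^sup>2 \<partial>lborel)"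
  shows "lo * c * h ^ CARD('d) * (\<Sum>\<alpha> | mdeg \<alpha> < k. (\<gamma> \<alpha>)\<^sup>2) \<le>
     (\<integral>\<omega>. (\<Sum>\<alpha> | mdeg \<alpha> < k. \<gamma> \<alpha> * window_monomial h \<alpha> (X \<omega>))\<^sup>2 \<partial>M)"
proof -
  define g where "g = (\<lambda>x. (\<Sum>\<alpha> | mdeg \<alpha> < k. \<gamma> \<alpha> * window_monomial h \<alpha> (x::real^'d))\<^sup>2)"
  define p where "p = (\<lambda>x. indicator (cball 0 1) x * (\<Sum>\<alpha> | mdeg \<alpha> < k. \<gamma> \<alpha> * monomial \<alpha> (x::real^'d))\<^sup>2)"
  have g_eq: "g x = indicator (cball 0 h) x * (\<Sum>\<alpha> | mdeg \<alpha> < k. \<gamma> \<alpha> * monomial \<alpha> ((1 / h) *\<^sub>R x))\<^sup>2" for x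
    unfolding g_def window_monomial_def by (cases "x \<in> cball 0 h") auto
  have gp: "g (0 + h *\<^sub>R x) = p x" for x
    unfolding g_eq p_def using h(1) by (auto simp: indicator_def)
  have [measurable]: "g \<in> borel_measurable borel" unfolding g_def by measurable
  have "integrable lborel g"
  proof -
    have "continuous_on (cball 0 h) (\<lambda>x::real^'d. (\<Sum>\<alpha> | mdeg \<alpha> < k. \<gamma> \<alpha> * monomial \<alpha> ((1 / h) *\<^sub>R x))\<^sup>2)"
      by (intro continuous_intros continuous_on_compose2[OF continuous_on_monomial[of UNIV]]) auto
    from borel_integrable_compact[OF compact_cball this] show ?thesis
      unfolding real_scaleR_def g_eq .
  qed
  have "h ^ CARD('d) * (c * (\<Sum>\<alpha> | mdeg \<alpha> < k. (\<gamma> \<alpha>)\<^sup>2)) \<le> h ^ CARD('d) * (\<integral>x. p x \<partial>lborel)"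
    using c[of \<gamma>] h unfolding p_def by (intro mult_left_mono) auto
  also have "\<dots> = (\<integral>x. g x \<partial>lborel)"
  proof -
    have "(\<integral>x. g x \<partial>lborel) = (\<integral>x. g x \<partial>density (distr lborel borel (\<lambda>x. 0 + h *\<^sub>R x)) (\<lambda>_. \<bar>h\<bar> ^ DIM(real^'d)))"
      using lborel_affine[of h "0 :: real^'d"] h by simp
    also have "\<dots> = (\<integral>x. \<bar>h\<bar> ^ DIM(real^'d) * g (0 + h *\<^sub>R x) \<partial>lborel)"
      using h by (subst integral_real_density) (auto simp: integral_distr)
    also have "\<dots> = h ^ CARD('d) * (\<integral>x. p x \<partial>lborel)" unfolding gp using h by simp
    finally show ?thesis by simp
  qed
  finally have "lo * (h ^ CARD('d) * (c * (\<Sum>\<alpha> | mdeg \<alpha> < k. (\<gamma> \<alpha>)\<^sup>2))) \<le> lo * (\<integral>x. g x \<partial>lborel)"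
    using density_bounds(1) by (intro mult_left_mono) auto
  also have "\<dots> \<le> (\<integral>\<omega>. g (X \<omega>) \<partial>M)"
  proof (rule expectation_density_bounds(1)[OF \<open>integrable lborel g\<close>])
    fix x assume "x \<notin> U" then show "g x = 0" unfolding g_eq using h by (auto simp: indicator_def)
  qed (auto simp: g_def)
  finally show ?thesis unfolding g_def by (simp add: mult_ac)
qed

end

section \<open>Concentration of the window statistics\<close>

text \<open>The event on which the least squares problem is well behaved, in units of the expected window count
  \<open>n h\<^sup>d\<close>: curvature at least \<open>\<kappa>\<close>, at most \<open>N\<close> points, and noise of the size \<open>\<tau>\<close> of a standard
  deviation.\<close>

definition regular_window :: "nat \<Rightarrow> real \<Rightarrow> nat \<Rightarrow> (real^'d::finite \<Rightarrow> real^'e::finite) \<Rightarrow>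
    real \<Rightarrow> real \<Rightarrow> real \<Rightarrow> ('d, 'e) sample \<Rightarrow> bool" where
  "regular_window k h n f \<kappa> N \<tau> s \<longleftrightarrow>
     (\<forall>\<gamma> :: ('d \<Rightarrow> nat) \<Rightarrow> real. \<kappa> * (real n * h ^ CARD('d)) * (\<Sum>\<alpha> | mdeg \<alpha> < k. (\<gamma> \<alpha>)\<^sup>2) \<le>
        (\<Sum>i<n. (\<Sum>\<alpha> | mdeg \<alpha> < k. \<gamma> \<alpha> * window_monomial h \<alpha> (fst (s i)))\<^sup>2)) \<and>
     real (card (window h n s)) \<le> N * (real n * h ^ CARD('d)) \<and>
     (\<forall>\<alpha> e. mdeg \<alpha> < k \<longrightarrow>
        \<bar>\<Sum>i<n. (f (fst (s i)) - snd (s i)) $ e * window_monomial h \<alpha> (fst (s i))\<bar>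
          \<le> \<tau> * sqrt (real n * h ^ CARD('d)))"

context local_regression
begin

abbreviation law :: "((real^'d) \<times> (real^'e)) measure" where
  "law \<equiv> distr M borel (\<lambda>\<omega>. (X \<omega>, Y \<omega>))"

lemma prob_space_law: "prob_space law"
  by (rule prob_space_distr) measurable

text \<open>\<open>B\<close> dominates a second moment of the noise.\<close>

lemma noise_bound_nonneg: "0 \<le> B"
proof -
  have "0 \<le> (\<integral>\<omega>. (1 * noise \<omega> $ undefined)\<^sup>2 \<partial>M)" by (intro integral_nonneg_AE) auto
  also have "\<dots> \<le> B * (\<integral>\<omega>. 1\<^sup>2 \<partial>M)" by (rule noise_second_moment(2)[of "\<lambda>_. 1"]) auto
  finally show ?thesis by (simp add: prob_space)
qed

lemma Chebyshev_sample:
  fixes g :: "(real^'d) \<times> (real^'e) \<Rightarrow> real"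
  assumes [measurable]: "g \<in> borel_measurable borel"
    and "integrable M (\<lambda>\<omega>. (g (X \<omega>, Y \<omega>))\<^sup>2)" "(\<integral>\<omega>. (g (X \<omega>, Y \<omega>))\<^sup>2 \<partial>M) \<le> v" "t > 0"
  shows "measure (iid_law M X Y n)
     {s \<in> space (iid_law M X Y n). t \<le> \<bar>(\<Sum>i<n. g (s i)) - real n * (\<integral>\<omega>. g (X \<omega>, Y \<omega>) \<partial>M)\<bar>} \<le> real n * v / t\<^sup>2"
proof -
  have "integrable law (\<lambda>x. (g x)\<^sup>2)" using assms(2) by (subst integrable_distr_eq) auto
  moreover have "(\<integral>x. (g x)\<^sup>2 \<partial>law) \<le> v" using assms(3) by (subst integral_distr) auto
  moreover have "(\<integral>x. g x \<partial>law) = (\<integral>\<omega>. g (X \<omega>, Y \<omega>) \<partial>M)" by (subst integral_distr) auto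
  ultimately show ?thesis
    using Chebyshev_iid_sum[OF prob_space_law, of g v t n] assms(4) unfolding iid_law_def by simp
qed

text \<open>The Gram entries and the point count are sums of bounded variables supported in the window: their
  standard deviation \<open>(n h\<^sup>d)\<^bsup>1/2\<^esup>\<close> is negligible against \<open>n h\<^sup>d\<close>, and that is what the threshold \<open>H\<^sub>0\<close> is
  for.  The noise sums are only known to be of the size of their standard deviation, so there the failure
  probability is made small by the choice of \<open>\<tau>\<close>.  The constants depend neither on \<open>n\<close> nor on \<open>h\<close>.\<close>

lemma window_moments_concentrate:
  assumes "0 < k" "0 < \<epsilon>"
  obtains \<kappa> N \<tau> H\<^sub>0 where "0 < \<kappa>" "0 \<le> N" "0 \<le> \<tau>"
    "\<And>n h. 0 < h \<Longrightarrow> cball 0 h \<subseteq> U \<Longrightarrow> H\<^sub>0 \<le> real n * h ^ CARD('d) \<Longrightarrow>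
      \<exists>G\<in>sets (iid_law M X Y n). measure (iid_law M X Y n) G \<ge> 1 - \<epsilon> \<and>
        (\<forall>s\<in>G. regular_window k h n f \<kappa> N \<tau> s)"
proof -
  define A where "A = {\<alpha> :: 'd \<Rightarrow> nat. mdeg \<alpha> < k}"
  have finA: "finite A" by (simp add: A_def)
  have A0: "(\<lambda>_. 0) \<in> A" using assms(1) by (simp add: A_def)
  define a where "a = real (card A)"
  have a: "a > 0" using finA A0 by (auto simp: a_def card_gt_0_iff)
  obtain c where c: "c > 0" "\<And>\<gamma> :: ('d \<Rightarrow> nat) \<Rightarrow> real. c * (\<Sum>\<alpha> | mdeg \<alpha> < k. (\<gamma> \<alpha>)\<^sup>2) \<le>
     (\<integral>x. indicator (cball 0 1) x * (\<Sum>\<alpha> | mdeg \<alpha> < k. \<gamma> \<alpha> * monomial \<alpha> x)\<^sup>2 \<partial>lborel)"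
    using monomials_L2_lower_bound by blast
  define V where "V = hi * unit_ball_vol (real CARD('d))"
  have V: "V \<ge> 0" using lo_le_hi density_bounds(1) by (simp add: V_def)
  \<comment> \<open>Deviations of the Gram entries by \<open>\<delta> n h\<^sup>d\<close> change the quadratic form by at most
    \<open>\<delta> n h\<^sup>d (\<Sum>\<bar>\<gamma> \<alpha>\<bar>)\<^sup>2 \<le> \<delta> a n h\<^sup>d (\<Sum>(\<gamma> \<alpha>)\<^sup>2)\<close>, which is half of its mean.\<close>
  define \<delta> where "\<delta> = lo * c / (2 * a)"
  have \<delta>: "\<delta> > 0" using c a density_bounds(1) by (simp add: \<delta>_def)
  define D where "D = real CARD('e)"
  have D: "D > 0" by (simp add: D_def)
  \<comment> \<open>Chosen so that the \<open>a D\<close> noise sums together fail with probability at most \<open>\<epsilon> / 2\<close>.\<close>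
  define \<tau> where "\<tau> = sqrt (2 * a * D * (B * V + 1) / \<epsilon>)"
  have BV: "B * V \<ge> 0" using noise_bound_nonneg V by simp
  have \<tau>2: "\<tau>\<^sup>2 = 2 * a * D * (B * V + 1) / \<epsilon>"
    unfolding \<tau>_def using a D BV assms(2) by (intro real_sqrt_pow2 divide_nonneg_nonneg mult_nonneg_nonneg) auto
  have \<tau>: "\<tau> > 0" unfolding \<tau>_def using a D BV assms(2) by (intro real_sqrt_gt_zero divide_pos_pos mult_pos_pos) auto
  \<comment> \<open>Chosen so that the \<open>a\<^sup>2\<close> Gram entries together fail with probability at most \<open>\<epsilon> / 2\<close>.\<close>
  define H0 where "H0 = 2 * a\<^sup>2 * V / (\<delta>\<^sup>2 * \<epsilon>) + 1"
  have H0: "H0 \<ge> 1" using V assms(2) by (simp add: H0_def)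
  show ?thesis
  proof (rule that[of "lo * c / 2" "V + \<delta>" \<tau> H0])
    show "0 < lo * c / 2" "0 \<le> V + \<delta>" "0 \<le> \<tau>" using c density_bounds(1) V \<delta> \<tau> by auto
    fix n :: nat and h :: real assume h: "0 < h" "cball 0 h \<subseteq> U" and H0H: "H0 \<le> real n * h ^ CARD('d)"
    define H where "H = real n * h ^ CARD('d)"
    have H: "H > 0" "H0 \<le> H" using H0 H0H by (auto simp: H_def)
    define P where "P = iid_law M X Y n"
    interpret P: prob_space P unfolding P_def by (rule prob_space_iid_law) (auto intro: prob_space_axioms)
    define w :: "('d \<Rightarrow> nat) \<Rightarrow> real^'d \<Rightarrow> real" where "w = window_monomial h"
    have w_abs: "\<bar>w \<alpha> x\<bar> \<le> indicator (cball 0 h) x" for \<alpha> :: "'d \<Rightarrow> nat" and x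
      unfolding w_def by (rule abs_window_monomial_le) (rule h)
    have w_1: "\<bar>w \<alpha> x\<bar> \<le> 1" for \<alpha> :: "'d \<Rightarrow> nat" and x
      using w_abs[of \<alpha> x] order_trans indicator_le_1 by blast
    have ww_abs: "\<bar>w \<alpha> x * w \<beta> x\<bar> \<le> indicator (cball 0 h) x" for \<alpha> \<beta> :: "'d \<Rightarrow> nat" and x
    proof -
      have "\<bar>w \<alpha> x * w \<beta> x\<bar> \<le> indicator (cball 0 h) x * 1"
        unfolding abs_mult using w_abs[of \<alpha> x] w_1[of \<beta> x] by (intro mult_mono) auto
      then show ?thesis by simp
    qed
    have ww_1: "\<bar>w \<alpha> x * w \<beta> x\<bar> \<le> 1" for \<alpha> \<beta> :: "'d \<Rightarrow> nat" and x
      using w_1[of \<alpha> x] w_1[of \<beta> x] by (simp add: abs_mult mult_le_one)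
    have [measurable]: "w \<alpha> \<in> borel_measurable borel" for \<alpha> :: "'d \<Rightarrow> nat"
      unfolding w_def by measurable
    define g1 where "g1 = (\<lambda>\<alpha> \<beta> (z :: (real^'d) \<times> (real^'e)). w \<alpha> (fst z) * w \<beta> (fst z))"
    define g2 where "g2 = (\<lambda>\<alpha> e z. w \<alpha> (fst z) * (f (fst z) - snd z) $ e)"
    have [measurable]: "g1 \<alpha> \<beta> \<in> borel_measurable borel" for \<alpha> \<beta>
      unfolding g1_def borel_prod[symmetric] by measurable
    have [measurable]: "g2 \<alpha> e \<in> borel_measurable borel" for \<alpha> e
      unfolding g2_def borel_prod[symmetric]
      by (intro borel_measurable_times borel_measurable_vec_component borel_measurable_diff) measurable
    define m1 where "m1 = (\<lambda>\<alpha> \<beta>. \<integral>\<omega>. w \<alpha> (X \<omega>) * w \<beta> (X \<omega>) \<partial>M)"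
    define Bad1 where "Bad1 = (\<lambda>\<alpha> \<beta>. {s \<in> space P. \<delta> * H \<le> \<bar>(\<Sum>i<n. g1 \<alpha> \<beta> (s i)) - real n * m1 \<alpha> \<beta>\<bar>})"
    define Bad2 where "Bad2 = (\<lambda>\<alpha> e. {s \<in> space P. \<tau> * sqrt H \<le> \<bar>\<Sum>i<n. g2 \<alpha> e (s i)\<bar>})"
    have comp: "(\<lambda>s. s i) \<in> measurable P borel" if "i < n" for i
      using measurable_component_singleton[of i "{..<n}" "\<lambda>_. law"] that
      unfolding P_def iid_law_def by simp
    have [measurable]: "Bad1 \<alpha> \<beta> \<in> sets P" for \<alpha> \<beta>
    proof -
      have [measurable]: "(\<lambda>s. \<Sum>i<n. g1 \<alpha> \<beta> (s i)) \<in> borel_measurable P"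
        by (intro borel_measurable_sum measurable_compose[OF comp]) auto
      show ?thesis unfolding Bad1_def by measurable
    qed
    have [measurable]: "Bad2 \<alpha> e \<in> sets P" for \<alpha> e
    proof -
      have [measurable]: "(\<lambda>s. \<Sum>i<n. g2 \<alpha> e (s i)) \<in> borel_measurable P"
        by (intro borel_measurable_sum measurable_compose[OF comp]) auto
      show ?thesis unfolding Bad2_def by measurable
    qed
    have ww_int: "integrable M (\<lambda>\<omega>. (w \<alpha> (X \<omega>) * w \<beta> (X \<omega>))\<^sup>2)" for \<alpha> \<beta>
    proof -
      have "\<bar>(w \<alpha> x * w \<beta> x)\<^sup>2\<bar> \<le> 1" for x using ww_1[of \<alpha> x \<beta>] by (simp add: abs_square_le_1)
      then show ?thesis
        using integrable_bounded_times[of "\<lambda>x. (w \<alpha> x * w \<beta> x)\<^sup>2" "\<lambda>_. 1"] by simp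
    qed
    have second: "(\<integral>\<omega>. (w \<alpha> (X \<omega>) * w \<beta> (X \<omega>))\<^sup>2 \<partial>M) \<le> V * h ^ CARD('d)" for \<alpha> \<beta>
      unfolding V_def using h ww_abs by (intro window_second_moment) auto
    have second': "(\<integral>\<omega>. (w \<alpha> (X \<omega>))\<^sup>2 \<partial>M) \<le> V * h ^ CARD('d)" for \<alpha>
      unfolding V_def using h w_abs by (intro window_second_moment) auto
    have bad1: "P.prob (Bad1 \<alpha> \<beta>) \<le> V / (\<delta>\<^sup>2 * H)" for \<alpha> \<beta>
    proof -
      have g1_eq: "g1 \<alpha> \<beta> (X \<omega>, Y \<omega>) = w \<alpha> (X \<omega>) * w \<beta> (X \<omega>)" for \<omega> by (simp add: g1_def)
      have "P.prob (Bad1 \<alpha> \<beta>) \<le> real n * (V * h ^ CARD('d)) / (\<delta> * H)\<^sup>2"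
        using Chebyshev_sample[of "g1 \<alpha> \<beta>" "V * h ^ CARD('d)" "\<delta> * H" n] ww_int[of \<alpha> \<beta>] second[of \<alpha> \<beta>] \<delta> H
        unfolding Bad1_def P_def m1_def g1_eq by simp
      also have "real n * (V * h ^ CARD('d)) = V * H" by (simp add: H_def)
      also have "V * H / (\<delta> * H)\<^sup>2 = V / (\<delta>\<^sup>2 * H)" using H by (simp add: power2_eq_square)
      finally show ?thesis .
    qed
    have bad2: "P.prob (Bad2 \<alpha> e) \<le> B * V / \<tau>\<^sup>2" for \<alpha> e
    proof -
      have g2_eq: "g2 \<alpha> e (X \<omega>, Y \<omega>) = w \<alpha> (X \<omega>) * noise \<omega> $ e" for \<omega> by (simp add: g2_def)
      have "(\<integral>\<omega>. (w \<alpha> (X \<omega>) * noise \<omega> $ e)\<^sup>2 \<partial>M) \<le> B * (\<integral>\<omega>. (w \<alpha> (X \<omega>))\<^sup>2 \<partial>M)"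
        using w_1 by (intro noise_second_moment(2)) auto
      also have "\<dots> \<le> B * (V * h ^ CARD('d))" using second' noise_bound_nonneg by (rule mult_left_mono)
      finally have le: "(\<integral>\<omega>. (g2 \<alpha> e (X \<omega>, Y \<omega>))\<^sup>2 \<partial>M) \<le> B * (V * h ^ CARD('d))" unfolding g2_eq .
      have int: "integrable M (\<lambda>\<omega>. (g2 \<alpha> e (X \<omega>, Y \<omega>))\<^sup>2)"
        unfolding g2_eq using w_1 by (intro noise_second_moment(1)) auto
      have zero: "(\<integral>\<omega>. g2 \<alpha> e (X \<omega>, Y \<omega>) \<partial>M) = 0"
        unfolding g2_eq using w_1 by (intro noise_orthogonal) auto
      have "P.prob (Bad2 \<alpha> e) \<le> real n * (B * (V * h ^ CARD('d))) / (\<tau> * sqrt H)\<^sup>2"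
        using Chebyshev_sample[of "g2 \<alpha> e", OF _ int le, of "\<tau> * sqrt H" n] \<tau> H
        unfolding Bad2_def P_def zero by simp
      also have "real n * (B * (V * h ^ CARD('d))) = B * V * H" by (simp add: H_def)
      also have "B * V * H / (\<tau> * sqrt H)\<^sup>2 = B * V / \<tau>\<^sup>2" using H by (simp add: power_mult_distrib)
      finally show ?thesis .
    qed
    define Bad where "Bad = (\<Union>(\<alpha>, \<beta>)\<in>A \<times> A. Bad1 \<alpha> \<beta>) \<union> (\<Union>(\<alpha>, e)\<in>A \<times> UNIV. Bad2 \<alpha> e)"
    have Bad_sets: "(\<Union>(\<alpha>, \<beta>)\<in>A \<times> A. Bad1 \<alpha> \<beta>) \<in> sets P" "(\<Union>(\<alpha>, e)\<in>A \<times> UNIV. Bad2 \<alpha> e) \<in> sets P"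
      using finA by (auto intro!: sets.finite_UN)
    have "P.prob Bad \<le> P.prob (\<Union>(\<alpha>, \<beta>)\<in>A \<times> A. Bad1 \<alpha> \<beta>) + P.prob (\<Union>(\<alpha>, e)\<in>A \<times> UNIV. Bad2 \<alpha> e)"
      unfolding Bad_def using Bad_sets by (rule measure_Un_le)
    also have "P.prob (\<Union>(\<alpha>, \<beta>)\<in>A \<times> A. Bad1 \<alpha> \<beta>) \<le> (\<Sum>(\<alpha>, \<beta>)\<in>A \<times> A. V / (\<delta>\<^sup>2 * H))"
    proof -
      have "P.prob (\<Union>(\<alpha>, \<beta>)\<in>A \<times> A. Bad1 \<alpha> \<beta>) \<le> (\<Sum>(\<alpha>, \<beta>)\<in>A \<times> A. P.prob (Bad1 \<alpha> \<beta>))"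
        using measure_UNION_le[of "A \<times> A" "\<lambda>(\<alpha>, \<beta>). Bad1 \<alpha> \<beta>" P] finA by (auto simp: case_prod_unfold)
      also have "\<dots> \<le> (\<Sum>(\<alpha>, \<beta>)\<in>A \<times> A. V / (\<delta>\<^sup>2 * H))" using bad1 by (intro sum_mono) auto
      finally show ?thesis .
    qed
    also have "P.prob (\<Union>(\<alpha>, e)\<in>A \<times> UNIV. Bad2 \<alpha> e) \<le> (\<Sum>(\<alpha>, e)\<in>A \<times> (UNIV :: 'e set). B * V / \<tau>\<^sup>2)"
    proof -
      have "P.prob (\<Union>(\<alpha>, e)\<in>A \<times> UNIV. Bad2 \<alpha> e) \<le> (\<Sum>(\<alpha>, e)\<in>A \<times> UNIV. P.prob (Bad2 \<alpha> e))"
        using measure_UNION_le[of "A \<times> (UNIV :: 'e set)" "\<lambda>(\<alpha>, e). Bad2 \<alpha> e" P] finA by (auto simp: case_prod_unfold)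
      also have "\<dots> \<le> (\<Sum>(\<alpha>, e)\<in>A \<times> (UNIV :: 'e set). B * V / \<tau>\<^sup>2)" using bad2 by (intro sum_mono) auto
      finally show ?thesis .
    qed
    also have "(\<Sum>(\<alpha>, \<beta>)\<in>A \<times> A. V / (\<delta>\<^sup>2 * H)) = a\<^sup>2 * V / (\<delta>\<^sup>2 * H)"
      by (simp add: a_def power2_eq_square case_prod_unfold card_cartesian_product)
    also have "(\<Sum>(\<alpha>, e)\<in>A \<times> (UNIV :: 'e set). B * V / \<tau>\<^sup>2) = a * D * (B * V) / \<tau>\<^sup>2"
      by (simp add: a_def D_def case_prod_unfold card_cartesian_product)
    also have "a\<^sup>2 * V / (\<delta>\<^sup>2 * H) \<le> \<epsilon> / 2"
    proof -
      have "2 * a\<^sup>2 * V / (\<delta>\<^sup>2 * \<epsilon>) \<le> H" using H by (simp add: H0_def)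
      then show ?thesis using \<delta> assms(2) H by (simp add: field_simps)
    qed
    also have "a * D * (B * V) / \<tau>\<^sup>2 \<le> \<epsilon> / 2"
    proof -
      have "a * D * (B * V) / \<tau>\<^sup>2 \<le> a * D * (B * V + 1) / \<tau>\<^sup>2"
        using a D \<tau> by (intro divide_right_mono mult_left_mono) auto
      also have "\<dots> = \<epsilon> / 2"
      proof -
        define x where "x = a * D * (B * V + 1)"
        have "x > 0" unfolding x_def using a D BV by (intro mult_pos_pos) auto
        moreover have "\<tau>\<^sup>2 = 2 * x / \<epsilon>" by (simp add: \<tau>2 x_def mult.assoc)
        ultimately show ?thesis using assms(2) by (simp add: x_def[symmetric])
      qed
      finally show ?thesis .
    qed
    finally have Bad_prob: "P.prob Bad \<le> \<epsilon>" by simp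
    have Bad_in: "Bad \<in> sets P" unfolding Bad_def using Bad_sets by blast
    show "\<exists>G\<in>sets (iid_law M X Y n). measure (iid_law M X Y n) G \<ge> 1 - \<epsilon> \<and>
        (\<forall>s\<in>G. regular_window k h n f (lo * c / 2) (V + \<delta>) \<tau> s)"
      unfolding regular_window_def H_def[symmetric] P_def[symmetric] w_def[symmetric] A_def[symmetric]
    proof (rule bexI[of _ "space P - Bad"], intro conjI ballI allI impI)
      show "space P - Bad \<in> sets P" using Bad_in by auto
      show "1 - \<epsilon> \<le> P.prob (space P - Bad)" using Bad_prob Bad_in by (simp add: P.prob_compl)
      fix s assume s: "s \<in> space P - Bad"
      have dev: "\<bar>(\<Sum>i<n. w \<alpha> (fst (s i)) * w \<beta> (fst (s i))) - real n * m1 \<alpha> \<beta>\<bar> \<le> \<delta> * H"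
        if "\<alpha> \<in> A" "\<beta> \<in> A" for \<alpha> \<beta>
      proof -
        have "s \<notin> Bad1 \<alpha> \<beta>" using s that unfolding Bad_def by blast
        then show ?thesis using s unfolding Bad1_def g1_def by auto
      qed
      show "\<bar>\<Sum>i<n. (f (fst (s i)) - snd (s i)) $ e * w \<alpha> (fst (s i))\<bar> \<le> \<tau> * sqrt H" if "mdeg \<alpha> < k" for \<alpha> e
      proof -
        have "s \<notin> Bad2 \<alpha> e" using s that unfolding Bad_def A_def by blast
        then have "\<bar>\<Sum>i<n. w \<alpha> (fst (s i)) * (f (fst (s i)) - snd (s i)) $ e\<bar> \<le> \<tau> * sqrt H"
          using s unfolding Bad2_def g2_def by auto
        then show ?thesis by (simp only: mult.commute)
      qed
      show "real (card (window h n s)) \<le> (V + \<delta>) * H"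
      proof -
        \<comment> \<open>The Gram entry of the constant monomial counts the points of the window.\<close>
        let ?z = "(\<lambda>_. 0) :: 'd \<Rightarrow> nat"
        have "real (card (window h n s)) = (\<Sum>i<n. indicator (cball 0 h) (fst (s i)) *\<^sub>R 1)"
          by (subst sum_window) simp
        also have "\<dots> = (\<Sum>i<n. w ?z (fst (s i)) * w ?z (fst (s i)))"
          unfolding w_def window_monomial_def by (intro sum.cong) (auto simp: indicator_def)
        also have "\<dots> \<le> real n * m1 ?z ?z + \<delta> * H" using dev[OF A0 A0] by linarith
        also have "real n * m1 ?z ?z \<le> real n * (V * h ^ CARD('d))"
          using second'[of ?z] by (intro mult_left_mono) (auto simp: m1_def power2_eq_square)
        finally show ?thesis by (simp add: H_def algebra_simps)
      qed
      fix \<gamma> :: "('d \<Rightarrow> nat) \<Rightarrow> real"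
      have expand: "(\<Sum>\<alpha>\<in>A. \<gamma> \<alpha> * w \<alpha> x)\<^sup>2 = (\<Sum>\<alpha>\<in>A. \<Sum>\<beta>\<in>A. \<gamma> \<alpha> * \<gamma> \<beta> * (w \<alpha> x * w \<beta> x))" for x
        unfolding power2_eq_square sum_product by (intro sum.cong refl) (simp add: mult_ac)
      have int1: "integrable M (\<lambda>\<omega>. w \<alpha> (X \<omega>) * w \<beta> (X \<omega>))" for \<alpha> \<beta>
        using integrable_bounded_times[of "\<lambda>x. w \<alpha> x * w \<beta> x" "\<lambda>_. 1"] ww_1 by simp
      have "(\<integral>\<omega>. (\<Sum>\<alpha>\<in>A. \<gamma> \<alpha> * w \<alpha> (X \<omega>))\<^sup>2 \<partial>M) = (\<Sum>\<alpha>\<in>A. \<Sum>\<beta>\<in>A. \<gamma> \<alpha> * \<gamma> \<beta> * m1 \<alpha> \<beta>)"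
        unfolding expand m1_def using int1 by (simp add: Bochner_Integration.integral_sum)
      then have lower: "lo * c * h ^ CARD('d) * (\<Sum>\<alpha>\<in>A. (\<gamma> \<alpha>)\<^sup>2) \<le> (\<Sum>\<alpha>\<in>A. \<Sum>\<beta>\<in>A. \<gamma> \<alpha> * \<gamma> \<beta> * m1 \<alpha> \<beta>)"
        using window_Gram_lower_bound[OF h c(2), of \<gamma>] unfolding A_def w_def by simp
      have "(\<Sum>i<n. (\<Sum>\<alpha>\<in>A. \<gamma> \<alpha> * w \<alpha> (fst (s i)))\<^sup>2) =
          (\<Sum>\<alpha>\<in>A. \<Sum>\<beta>\<in>A. \<gamma> \<alpha> * \<gamma> \<beta> * (\<Sum>i<n. w \<alpha> (fst (s i)) * w \<beta> (fst (s i))))"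
        unfolding expand sum_distrib_left
        by (subst sum.swap, rule sum.cong[OF refl], subst sum.swap) simp
      then have "real n * (\<Sum>\<alpha>\<in>A. \<Sum>\<beta>\<in>A. \<gamma> \<alpha> * \<gamma> \<beta> * m1 \<alpha> \<beta>) - (\<Sum>i<n. (\<Sum>\<alpha>\<in>A. \<gamma> \<alpha> * w \<alpha> (fst (s i)))\<^sup>2) =
          (\<Sum>\<alpha>\<in>A. \<Sum>\<beta>\<in>A. \<gamma> \<alpha> * \<gamma> \<beta> * (real n * m1 \<alpha> \<beta> - (\<Sum>i<n. w \<alpha> (fst (s i)) * w \<beta> (fst (s i)))))"
        by (simp add: sum_distrib_left sum_subtractf right_diff_distrib mult_ac)
      also have "\<dots> \<le> (\<Sum>\<alpha>\<in>A. \<Sum>\<beta>\<in>A. \<bar>\<gamma> \<alpha>\<bar> * \<bar>\<gamma> \<beta>\<bar> * (\<delta> * H))"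
      proof (intro sum_mono)
        fix \<alpha> \<beta> assume "\<alpha> \<in> A" "\<beta> \<in> A"
        have "\<gamma> \<alpha> * \<gamma> \<beta> * (real n * m1 \<alpha> \<beta> - (\<Sum>i<n. w \<alpha> (fst (s i)) * w \<beta> (fst (s i)))) \<le>
            \<bar>\<gamma> \<alpha> * \<gamma> \<beta> * (real n * m1 \<alpha> \<beta> - (\<Sum>i<n. w \<alpha> (fst (s i)) * w \<beta> (fst (s i))))\<bar>" by simp
        also have "\<dots> \<le> \<bar>\<gamma> \<alpha>\<bar> * \<bar>\<gamma> \<beta>\<bar> * (\<delta> * H)"
          using dev[OF \<open>\<alpha> \<in> A\<close> \<open>\<beta> \<in> A\<close>] unfolding abs_mult by (intro mult_left_mono) (auto simp: abs_minus_commute)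
        finally show "\<gamma> \<alpha> * \<gamma> \<beta> * (real n * m1 \<alpha> \<beta> - (\<Sum>i<n. w \<alpha> (fst (s i)) * w \<beta> (fst (s i)))) \<le>
            \<bar>\<gamma> \<alpha>\<bar> * \<bar>\<gamma> \<beta>\<bar> * (\<delta> * H)" .
      qed
      also have "\<dots> = \<delta> * H * (\<Sum>\<alpha>\<in>A. \<bar>\<gamma> \<alpha>\<bar>)\<^sup>2"
        by (simp add: power2_eq_square sum_product sum_distrib_left mult_ac)
      also have "\<dots> \<le> \<delta> * H * (a * (\<Sum>\<alpha>\<in>A. (\<gamma> \<alpha>)\<^sup>2))"
        using sum_squared_le_sum_of_squares[of "\<lambda>\<alpha>. \<bar>\<gamma> \<alpha>\<bar>" A] \<delta> H finA
        by (intro mult_left_mono) (auto simp: a_def mult.commute)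
      also have "\<dots> = lo * c / 2 * H * (\<Sum>\<alpha>\<in>A. (\<gamma> \<alpha>)\<^sup>2)" using a by (simp add: \<delta>_def)
      finally have up: "real n * (\<Sum>\<alpha>\<in>A. \<Sum>\<beta>\<in>A. \<gamma> \<alpha> * \<gamma> \<beta> * m1 \<alpha> \<beta>) - (\<Sum>i<n. (\<Sum>\<alpha>\<in>A. \<gamma> \<alpha> * w \<alpha> (fst (s i)))\<^sup>2)
        \<le> lo * c / 2 * H * (\<Sum>\<alpha>\<in>A. (\<gamma> \<alpha>)\<^sup>2)" .
      have "real n * (lo * c * h ^ CARD('d) * (\<Sum>\<alpha>\<in>A. (\<gamma> \<alpha>)\<^sup>2)) \<le>
          real n * (\<Sum>\<alpha>\<in>A. \<Sum>\<beta>\<in>A. \<gamma> \<alpha> * \<gamma> \<beta> * m1 \<alpha> \<beta>)"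
        using lower by (intro mult_left_mono) auto
      moreover have "real n * (lo * c * h ^ CARD('d) * (\<Sum>\<alpha>\<in>A. (\<gamma> \<alpha>)\<^sup>2)) = 2 * (lo * c / 2 * H * (\<Sum>\<alpha>\<in>A. (\<gamma> \<alpha>)\<^sup>2))"
        by (simp add: H_def)
      ultimately show "lo * c / 2 * H * (\<Sum>\<alpha>\<in>A. (\<gamma> \<alpha>)\<^sup>2) \<le> (\<Sum>i<n. (\<Sum>\<alpha>\<in>A. \<gamma> \<alpha> * w \<alpha> (fst (s i)))\<^sup>2)"
        using up by linarith
    qed
  qed
qed

end

section \<open>Convergence rate of the basic estimator\<close>

text \<open>The variable \<open>w\<close> is \<open>n\<^bsup>1/(2k+d)\<^esup>\<close>, so that \<open>h\<close> is comparable to \<open>1 / w\<close> and all rates become integer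
  powers of \<open>w\<close>: \<open>n h\<^sup>d\<close> is comparable to \<open>w\<^bsup>2k\<^esup>\<close>, hence the bias \<open>h\<^sup>k\<close> and the noise \<open>(n h\<^sup>d)\<^bsup>-1/2\<^esup>\<close> are
  both of order \<open>w\<^bsup>-k\<^esup>\<close>.\<close>

lemma bias_variance_balance:
  fixes h w l x P Q \<kappa> :: real
  assumes w: "1 \<le> w" and l: "0 < l" "l / 2 \<le> w * h" "w * h \<le> 2 * l"
    and n: "N = w ^ (2 * k + d)" and "j \<le> m" "m \<le> k" and pos: "0 < \<kappa>" "0 \<le> P" "0 \<le> Q"
    and le: "\<kappa> * (N * h ^ d) * (h ^ j * x) \<le> P * (N * h ^ d * h ^ k) + Q * sqrt (N * h ^ d)" and "0 \<le> x"
  shows "x \<le> (P * (2 * l) ^ k + Q / sqrt ((l / 2) ^ d)) / (\<kappa> * (l / 2) ^ j) / w ^ (k - m)"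
proof -
  define t where "t = w * h"
  have h: "h = t / w" using w by (simp add: t_def)
  have t: "t > 0" "l / 2 \<le> t" "t \<le> 2 * l" using l by (auto simp: t_def)
  have w0: "w > 0" using w by simp
  define H where "H = N * h ^ d"
  have H_eq: "H = (w ^ k)\<^sup>2 * t ^ d"
    using w0 by (simp add: H_def n h power_add power_divide power_even_eq)
  have H0: "H > 0" unfolding H_eq using w0 t by simp
  have sq: "sqrt H * sqrt H = H" using H0 by simp
  have "sqrt H \<ge> w ^ k * sqrt ((l / 2) ^ d)"
    unfolding H_eq real_sqrt_mult using w0 t l by (auto intro!: mult_left_mono power_mono)
  then have inv: "1 / sqrt H \<le> 1 / (w ^ k * sqrt ((l / 2) ^ d))"
    using w0 l by (intro divide_left_mono) (auto intro!: mult_pos_pos H0)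
  have hk: "h ^ k \<le> (2 * l) ^ k / w ^ k"
    unfolding h power_divide using t w0 by (intro divide_right_mono power_mono) auto
  have hj: "(l / 2) ^ j / w ^ j \<le> h ^ j"
    unfolding h power_divide[of t] using t w0 l by (intro divide_right_mono power_mono) auto
  have "\<kappa> * (h ^ j * x) = (\<kappa> * H * (h ^ j * x)) / H" using H0 by simp
  also have "\<dots> \<le> (P * (H * h ^ k) + Q * sqrt H) / H"
    using le H0 unfolding H_def by (intro divide_right_mono) auto
  also have "\<dots> = P * h ^ k + Q * (1 / sqrt H)"
    using H0 sq by (simp add: field_simps)
  also have "\<dots> \<le> P * ((2 * l) ^ k / w ^ k) + Q * (1 / (w ^ k * sqrt ((l / 2) ^ d)))"
    using hk inv pos by (intro add_mono mult_left_mono) auto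
  also have "\<dots> = (P * (2 * l) ^ k + Q / sqrt ((l / 2) ^ d)) / w ^ k"
    by (simp add: add_divide_distrib mult.commute)
  finally have 1: "\<kappa> * (h ^ j * x) \<le> (P * (2 * l) ^ k + Q / sqrt ((l / 2) ^ d)) / w ^ k" .
  define C where "C = P * (2 * l) ^ k + Q / sqrt ((l / 2) ^ d)"
  have C: "0 \<le> C" unfolding C_def using pos l by simp
  have "\<kappa> * ((l / 2) ^ j / w ^ j * x) \<le> \<kappa> * (h ^ j * x)"
    using hj pos \<open>0 \<le> x\<close> by (intro mult_left_mono mult_right_mono) auto
  then have "\<kappa> * (l / 2) ^ j * x / w ^ j \<le> C / w ^ k" using 1 unfolding C_def by simp
  then have "\<kappa> * (l / 2) ^ j * x \<le> C / w ^ k * w ^ j" using w0 by (simp add: pos_divide_le_eq)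
  also have "\<dots> \<le> C / w ^ k * w ^ m"
    using w C \<open>j \<le> m\<close> by (intro mult_left_mono power_increasing) auto
  also have "\<dots> = C / w ^ (k - m)" using w0 \<open>m \<le> k\<close> by (simp add: power_diff)
  finally have "x * (\<kappa> * (l / 2) ^ j) \<le> C / w ^ (k - m)" by (simp add: mult.commute)
  then have "x \<le> C / w ^ (k - m) / (\<kappa> * (l / 2) ^ j)"
    using pos l by (subst pos_le_divide_eq) auto
  then show ?thesis unfolding C_def by (simp add: mult.commute)
qed

text \<open>For \<open>k = 0\<close> only the zero polynomial is available, and its derivatives are \<open>0\<close>.\<close>

lemma basic_estimator_order_0:
  assumes "basic_estimator 0 m a h n E" "s \<in> space (sample_space n)"
  shows "E s = 0"
proof -
  obtain \<pi> where "\<pi> \<in> vpolys 0" "E s = diff_op m a \<pi> 0"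
    using assms unfolding basic_estimator_def is_arg_min_def by blast
  then obtain b where "supported_below 0 b" "E s = diff_op m a (vpoly 0 b) 0"
    using vpolys_obtain_supported by metis
  then show ?thesis
    by (simp add: diff_op_def multi_deriv_vpoly_at_0) (simp add: supported_below_def)
qed

text \<open>On the event of regular windows the error of every derivative is controlled by
  \<open>local_polynomial_coefficient_error\<close> and \<open>bias_variance_balance\<close>; all that remains is to collect the
  constants and to check that \<open>n h\<^sup>d\<close> and the window eventually meet the requirements of the concentration
  lemma.\<close>

lemma (in local_regression) basic_estimator_rate:
  fixes bw :: "nat \<Rightarrow> real" and a :: "('d \<Rightarrow> nat) \<Rightarrow> real"
  assumes f: "Ck k f" and "open U" and "m \<le> k"
    and bandwidth: "0 < l"
      "(\<lambda>n. real n powr (1 / (2 * real k + real CARD('d))) * bw n) \<longlonglongrightarrow> l"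
    and r: "r = (real k - real m) / (2 * real k + real CARD('d))"
    and estimator: "\<And>n. basic_estimator k m a (bw n) n (E n)" and "0 < \<epsilon>\<^sub>0"
  shows "\<exists>C. basic_rate (iid_law M X Y) E (diff_op m a f 0) r \<epsilon>\<^sub>0 C"
proof (cases "k = 0")
  case True
  then have "r = 0" "m = 0" using r \<open>m \<le> k\<close> by auto
  have "basic_rate (iid_law M X Y) E (diff_op m a f 0) r \<epsilon>\<^sub>0 (norm (diff_op m a f 0))"
    unfolding basic_rate_def
  proof (rule eventually_sequentiallyI[of 1])
    fix n :: nat assume "1 \<le> n"
    interpret P: prob_space "iid_law M X Y n" by (rule prob_space_iid_law) (auto intro: prob_space_axioms)
    have "{s \<in> space (iid_law M X Y n). norm (E n s - diff_op m a f 0) \<le> norm (diff_op m a f 0) / real n powr r}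
        = space (iid_law M X Y n)"
      using basic_estimator_order_0[of m a "bw n" n "E n"] estimator[of n] True \<open>1 \<le> n\<close>
      by (auto simp: \<open>r = 0\<close> space_iid_law)
    then show "1 - \<epsilon>\<^sub>0 \<le> P.prob {s \<in> space (iid_law M X Y n). norm (E n s - diff_op m a f 0) \<le> norm (diff_op m a f 0) / real n powr r}"
      using \<open>0 < \<epsilon>\<^sub>0\<close> by (simp add: P.prob_space)
  qed
  then show ?thesis by blast
next
  case False
  define d where "d = CARD('d)"
  define q where "q = 2 * k + d"
  have q: "real q = 2 * real k + real d" "q > 0" using False by (auto simp: q_def)
  obtain b K where b: "supported_below k b" "0 \<le> K"
    and deriv: "\<And>\<alpha>. mdeg \<alpha> < k \<Longrightarrow> multi_deriv \<alpha> f 0 = multi_deriv \<alpha> (vpoly k b) 0"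
    and bias: "\<And>x. norm x \<le> 1 \<Longrightarrow> norm (f x - vpoly k b x) \<le> K * norm x ^ k"
    using Taylor_vpoly[OF f] by metis
  obtain \<kappa> N \<tau> H\<^sub>0 where cons: "0 < \<kappa>" "0 \<le> N" "0 \<le> \<tau>"
    and concentrate: "\<And>n h. 0 < h \<Longrightarrow> cball 0 h \<subseteq> U \<Longrightarrow> H\<^sub>0 \<le> real n * h ^ CARD('d) \<Longrightarrow>
      \<exists>G\<in>sets (iid_law M X Y n). measure (iid_law M X Y n) G \<ge> 1 - \<epsilon>\<^sub>0 \<and>
        (\<forall>s\<in>G. regular_window k h n f \<kappa> N \<tau> s)"
    using window_moments_concentrate[of k \<epsilon>\<^sub>0] False \<open>0 < \<epsilon>\<^sub>0\<close> by blast
  obtain r\<^sub>0 where r0: "r\<^sub>0 > 0" "cball 0 r\<^sub>0 \<subseteq> U"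
    using \<open>open U\<close> density_bounds(2) open_contains_cball by blast
  define c where "c = 2 * real (card {\<alpha> :: 'd \<Rightarrow> nat. mdeg \<alpha> < k})"
  define P where "P = c * N * K"
  define Q where "Q = c * real CARD('e) * \<tau>"
  have PQ: "0 \<le> P" "0 \<le> Q" "0 \<le> c" using cons b by (auto simp: P_def Q_def c_def)
  \<comment> \<open>The second case concerns \<open>mdeg \<alpha> = k = m\<close>: the fitted polynomial has no derivative of order \<open>k\<close>, and
    the error is the derivative of \<open>f\<close> itself.\<close>
  define R where "R = (\<lambda>\<alpha> :: 'd \<Rightarrow> nat.
    if mdeg \<alpha> < k then mfact \<alpha> * ((P * (2 * l) ^ k + Q / sqrt ((l / 2) ^ d)) / (\<kappa> * (l / 2) ^ mdeg \<alpha>))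
    else norm (multi_deriv \<alpha> f 0))"
  define C where "C = (\<Sum>\<alpha> | mdeg \<alpha> \<le> m. \<bar>a \<alpha>\<bar> * R \<alpha>)"
  define w where "w = (\<lambda>n. real n powr (1 / real q))"
  have w_lim: "filterlim w at_top sequentially"
  proof -
    have "filterlim (\<lambda>n. exp (1 / real q * ln (real n))) at_top sequentially"
      using q(2)
      by (intro filterlim_compose[OF exp_at_top] filterlim_tendsto_pos_mult_at_top[OF tendsto_const]
          filterlim_compose[OF ln_at_top filterlim_real_sequentially]) auto
    moreover have "\<forall>\<^sub>F n in sequentially. exp (1 / real q * ln (real n)) = w n"
      using eventually_ge_at_top[of "1::nat"] by eventually_elim (auto simp: w_def powr_def)
    ultimately show ?thesis using filterlim_cong by fast
  qed
  \<comment> \<open>For \<open>w n \<ge> W\<close> the bandwidth is at most \<open>1\<close> and at most \<open>r\<^sub>0\<close>, and \<open>n h\<^sup>d \<ge> H\<^sub>0\<close>.\<close>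
  define W where "W = max (max 1 (2 * l)) (max (2 * l / r\<^sub>0) (H\<^sub>0 / (l / 2) ^ d))"
  have "\<forall>\<^sub>F n in sequentially. W \<le> w n" using w_lim by (simp add: filterlim_at_top)
  moreover have "\<forall>\<^sub>F n in sequentially. l / 2 < w n * bw n"
    using order_tendstoD(1)[OF bandwidth(2), of "l / 2"] bandwidth(1) unfolding w_def q d_def by simp
  moreover have "\<forall>\<^sub>F n in sequentially. w n * bw n < 2 * l"
    using order_tendstoD(2)[OF bandwidth(2), of "2 * l"] bandwidth(1) unfolding w_def q d_def by simp
  moreover have "\<forall>\<^sub>F n :: nat in sequentially. 1 \<le> n" by (rule eventually_ge_at_top)
  ultimately have "\<forall>\<^sub>F n in sequentially. measure (iid_law M X Y n)
      {s \<in> space (iid_law M X Y n). norm (E n s - diff_op m a f 0) \<le> C / real n powr r} \<ge> 1 - \<epsilon>\<^sub>0"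
  proof eventually_elim
    case (elim n)
    define h where "h = bw n"
    have w: "1 \<le> w n" "2 * l \<le> w n" "2 * l / r\<^sub>0 \<le> w n" "H\<^sub>0 / (l / 2) ^ d \<le> w n"
      using elim(1) by (auto simp: W_def)
    have w0: "w n > 0" using w by linarith
    have wh: "l / 2 \<le> w n * h" "w n * h \<le> 2 * l" using elim(2,3) by (auto simp: h_def)
    have h: "0 < h" using wh bandwidth(1) w0 by (smt (verit) zero_less_mult_pos half_gt_zero)
    have h_le: "h \<le> 2 * l / w n" using wh(2) w0 by (simp add: pos_le_divide_eq mult.commute)
    also have "\<dots> \<le> 1" using w(2) w0 by simp
    finally have h1: "h \<le> 1" .
    have "2 * l / w n \<le> r\<^sub>0" using w(3) w0 r0(1) by (simp add: field_simps)
    then have hU: "cball 0 h \<subseteq> U" using h_le r0(2) by (meson order_trans subset_cball)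
    have wq: "real n = w n ^ (2 * k + d)"
    proof -
      have "w n ^ q = w n powr real q" using w0 by (simp add: powr_realpow)
      also have "\<dots> = real n" using q(2) elim(4) by (simp add: w_def powr_powr)
      finally show ?thesis by (simp add: q_def)
    qed
    have wr: "real n powr r = w n ^ (k - m)"
    proof -
      have "w n ^ (k - m) = w n powr real (k - m)" using w0 by (simp add: powr_realpow)
      also have "\<dots> = real n powr r"
        using \<open>m \<le> k\<close> unfolding w_def powr_powr r q d_def by (simp add: of_nat_diff)
      finally show ?thesis by simp
    qed
    have H: "H\<^sub>0 \<le> real n * h ^ CARD('d)"
    proof -
      have "H\<^sub>0 \<le> w n * (l / 2) ^ d" using w(4) bandwidth(1) by (simp add: pos_divide_le_eq)
      also have "\<dots> \<le> w n ^ (2 * k) * (w n * h) ^ d"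
        using wh bandwidth(1) w(1) False self_le_power[of "w n" "2 * k"] by (intro mult_mono power_mono) auto
      also have "\<dots> = real n * h ^ CARD('d)" by (simp add: wq power_add power_mult_distrib d_def)
      finally show ?thesis .
    qed
    interpret P: prob_space "iid_law M X Y n" by (rule prob_space_iid_law) (auto intro: prob_space_axioms)
    from concentrate[OF h hU H] obtain G where G: "G \<in> sets (iid_law M X Y n)" "P.prob G \<ge> 1 - \<epsilon>\<^sub>0"
      and curv: "\<And>s \<gamma>. s \<in> G \<Longrightarrow> \<kappa> * (real n * h ^ d) * (\<Sum>\<alpha> | mdeg \<alpha> < k. (\<gamma> \<alpha>)\<^sup>2) \<le>
             (\<Sum>i<n. (\<Sum>\<alpha> | mdeg \<alpha> < k. \<gamma> \<alpha> * window_monomial h \<alpha> (fst (s i)))\<^sup>2)"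
      and count: "\<And>s. s \<in> G \<Longrightarrow> real (card (window h n s)) \<le> N * (real n * h ^ d)"
      and noise: "\<And>s \<alpha> e. s \<in> G \<Longrightarrow> mdeg \<alpha> < k \<Longrightarrow>
             \<bar>\<Sum>i<n. (f (fst (s i)) - snd (s i)) $ e * window_monomial h \<alpha> (fst (s i))\<bar>
               \<le> \<tau> * sqrt (real n * h ^ d)"
      unfolding d_def regular_window_def by blast
    have nh: "real n * h ^ d > 0" using h elim(4) by simp
    have "norm (E n s - diff_op m a f 0) \<le> C / real n powr r" if s: "s \<in> G" for s
    proof -
      have "s \<in> space (iid_law M X Y n)" using s sets.sets_into_space[OF G(1)] by (rule subsetD[rotated])
      then have "s \<in> space (sample_space n)" unfolding space_iid_law .
      then obtain \<pi> where \<pi>: "is_arg_min (empirical_risk h n s) (\<lambda>\<pi>. \<pi> \<in> vpolys k) \<pi>" "E n s = diff_op m a \<pi> 0"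
        using estimator[of n] unfolding basic_estimator_def h_def by blast
      have "\<pi> \<in> vpolys k" using \<pi>(1) by (simp add: is_arg_min_def)
      then obtain b' where b': "supported_below k b'" "\<pi> = vpoly k b'"
        by (rule vpolys_obtain_supported)
      have deriv_error: "norm (multi_deriv \<alpha> \<pi> 0 - multi_deriv \<alpha> f 0) \<le> R \<alpha> / w n ^ (k - m)" if \<alpha>: "mdeg \<alpha> \<le> m" for \<alpha>
      proof (cases "mdeg \<alpha> < k")
        case True
        have "\<kappa> * (real n * h ^ d) * (h ^ mdeg \<alpha> * norm (b' \<alpha> - b \<alpha>)) \<le>
            c * (real (card (window h n s)) * (K * h ^ k) + real CARD('e) * (\<tau> * sqrt (real n * h ^ d)))"
          unfolding c_def
        proof (rule local_polynomial_coefficient_error[OF h _ _ _ _ curv[OF s] noise[OF s] True])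
          show "is_arg_min (empirical_risk h n s) (\<lambda>\<pi>. \<pi> \<in> vpolys k) (vpoly k b')" using \<pi>(1) b'(2) by simp
          fix x :: "real^'d" assume x: "norm x \<le> h"
          have "norm (f x - vpoly k b x) \<le> K * norm x ^ k" using bias x h1 by simp
          also have "\<dots> \<le> K * h ^ k" using x b(2) by (intro mult_left_mono power_mono) auto
          finally show "norm (f x - vpoly k b x) \<le> K * h ^ k" .
        qed (use cons nh b(2) h in auto)
        also have "\<dots> \<le> c * (N * (real n * h ^ d) * (K * h ^ k) + real CARD('e) * (\<tau> * sqrt (real n * h ^ d)))"
          using count[OF s] b(2) h PQ by (intro mult_left_mono add_right_mono mult_right_mono) auto
        also have "\<dots> = P * (real n * h ^ d * h ^ k) + Q * sqrt (real n * h ^ d)"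
          by (simp add: P_def Q_def algebra_simps)
        finally have "norm (b' \<alpha> - b \<alpha>) \<le>
            (P * (2 * l) ^ k + Q / sqrt ((l / 2) ^ d)) / (\<kappa> * (l / 2) ^ mdeg \<alpha>) / w n ^ (k - m)"
          by (rule bias_variance_balance[OF w(1) bandwidth(1) wh wq \<alpha> \<open>m \<le> k\<close> cons(1) PQ(1,2)]) simp
        then have "mfact \<alpha> * norm (b' \<alpha> - b \<alpha>) \<le> R \<alpha> / w n ^ (k - m)"
          using True mfact_pos(1)[of \<alpha>] mult_left_mono[OF _ less_imp_le[OF mfact_pos(1)[of \<alpha>]]]
          unfolding R_def by fastforce
        moreover have "multi_deriv \<alpha> \<pi> 0 - multi_deriv \<alpha> f 0 = mfact \<alpha> *\<^sub>R (b' \<alpha> - b \<alpha>)"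
          by (simp add: deriv[OF True] b'(2) multi_deriv_vpoly_at_0 b b' scaleR_diff_right)
        ultimately show ?thesis by (simp add: abs_of_pos)
      next
        case False
        then have "k - m = 0" using \<alpha> \<open>m \<le> k\<close> by simp
        moreover have "multi_deriv \<alpha> \<pi> 0 = 0"
          using False b'(1) by (simp add: b'(2) multi_deriv_vpoly_at_0) (simp add: supported_below_def)
        ultimately show ?thesis using False by (simp add: R_def)
      qed
      have "E n s - diff_op m a f 0 = (\<Sum>\<alpha> | mdeg \<alpha> \<le> m. a \<alpha> *\<^sub>R (multi_deriv \<alpha> \<pi> 0 - multi_deriv \<alpha> f 0))"
        by (simp add: \<pi>(2) diff_op_def sum_subtractf scaleR_diff_right)
      also have "norm \<dots> \<le> (\<Sum>\<alpha> | mdeg \<alpha> \<le> m. \<bar>a \<alpha>\<bar> * (R \<alpha> / w n ^ (k - m)))"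
      proof (rule sum_norm_le)
        fix \<alpha> :: "'d \<Rightarrow> nat" assume "\<alpha> \<in> {\<alpha>. mdeg \<alpha> \<le> m}"
        then show "norm (a \<alpha> *\<^sub>R (multi_deriv \<alpha> \<pi> 0 - multi_deriv \<alpha> f 0)) \<le> \<bar>a \<alpha>\<bar> * (R \<alpha> / w n ^ (k - m))"
          unfolding norm_scaleR by (intro mult_left_mono deriv_error) auto
      qed
      also have "\<dots> = C / real n powr r" by (simp add: C_def wr sum_divide_distrib)
      finally show ?thesis .
    qed
    then have "G \<subseteq> {s \<in> space (iid_law M X Y n). norm (E n s - diff_op m a f 0) \<le> C / real n powr r}"
      using sets.sets_into_space[OF G(1)] by blast
    moreover have "E n \<in> borel_measurable (iid_law M X Y n)"
      using estimator[of n] unfolding basic_estimator_def by (simp add: measurable_cong_sets[OF sets_iid_law refl])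
    then have "{s \<in> space (iid_law M X Y n). norm (E n s - diff_op m a f 0) \<le> C / real n powr r} \<in> sets (iid_law M X Y n)"
      by measurable
    ultimately show ?case using G(2) P.finite_measure_mono order_trans by blast
  qed
  then show ?thesis unfolding basic_rate_def by blast
qed

section \<open>The median trick\<close>

lemma indep_vars_PiM_coordinates:
  assumes "prob_space N"
  shows "prob_space.indep_vars (PiM I (\<lambda>_. N)) (\<lambda>_. N) (\<lambda>i s. s i) I"
proof -
  interpret N: prob_space N by fact
  interpret P: prob_space "PiM I (\<lambda>_. N)" by (rule prob_space_PiM) (rule assms)
  show ?thesis
  proof (cases "I = {}")
    case True
    then show ?thesis unfolding P.indep_vars_def P.indep_sets_def by auto
  next
    case False
    have "distr (PiM I (\<lambda>_. N)) (PiM I (\<lambda>_. N)) (\<lambda>s. \<lambda>i\<in>I. s i) =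
      distr (PiM I (\<lambda>_. N)) (PiM I (\<lambda>_. N)) (\<lambda>s. s)"
      by (intro distr_cong) (auto simp: space_PiM PiE_def extensional_restrict)
    also have "\<dots> = PiM I (\<lambda>i. distr (PiM I (\<lambda>_. N)) N (\<lambda>s. s i))"
      unfolding distr_id
      by (intro PiM_cong refl distr_PiM_component[symmetric] assms)
    finally show ?thesis
      using False by (subst P.indep_vars_iff_distr_eq_PiM') auto
  qed
qed

text \<open>Only \<open>\<nu> * p \<le> n\<close> is assumed here and in the next lemmas: the last points of the sample may belong to
  no part.\<close>

lemma part_measurable [measurable]:
  assumes "j < \<nu>" "\<nu> * p \<le> n"
  shows "(\<lambda>s. part p s j) \<in> measurable (PiM {..<n} (\<lambda>_. N)) (PiM {..<p} (\<lambda>_. N))"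
  unfolding part_def
proof (rule measurable_restrict)
  fix i assume "i \<in> {..<p}"
  have "Suc j * p \<le> \<nu> * p" using assms by (intro mult_right_mono) auto
  then have "j * p + i \<in> {..<n}" using assms \<open>i \<in> {..<p}\<close> by simp
  then show "(\<lambda>s. s (j * p + i)) \<in> measurable (PiM {..<n} (\<lambda>_. N)) N"
    by (rule measurable_component_singleton)
qed

lemma distr_part:
  assumes "prob_space N" "j < \<nu>" "\<nu> * p \<le> n"
  shows "distr (PiM {..<n} (\<lambda>_. N)) (PiM {..<p} (\<lambda>_. N)) (\<lambda>s. part p s j) = PiM {..<p} (\<lambda>_. N)"
proof -
  have "Suc j * p \<le> \<nu> * p" using assms by (intro mult_right_mono) auto
  then have "(\<lambda>i. j * p + i) \<in> {..<p} \<rightarrow> {..<n}" using assms by auto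
  then show ?thesis
    unfolding part_def using assms(1)
    by (intro distr_PiM_reindex[where M = "\<lambda>_. N" and f = "\<lambda>i. j * p + i"]) auto
qed

text \<open>Different parts read disjoint blocks of coordinates.\<close>

lemma indep_vars_part:
  assumes "prob_space N" "\<nu> * p \<le> n"
  shows "prob_space.indep_vars (PiM {..<n} (\<lambda>_. N)) (\<lambda>_. PiM {..<p} (\<lambda>_. N))
    (\<lambda>j s. part p s j) {..<\<nu>}"
proof -
  interpret P: prob_space "PiM {..<n} (\<lambda>_. N)" by (rule prob_space_PiM) (rule assms)
  define K where "K j = {j * p..<Suc j * p}" for j
  have sub: "K j \<subseteq> {..<n}" if "j \<in> {..<\<nu>}" for j
  proof -
    have "Suc j * p \<le> \<nu> * p" using that by (intro mult_right_mono) auto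
    with assms(2) show ?thesis by (auto simp: K_def)
  qed
  have disj: "disjoint_family_on K {..<\<nu>}"
    unfolding disjoint_family_on_def
  proof safe
    fix i j x assume "i \<noteq> j" "x \<in> K i" "x \<in> K j"
    then have "x div p = i" "x div p = j" 
      by (auto simp: K_def intro!: div_nat_eqI simp: algebra_simps)
    with \<open>i \<noteq> j\<close> show "x \<in> {}" by simp
  qed
  have "P.indep_vars (\<lambda>j. PiM (K j) (\<lambda>_. N)) (\<lambda>j s. restrict (\<lambda>i. s i) (K j)) {..<\<nu>}"
    by (rule P.indep_vars_restrict[OF indep_vars_PiM_coordinates[OF assms(1)] sub disj])
  then have "P.indep_vars (\<lambda>_. PiM {..<p} (\<lambda>_. N))
      (\<lambda>j s. (\<lambda>t. \<lambda>i\<in>{..<p}. t (j * p + i)) (restrict (\<lambda>i. s i) (K j))) {..<\<nu>}"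
    by (rule P.indep_vars_compose2, intro measurable_restrict measurable_component_singleton)
       (auto simp: K_def)
  also have "(\<lambda>j s. (\<lambda>t. \<lambda>i\<in>{..<p}. t (j * p + i)) (restrict (\<lambda>i. s i) (K j))) = (\<lambda>j s. part p s j)"
    unfolding part_def K_def by (intro ext) (auto simp: restrict_def)
  finally show ?thesis .
qed

lemma card_parts_eq_sum_indicator:
  fixes \<nu> :: nat
  shows "real (card {j \<in> {..<\<nu>}. t j \<in> G}) = (\<Sum>j\<in>{..<\<nu>}. indicator G (t j))"
proof -
  have "(\<Sum>j\<in>{..<\<nu>}. indicator G (t j) :: real) = (\<Sum>j\<in>{..<\<nu>}. if t j \<in> G then 1 else 0)"
    by (intro sum.cong) (auto simp: indicator_def)
  also have "\<dots> = real (card {j \<in> {..<\<nu>}. t j \<in> G})"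
    by (subst sum.If_cases) (auto intro!: arg_cong[where f = card])
  finally show ?thesis by simp
qed

text \<open>The number of good parts is a sum of independent indicators with mean at least \<open>\<nu> (1 - e)\<close>, which
  exceeds \<open>\<nu> / 2\<close> by a multiple of \<open>\<nu>\<close>.\<close>

lemma majority_of_parts_good:
  assumes N: "prob_space N" and p: "\<nu> * p \<le> n" and "\<nu> \<ge> 1"
    and G: "G \<in> sets (PiM {..<p} (\<lambda>_. N))"
    and good: "measure (PiM {..<p} (\<lambda>_. N)) G \<ge> 1 - e" and e: "e < 1 / 2"
  shows "measure (PiM {..<n} (\<lambda>_. N))
     {s \<in> space (PiM {..<n} (\<lambda>_. N)). real (card {j \<in> {..<\<nu>}. part p s j \<in> G}) \<le> real \<nu> / 2}
     \<le> exp (- 2 * (1 / 2 - e)\<^sup>2 * real \<nu>)"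
proof -
  interpret P: prob_space "PiM {..<n} (\<lambda>_. N)" by (rule prob_space_PiM) (rule N)
  define W where "W j s = (indicator G (part p s j) :: real)" for j s
  have "P.indep_vars (\<lambda>_. borel) (\<lambda>j s. (\<lambda>t. indicator G t :: real) (part p s j)) {..<\<nu>}"
    by (rule P.indep_vars_compose2[OF indep_vars_part[OF N p]]) (rule borel_measurable_indicator[OF G])
  then have indep: "P.indep_vars (\<lambda>_. borel) W {..<\<nu>}" by (simp add: W_def[abs_def])
  have EW: "P.expectation (W j) = measure (PiM {..<p} (\<lambda>_. N)) G" if "j < \<nu>" for j
  proof -
    have "measure (PiM {..<p} (\<lambda>_. N)) G =
        (\<integral>t. indicator G t \<partial>distr (PiM {..<n} (\<lambda>_. N)) (PiM {..<p} (\<lambda>_. N)) (\<lambda>s. part p s j))"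
      using G by (simp add: distr_part[OF N that p])
    also have "\<dots> = P.expectation (W j)"
      unfolding W_def using part_measurable[OF that p] G
      by (subst integral_distr) auto
    finally show ?thesis by simp
  qed
  interpret H: Hoeffding_ineq "PiM {..<n} (\<lambda>_. N)" "{..<\<nu>}" W "\<lambda>_. 0" "\<lambda>_. 1"
      "\<Sum>j\<in>{..<\<nu>}. P.expectation (W j)"
    by unfold_locales (auto simp: indep W_def)
  define \<mu> where "\<mu> = (\<Sum>j\<in>{..<\<nu>}. P.expectation (W j))"
  have "\<mu> = real \<nu> * measure (PiM {..<p} (\<lambda>_. N)) G" unfolding \<mu>_def by (simp add: EW)
  moreover have "real \<nu> * measure (PiM {..<p} (\<lambda>_. N)) G \<ge> real \<nu> * (1 - e)"
    using good by (intro mult_left_mono) auto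
  ultimately have dev: "\<mu> - real \<nu> / 2 \<ge> real \<nu> * (1 / 2 - e)" by (simp add: algebra_simps)
  moreover have "real \<nu> * (1 / 2 - e) \<ge> 0" using e by simp
  ultimately have dev2: "(\<mu> - real \<nu> / 2)\<^sup>2 \<ge> (real \<nu> * (1 / 2 - e))\<^sup>2" and dev0: "\<mu> - real \<nu> / 2 \<ge> 0"
    by (auto intro!: power_mono)
  have card_eq: "real (card {j \<in> {..<\<nu>}. part p s j \<in> G}) = (\<Sum>j\<in>{..<\<nu>}. W j s)" for s
    unfolding W_def by (rule card_parts_eq_sum_indicator)
  have "P.prob {s \<in> space (PiM {..<n} (\<lambda>_. N)). (\<Sum>j\<in>{..<\<nu>}. W j s) \<le> \<mu> - (\<mu> - real \<nu> / 2)}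
      \<le> exp (- 2 * (\<mu> - real \<nu> / 2)\<^sup>2 / (\<Sum>j\<in>{..<\<nu>}. (1 - 0)\<^sup>2))"
    unfolding \<mu>_def using dev0 \<open>\<nu> \<ge> 1\<close>
    by (intro H.Hoeffding_ineq_le) (auto simp: \<mu>_def)
  also have "\<dots> \<le> exp (- 2 * (1 / 2 - e)\<^sup>2 * real \<nu>)"
  proof -
    have "(1 / 2 - e)\<^sup>2 * real \<nu> * real \<nu> \<le> (\<mu> - real \<nu> / 2)\<^sup>2"
      using dev2 by (simp add: power2_eq_square mult_ac)
    then have "(1 / 2 - e)\<^sup>2 * real \<nu> \<le> (\<mu> - real \<nu> / 2)\<^sup>2 / real \<nu>"
      using \<open>\<nu> \<ge> 1\<close> by (simp add: pos_le_divide_eq)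
    then show ?thesis by simp
  qed
  finally show ?thesis unfolding card_eq by (simp only: diff_diff_eq2 add_diff_cancel_left')
qed

lemma two_majorities_meet:
  assumes "contains_majority \<nu> t A" "contains_majority \<nu> t B"
  obtains z where "z \<in> A" "z \<in> B"
proof -
  let ?S = "\<lambda>A. {j \<in> {..<\<nu>}. t j \<in> A}"
  have "?S A \<inter> ?S B \<noteq> {}"
  proof
    assume "?S A \<inter> ?S B = {}"
    then have "card (?S A) + card (?S B) = card (?S A \<union> ?S B)" by (intro card_Un_disjoint[symmetric]) auto
    also have "\<dots> \<le> card {..<\<nu>}" by (intro card_mono) auto
    finally show False using assms unfolding contains_majority_def by simp
  qed
  then show ?thesis using that by auto
qed

text \<open>A part has \<open>n div \<nu>\<close> points, which can be fewer than \<open>n / \<nu>\<close>, but at least half as many.  Since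
  \<open>r \<le> 1\<close>, the accuracy of a part is then at worst twice \<open>C \<nu>\<^sup>r / n\<^sup>r\<close>, and this is the radius of the
  ball.\<close>

lemma median_trick_error_bound:
  fixes \<theta> :: "real^'e::finite"
  assumes T: "median_trick E C r \<nu> n T" and s: "s \<in> space (sample_space n)"
    and r: "0 \<le> r" "r \<le> 1" and C: "0 \<le> C" and "1 \<le> \<nu>" "\<nu> \<le> n"
    and maj: "real (card {j \<in> {..<\<nu>}.
        norm (E (n div \<nu>) (part (n div \<nu>) s j) - \<theta>) \<le> C / real (n div \<nu>) powr r}) > real \<nu> / 2"
  shows "norm (T s - \<theta>) \<le> 4 * C * real \<nu> powr r / real n powr r"
proof -
  define p where "p = n div \<nu>"
  define t where "t = (\<lambda>j. E p (part p s j))"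
  define R where "R = 2 * C * real \<nu> powr r / real n powr r"
  have "p \<ge> 1" using assms(6,7) unfolding p_def by (metis One_nat_def Suc_leI div_greater_zero_iff gr0I not_one_le_zero le_zero_eq)
  have "n \<le> \<nu> * (2 * p)"
  proof -
    have "n = \<nu> * p + n mod \<nu>" unfolding p_def by simp
    also have "\<dots> \<le> \<nu> * p + \<nu>" using \<open>1 \<le> \<nu>\<close> by (intro add_left_mono less_imp_le mod_less_divisor) auto
    also have "\<dots> \<le> \<nu> * p + \<nu> * p" using \<open>p \<ge> 1\<close> by (intro add_left_mono) simp
    finally show ?thesis by simp
  qed
  then have "real n \<le> real \<nu> * (2 * real p)"
    using of_nat_mono[where 'a = real] by fastforce
  then have "real n powr r \<le> (real \<nu> * (2 * real p)) powr r" using r by (intro powr_mono2) auto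
  also have "\<dots> = 2 powr r * (real \<nu> powr r * real p powr r)" by (simp add: powr_mult)
  also have "\<dots> \<le> 2 * (real \<nu> powr r * real p powr r)"
    using r powr_mono[of r 1 "2::real"] by (intro mult_right_mono) auto
  finally have le: "real n powr r \<le> 2 * (real \<nu> powr r * real p powr r)" .
  have pos: "real n powr r > 0" "real p powr r > 0" using \<open>p \<ge> 1\<close> \<open>1 \<le> \<nu>\<close> \<open>\<nu> \<le> n\<close> by auto
  have "C * real n powr r \<le> C * (2 * (real \<nu> powr r * real p powr r))"
    using C le by (rule mult_left_mono[rotated])
  then have "C / real p powr r \<le> R"
    using pos unfolding R_def by (simp add: field_simps)
  then have sub: "{j \<in> {..<\<nu>}. norm (t j - \<theta>) \<le> C / real p powr r} \<subseteq> {j \<in> {..<\<nu>}. t j \<in> cball \<theta> R}"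
    by (auto simp: dist_norm norm_minus_commute)
  have "card {j \<in> {..<\<nu>}. norm (t j - \<theta>) \<le> C / real p powr r} \<le> card {j \<in> {..<\<nu>}. t j \<in> cball \<theta> R}"
    using sub by (intro card_mono) auto
  then have 1: "contains_majority \<nu> t (cball \<theta> R)"
    using maj unfolding contains_majority_def t_def p_def by linarith
  moreover have "(\<exists>z. contains_majority \<nu> t (cball z R)) \<longrightarrow> contains_majority \<nu> t (cball (T s) R)"
    using T s unfolding median_trick_def Let_def p_def t_def R_def by blast
  ultimately have "contains_majority \<nu> t (cball (T s) R)" by blast
  with 1 obtain z where "z \<in> cball \<theta> R" "z \<in> cball (T s) R" by (rule two_majorities_meet)
  then have "dist (T s) \<theta> \<le> R + R"
    by (metis dist_triangle_le add_mono dist_commute mem_cball)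
  then show ?thesis by (simp add: dist_norm R_def)
qed

text \<open>The number of parts is \<open>\<kappa> ln (1 / \<epsilon>)\<close> rounded up, with \<open>\<kappa>\<close> such that Hoeffding's bound is at most \<open>\<epsilon>\<close>.
  Rounding adds up to \<open>1\<close>, which is at most a multiple of \<open>ln (1 / \<epsilon>)\<close> because \<open>\<epsilon> \<le> q < 1\<close>.  The bound
  \<open>N\<^sub>0\<close> ensures that every part is large enough for the assumed rate of the estimator to hold.\<close>

theorem median_trick_exponential_concentration:
  fixes X :: "'a \<Rightarrow> real^'d::finite" and Y :: "'a \<Rightarrow> real^'e::finite"
  assumes M: "prob_space M" "X \<in> borel_measurable M" "Y \<in> borel_measurable M"
    and meas: "\<And>n. E n \<in> borel_measurable (sample_space n)"
    and r: "0 \<le> r" "r \<le> 1" and e: "0 < \<epsilon>\<^sub>0" "\<epsilon>\<^sub>0 < 1 / 2" and q: "0 < q" "q < 1"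
    and rate: "basic_rate (iid_law M X Y) E \<theta> r \<epsilon>\<^sub>0 C"
  shows "\<exists>C\<^sub>0>0. \<exists>c\<^sub>0>0. \<exists>N\<^sub>0>0. \<forall>\<epsilon>. 0 < \<epsilon> \<and> \<epsilon> \<le> q \<longrightarrow>
        (\<exists>\<nu>\<ge>1. real \<nu> \<le> c\<^sub>0 * ln (1 / \<epsilon>) \<and>
          (\<forall>n T. real n > N\<^sub>0 * ln (1 / \<epsilon>) \<and> median_trick E C r \<nu> n T \<longrightarrow>
            measure (iid_law M X Y n)
              {s \<in> space (iid_law M X Y n).
                 norm (T s - \<theta>)
                   > C\<^sub>0 * c\<^sub>0 powr r * ln (1 / \<epsilon>) powr r / real n powr r} \<le> \<epsilon>))"
proof -
  let ?N = "distr M borel (\<lambda>\<omega>. (X \<omega>, Y \<omega>))"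
  let ?G = "\<lambda>p. {s \<in> space (iid_law M X Y p). norm (E p s - \<theta>) \<le> C / real p powr r}"
  have [measurable]: "E n \<in> borel_measurable (iid_law M X Y n)" for n
    using meas by (simp add: measurable_cong_sets[OF sets_iid_law refl])
  obtain n0 where n0: "\<And>p. p \<ge> n0 \<Longrightarrow> measure (iid_law M X Y p) (?G p) \<ge> 1 - \<epsilon>\<^sub>0"
    using rate unfolding basic_rate_def eventually_sequentially by blast
  define n1 where "n1 = max 1 n0"
  \<comment> \<open>A negative \<open>C\<close> makes the event in \<open>basic_rate\<close> empty.\<close>
  have C: "0 \<le> C"
  proof (rule ccontr)
    assume "\<not> 0 \<le> C"
    then have "C / real n1 powr r < 0" by (simp add: n1_def divide_neg_pos)
    then have "?G n1 = {}" by (smt (verit) Collect_empty_eq norm_ge_zero)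
    moreover have "measure (iid_law M X Y n1) (?G n1) \<ge> 1 - \<epsilon>\<^sub>0" by (rule n0) (simp add: n1_def)
    ultimately show False using e by (metis diff_gt_0_iff_gt field_sum_of_halves measure_empty
          not_le order_less_trans zero_less_one less_add_same_cancel1 half_gt_zero_iff)
  qed
  define D where "D = (1 / 2 - \<epsilon>\<^sub>0)\<^sup>2"
  have D: "D > 0" using e by (simp add: D_def)
  define \<kappa> where "\<kappa> = 1 / (2 * D)"
  define c0 where "c0 = \<kappa> + 1 / ln (1 / q)"
  have \<kappa>: "\<kappa> > 0" using D by (simp add: \<kappa>_def)
  have lnq: "ln (1 / q) > 0" using q by (simp add: ln_div)
  have c0: "c0 > 0" using \<kappa> lnq by (simp add: c0_def add_pos_pos)
  have pos: "4 * C + 1 > 0" "real n1 * c0 > 0" using C c0 by (auto simp: n1_def)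
  show ?thesis
  proof (rule exI[of _ "4 * C + 1"], rule conjI[OF pos(1)], rule exI[of _ c0], rule conjI[OF c0],
      rule exI[of _ "real n1 * c0"], rule conjI[OF pos(2)], intro allI impI)
    fix \<epsilon> assume eps: "0 < \<epsilon> \<and> \<epsilon> \<le> q"
    define \<Lambda> where "\<Lambda> = ln (1 / \<epsilon>)"
    have "ln (1 / q) \<le> \<Lambda>" unfolding \<Lambda>_def using eps q by (simp add: frac_le)
    then have \<Lambda>: "\<Lambda> > 0" "\<Lambda> / ln (1 / q) \<ge> 1" using lnq by auto
    define \<nu> where "\<nu> = nat \<lceil>\<kappa> * \<Lambda>\<rceil>"
    have \<nu>: "real \<nu> \<ge> \<kappa> * \<Lambda>" "real \<nu> \<le> \<kappa> * \<Lambda> + 1"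
      using \<kappa> \<Lambda> unfolding \<nu>_def by (auto simp: of_nat_ceiling)
    then have "real \<nu> > 0" using \<kappa> \<Lambda> by (smt (verit) mult_pos_pos)
    then have \<nu>1: "\<nu> \<ge> 1" by simp
    have \<nu>c: "real \<nu> \<le> c0 * \<Lambda>" using \<nu>(2) \<Lambda>(2) unfolding c0_def by (simp add: algebra_simps)
    have exp_le: "exp (- 2 * D * real \<nu>) \<le> \<epsilon>"
    proof -
      have "2 * D * (\<kappa> * \<Lambda>) \<le> 2 * D * real \<nu>"
        using \<nu>(1) D by (intro mult_left_mono) auto
      moreover have "2 * D * (\<kappa> * \<Lambda>) = \<Lambda>" using D by (simp add: \<kappa>_def)
      moreover have "ln \<epsilon> = - \<Lambda>" using eps by (simp add: \<Lambda>_def ln_div)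
      ultimately have "- 2 * D * real \<nu> \<le> ln \<epsilon>" by linarith
      then show ?thesis using eps by (metis exp_le_cancel_iff exp_ln)
    qed
    show "\<exists>\<nu>\<ge>1. real \<nu> \<le> c0 * ln (1 / \<epsilon>) \<and>
          (\<forall>n T. real n > real n1 * c0 * ln (1 / \<epsilon>) \<and> median_trick E C r \<nu> n T \<longrightarrow>
            measure (iid_law M X Y n)
              {s \<in> space (iid_law M X Y n). norm (T s - \<theta>)
                   > (4 * C + 1) * c0 powr r * ln (1 / \<epsilon>) powr r / real n powr r} \<le> \<epsilon>)"
      unfolding \<Lambda>_def[symmetric]
    proof (intro exI[of _ \<nu>] conjI allI impI)
      fix n T assume *: "real n > real n1 * c0 * \<Lambda> \<and> median_trick E C r \<nu> n T"
      define p where "p = n div \<nu>"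
      interpret P: prob_space "iid_law M X Y n" by (rule prob_space_iid_law[OF M])
      have "real (n1 * \<nu>) \<le> real n1 * (c0 * \<Lambda>)" using \<nu>c by (simp add: mult_left_mono)
      also have "\<dots> < real n" using * by (simp add: mult_ac)
      finally have n1n: "n1 * \<nu> \<le> n" by linarith
      then have "n1 \<le> p" unfolding p_def using \<nu>1 by (simp add: less_eq_div_iff_mult_less_eq)
      have "1 \<le> n1" by (simp add: n1_def)
      then have "\<nu> \<le> n" using n1n by (metis mult_1 mult_le_mono1 order_trans)
      have vp: "\<nu> * p \<le> n" unfolding p_def by simp
      have Gs: "?G p \<in> sets (iid_law M X Y p)" by measurable
      let ?bad = "{s \<in> space (iid_law M X Y n). real (card {j \<in> {..<\<nu>}. part p s j \<in> ?G p}) \<le> real \<nu> / 2}"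
      let ?err = "{s \<in> space (iid_law M X Y n). norm (T s - \<theta>)
                   > (4 * C + 1) * c0 powr r * \<Lambda> powr r / real n powr r}"
      have in_space: "part p s j \<in> space (iid_law M X Y p)" for s j
        unfolding part_def space_iid_law sample_space_def space_PiM by auto
      have "?err \<subseteq> ?bad"
      proof (safe, rule ccontr)
        fix s assume s: "s \<in> space (iid_law M X Y n)"
          and err: "norm (T s - \<theta>) > (4 * C + 1) * c0 powr r * \<Lambda> powr r / real n powr r"
          and "\<not> real (card {j \<in> {..<\<nu>}. part p s j \<in> ?G p}) \<le> real \<nu> / 2"
        then have "real (card {j \<in> {..<\<nu>}. norm (E p (part p s j) - \<theta>) \<le> C / real p powr r}) > real \<nu> / 2"
          using in_space by simp
        then have "norm (T s - \<theta>) \<le> 4 * C * real \<nu> powr r / real n powr r"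
          using s * \<nu>1 \<open>\<nu> \<le> n\<close> r C unfolding p_def space_iid_law
          by (intro median_trick_error_bound) auto
        also have "\<dots> \<le> (4 * C + 1) * (c0 * \<Lambda>) powr r / real n powr r"
          using \<nu>c C r by (intro divide_right_mono mult_mono powr_mono2) auto
        also have "\<dots> = (4 * C + 1) * c0 powr r * \<Lambda> powr r / real n powr r"
          using c0 \<Lambda> by (simp add: powr_mult)
        finally show False using err by simp
      qed
      moreover have bad_le: "P.prob ?bad \<le> exp (- 2 * D * real \<nu>)"
      proof -
        have "n0 \<le> p" using \<open>n1 \<le> p\<close> by (simp add: n1_def)
        from majority_of_parts_good[OF prob_space_iid_law(1)[OF M] vp \<nu>1
            Gs[unfolded iid_law_def] n0[OF this, unfolded iid_law_def] e(2)]
        show ?thesis unfolding iid_law_def D_def .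
      qed
      moreover have "?bad \<in> sets (iid_law M X Y n)"
      proof -
        have [measurable]: "(\<lambda>s. part p s j) \<in> measurable (iid_law M X Y n) (iid_law M X Y p)" if "j \<in> {..<\<nu>}" for j
          using part_measurable[of j \<nu> p n ?N] that vp unfolding iid_law_def by simp
        have "(\<lambda>s. \<Sum>j\<in>{..<\<nu>}. indicator (?G p) (part p s j) :: real) \<in> borel_measurable (iid_law M X Y n)"
          using Gs by (intro borel_measurable_sum) measurable
        then show ?thesis unfolding card_parts_eq_sum_indicator by measurable
      qed
      ultimately have "P.prob ?err \<le> P.prob ?bad" by (intro P.finite_measure_mono)
      then show "P.prob ?err \<le> \<epsilon>" using bad_le exp_le by linarith
    qed (use \<nu>1 \<nu>c in auto)
  qed
qed

section \<open>The rate of the median trick\<close>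

theorem theorem3p2:
  fixes M :: "'a measure"
    and X :: "'a \<Rightarrow> real^'d::finite"
    and Y :: "'a \<Rightarrow> real^'e::finite"
    and f :: "real^'d \<Rightarrow> real^'e"
    and \<rho> :: "real^'d \<Rightarrow> real" and U :: "(real^'d) set" and lo hi :: real
    and c :: real
    and k m :: nat and a :: "('d \<Rightarrow> nat) \<Rightarrow> real"
    and bw :: "nat \<Rightarrow> real" and l :: real
    and E :: "nat \<Rightarrow> ('d, 'e) sample \<Rightarrow> real^'e"
    and r \<epsilon>\<^sub>0 q :: real
  assumes "prob_space M"
    and "Ck k f"
    and density: "distributed M lborel X (\<lambda>x. ennreal (\<rho> x))"
    and density_bounds: "open U" "0 \<in> U" "0 < lo" "\<forall>x\<in>U. lo \<le> \<rho> x \<and> \<rho> x \<le> hi"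
    and regression: "integrable M Y" "AE \<omega> in M. cond_mean M X Y \<omega> = f (X \<omega>)"
    and noise: "integrable M (\<lambda>\<omega>. (norm (f (X \<omega>) - Y \<omega>))\<^sup>2)"
      "AE \<omega> in M. onorm ((*v) (cond_cov M X (\<lambda>\<omega>. f (X \<omega>) - Y \<omega>) \<omega>)) \<le> sqrt (c / real CARD('e))"
    and "m \<le> k"
    and bandwidth: "0 < l"
      "(\<lambda>n. real n powr (1 / (2 * real k + real CARD('d))) * bw n) \<longlonglongrightarrow> l"
    and r_def: "r = (real k - real m) / (2 * real k + real CARD('d))"
    and estimator: "\<forall>n. basic_estimator k m a (bw n) n (E n)"
    and "0 < \<epsilon>\<^sub>0" "\<epsilon>\<^sub>0 < 1 / 2"
    and "0 < q" "q < 1"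
  shows "(\<exists>C. basic_rate (iid_law M X Y) E (diff_op m a f 0) r \<epsilon>\<^sub>0 C) \<and>
    (\<forall>C. basic_rate (iid_law M X Y) E (diff_op m a f 0) r \<epsilon>\<^sub>0 C \<longrightarrow>
      (\<exists>C\<^sub>0>0. \<exists>c\<^sub>0>0. \<exists>N\<^sub>0>0. \<forall>\<epsilon>. 0 < \<epsilon> \<and> \<epsilon> \<le> q \<longrightarrow>
        (\<exists>\<nu>\<ge>1. real \<nu> \<le> c\<^sub>0 * ln (1 / \<epsilon>) \<and>
          (\<forall>n T. real n > N\<^sub>0 * ln (1 / \<epsilon>) \<and> median_trick E C r \<nu> n T \<longrightarrow>
            measure (iid_law M X Y n)
              {s \<in> space (iid_law M X Y n).
                 norm (T s - diff_op m a f 0)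
                   > C\<^sub>0 * c\<^sub>0 powr r * ln (1 / \<epsilon>) powr r / real n powr r} \<le> \<epsilon>))))"
proof -
  interpret local_regression M X Y f \<rho> U lo hi "sqrt (c / real CARD('e))"
    using assms(1) Ck_imp_continuous[OF assms(2)] density density_bounds regression noise
    by (intro local_regression.intro local_regression_axioms.intro) auto
  have r: "0 \<le> r" "r \<le> 1" using \<open>m \<le> k\<close> by (auto simp: r_def divide_le_eq)
  show ?thesis
  proof (intro conjI allI impI)
    show "\<exists>C. basic_rate (iid_law M X Y) E (diff_op m a f 0) r \<epsilon>\<^sub>0 C"
      using \<open>Ck k f\<close> \<open>open U\<close> \<open>m \<le> k\<close> bandwidth r_def estimator \<open>0 < \<epsilon>\<^sub>0\<close>
      by (intro basic_estimator_rate[where bw = bw and l = l and k = k]) auto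
    fix C assume "basic_rate (iid_law M X Y) E (diff_op m a f 0) r \<epsilon>\<^sub>0 C"
    then show "\<exists>C\<^sub>0>0. \<exists>c\<^sub>0>0. \<exists>N\<^sub>0>0. \<forall>\<epsilon>. 0 < \<epsilon> \<and> \<epsilon> \<le> q \<longrightarrow>
        (\<exists>\<nu>\<ge>1. real \<nu> \<le> c\<^sub>0 * ln (1 / \<epsilon>) \<and>
          (\<forall>n T. real n > N\<^sub>0 * ln (1 / \<epsilon>) \<and> median_trick E C r \<nu> n T \<longrightarrow>
            measure (iid_law M X Y n)
              {s \<in> space (iid_law M X Y n).
                 norm (T s - diff_op m a f 0)
                   > C\<^sub>0 * c\<^sub>0 powr r * ln (1 / \<epsilon>) powr r / real n powr r} \<le> \<epsilon>))"
      using estimator r \<open>0 < \<epsilon>\<^sub>0\<close> \<open>\<epsilon>\<^sub>0 < 1 / 2\<close> \<open>0 < q\<close> \<open>q < 1\<close> prob_space_axioms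
      by (intro median_trick_exponential_concentration) (auto simp: basic_estimator_def)
  qed
qed

end
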